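(* Let $k,n,s$ be positive integers, $\vec m=(m_1,\dots,m_n)\in\mathbb Z_{>0}^n$, $\kappa\in\mathbb Q^\times$, and let $p>2$ be a prime that does not divide the numerator of $\kappa$. Choose positive integers $M_l$ ($1\le l\le n$), $M_{i,j}$ ($1\le i<j\le n$) and $M^0$ such that, modulo $p^s$, $$M_l\equiv-\frac{m_l}{\kappa},\qquad M_{i,j}\equiv\frac{m_im_j}{2\kappa},\qquad M^0\equiv\frac2\kappa .$$ Let $t=(t_1,\dots,t_k)$, $z=(z_1,\dots,z_n)$ and $$\Phi_s(t,z,\lambda)=\prod_{l=1}^nE_s\Big(p\frac{m_lz_l\lambda}{2\kappa}\Big)\prod_{i=1}^kE_s\Big(-p\frac{t_i\lambda}{\kappa}\Big)\prod_{1\le i<j\le n}(z_i-z_j)^{M_{i,j}}\prod_{1\le i<j\le k}(t_i-t_j)^{M^0}\prod_{l=1}^n\prod_{i=1}^k(t_i-z_l)^{M_l},$$ $$\Psi_s(t,z,\lambda)=\sum_{J\in\mathcal I_k}\Phi_s(t,z,\lambda)\,W_J(t,z)\,f_Jv ,$$ a polynomial in $t,z,\lambda$ with coefficients in $\mathbb Z_p$ (with respect to the basis $f_Jv$). For a vector $\ell=(\ell_1,\dots,\ell_k)$ with positive integer coordinates, let $I^\ell(z,\lambda)$ be the coefficient of $t_1^{\ell_1p^s-1}\cdots t_k^{\ell_kp^s-1}$ in $\Psi_s(t,z,\lambda)$. (1) If $\lambda\in\mathbb Z_p$, then $I=I^\ell(z,\lambda)$ is a solution modulo $p^s$ of the KZ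 equations $$\frac{\partial I}{\partial z_i}=\frac1\kappa\Big(p\frac\lambda2h^{(i)}+\sum_{j\ne i}\frac{\Omega^{(i,j)}}{z_i-z_j}\Big)I,\qquad i=1,\dots,n.$$ (2) If $\lambda\in\mathbb Z_p^\times$, then $I=I^\ell(z,\lambda)$ is a solution modulo $p^s$ of the dynamical equation $$\frac{\partial I}{\partial\lambda}=\frac1\kappa\Big(p\sum_{i=1}^n\frac{z_i}2h^{(i)}+\sum_{i,j=1}^n\frac{f^{(i)}e^{(j)}}{\lambda}\Big)I.$$
   Context: $\mathbb Z_p$ is the ring of $p$-adic integers. Congruences modulo $p^s$ between rational numbers lying in $\mathbb Z_p$ are taken in $\mathbb Z_p$. Exponential polynomial: $d(s)=\left[s\frac{p-1}{p-2}\right]+1$ and $E_s(x)=\sum_{k=0}^{d(s)}\frac{x^k}{k!}$. Lie algebra: $\mathfrak{sl}_2$ has basis $e,f,h$ with $[e,f]=h$, $[h,e]=2e$, $[h,f]=-2f$, and $\Omega=e\otimes f+f\otimes e+\frac12h\otimes h$. For $x\in\mathfrak{sl}_2$, $x^{(i)}$ acts on a tensor product of $n$ modules by $x$ in the $i$-th factor and by the identity in the others; $\Omega^{(i,j)}$ acts by $\Omega$ in the $i$-th and $j$-th factors. Modules: for $m\in\mathbb Z_{\ge0}$, $L_m$ is the module with basis $v_m,fv_m,\dots,f^mv_m$ and action $f\cdot f^kv_m=f^{k+1}v_m$ for $k<m$, $f\cdot f^mv_m=0$, $h\cdot f^kv_m=(m-2k)f^kv_m$, $e\cdot f^kv_m=k(m-k+1)f^{k-1}v_m$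 for $k\geq 1$, $e\cdot v_m=0$. Put $L^{\otimes\vec m}=L_{m_1}\otimes\dots\otimes L_{m_n}$, with basis $f_Jv=f^{j_1}v_{m_1}\otimes\dots\otimes f^{j_n}v_{m_n}$, $J=(j_1,\dots,j_n)$, $0\le j_l\le m_l$. Put $|J|=j_1+\dots+j_n$ and $\mathcal I_k=\{J\in\mathbb Z_{\ge0}^n: |J|=k,\ j_l\le m_l,\ l=1,\dots,n\}$; the vectors $f_Jv$, $J\in\mathcal I_k$, form a basis of the weight subspace $L^{\otimes\vec m}[|\vec m|-2k]$ (the $h$-eigenspace with eigenvalue $|\vec m|-2k$, $|\vec m|=\sum_l m_l$), which is preserved by all operators in the equations. Weight functions: for $J\in\mathcal I_k$, $$W_J(t,z)=\frac1{j_1!\cdots j_n!}\sum_{\sigma\in S_k}\ \prod_{l=1}^n\prod_{i=1}^{j_l}\frac1{t_{\sigma(j_1+\dots+j_{l-1}+i)}-z_l}.$$ "Solution modulo $p^s$" for a given value of $\lambda$ means: after taking the derivatives of the polynomial vector $I^\ell(z,\lambda)$ and substituting the given value of $\lambda$, the difference of the two sides of each equation has all its coordinates in the basis $f_Jv$, $J\in\mathcal I_k$, lying in $p^sR$, where $R=\mathbb Z_p[z_1,\dots,z_n]\big[(z_i-z_j)^{-1},\ i\neq j\big]$. *)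

theory Defs
  imports
    "HOL-Library.Poly_Mapping"
    "HOL-Computational_Algebra.Computational_Algebra"
    "HOL-Combinatorics.Permutations"
    "Berlekamp_Zassenhaus.Finite_Field"
begin

section \<open>The p-adic integers\<close>

text \<open>
  The prime is carried by a type of class prime_card: p is CARD('p). The p-adic integers are the
  inverse limit of the rings Z/p^r; component r is the residue modulo p^r, represented
  in {0..<p^r}.
\<close>

typedef ('p :: prime_card) padic_int =
  "{x :: nat \<Rightarrow> int. \<forall>r. x r = x (Suc r) mod int CARD('p) ^ r}"
  by (rule exI[of _ "\<lambda>_. 0"]) simp

setup_lifting type_definition_padic_int

lemma mod_power_Suc_cancel: "(a :: int) mod q ^ Suc r mod q ^ r = a mod q ^ r"
  by (rule mod_mod_cancel) simp

lemma coherent_reduced: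
  fixes x :: "nat \<Rightarrow> int"
  assumes "\<forall>r. x r = x (Suc r) mod q ^ r"
  shows "x r mod q ^ r = x r"
  using assms by (metis mod_mod_trivial)

lemma coherent_arith:
  fixes x y :: "nat \<Rightarrow> int"
  assumes "\<forall>r. x r = x (Suc r) mod q ^ r" and "\<forall>r. y r = y (Suc r) mod q ^ r"
  shows "(x r + y r) mod q ^ r = (x (Suc r) + y (Suc r)) mod q ^ r"
    and "(x r - y r) mod q ^ r = (x (Suc r) - y (Suc r)) mod q ^ r"
    and "(- x r) mod q ^ r = (- x (Suc r)) mod q ^ r"
    and "(x r * y r) mod q ^ r = (x (Suc r) * y (Suc r)) mod q ^ r"
  unfolding assms(1)[rule_format, of r] assms(2)[rule_format, of r]
  by (simp_all only: mod_add_eq mod_diff_eq mod_minus_eq mod_mult_eq)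

instantiation padic_int :: (prime_card) comm_ring_1
begin

lift_definition zero_padic_int :: "'a padic_int" is "\<lambda>_. 0"
  by simp

lift_definition one_padic_int :: "'a padic_int" is "\<lambda>r. 1 mod int CARD('a) ^ r"
  by (simp only: mod_power_Suc_cancel)

lift_definition plus_padic_int :: "'a padic_int \<Rightarrow> 'a padic_int \<Rightarrow> 'a padic_int"
  is "\<lambda>x y r. (x r + y r) mod int CARD('a) ^ r"
  unfolding mod_power_Suc_cancel by (blast intro: coherent_arith)

lift_definition minus_padic_int :: "'a padic_int \<Rightarrow> 'a padic_int \<Rightarrow> 'a padic_int"
  is "\<lambda>x y r. (x r - y r) mod int CARD('a) ^ r"
  unfolding mod_power_Suc_cancel by (blast intro: coherent_arith)

lift_definition uminus_padic_int :: "'a padic_int \<Rightarrow> 'a padic_int"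
  is "\<lambda>x r. (- x r) mod int CARD('a) ^ r"
  unfolding mod_power_Suc_cancel by (blast intro: coherent_arith)

lift_definition times_padic_int :: "'a padic_int \<Rightarrow> 'a padic_int \<Rightarrow> 'a padic_int"
  is "\<lambda>x y r. (x r * y r) mod int CARD('a) ^ r"
  unfolding mod_power_Suc_cancel by (blast intro: coherent_arith)

instance
proof
  fix a b c :: "'a padic_int"
  note ops = Rep_padic_int_inject[symmetric] fun_eq_iff zero_padic_int.rep_eq
    one_padic_int.rep_eq plus_padic_int.rep_eq minus_padic_int.rep_eq uminus_padic_int.rep_eq
    times_padic_int.rep_eq
  have red: "Rep_padic_int x r mod int CARD('a) ^ r = Rep_padic_int x r"
    for x :: "'a padic_int" and r
    using Rep_padic_int[of x] unfolding mem_Collect_eq by (rule coherent_reduced)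
  show "a * b * c = a * (b * c)"
    by (simp add: ops mod_mult_left_eq mod_mult_right_eq mult.assoc)
  show "a * b = b * a"
    by (simp add: ops mult.commute)
  show "1 * a = a"
    by (simp add: ops mod_mult_left_eq red)
  show "a + b + c = a + (b + c)"
    by (simp add: ops mod_add_left_eq mod_add_right_eq add.assoc)
  show "a + b = b + a"
    by (simp add: ops add.commute)
  show "0 + a = a"
    by (simp add: ops red)
  show "- a + a = 0"
    by (simp add: ops mod_add_left_eq)
  show "a - b = a + - b"
    by (simp add: ops mod_add_right_eq)
  show "(a + b) * c = a * c + b * c"
    by (simp add: ops mod_mult_left_eq mod_add_eq distrib_right)
  show "(0 :: 'a padic_int) \<noteq> 1"
  proof
    assume "(0 :: 'a padic_int) = 1"
    hence "Rep_padic_int (0 :: 'a padic_int) 1 = Rep_padic_int (1 :: 'a padic_int) 1"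
      by simp
    moreover have "int CARD('a) > 1"
      using prime_card_int[where 'a = 'a] by (rule prime_gt_1_int)
    ultimately show False by (simp add: zero_padic_int.rep_eq one_padic_int.rep_eq)
  qed
qed

end

lemma coherent_mod_power:
  fixes x :: "nat \<Rightarrow> int"
  assumes "\<forall>r. x r = x (Suc r) mod q ^ r"
  shows "x (r + d) mod q ^ r = x r"
proof (induction d)
  case 0
  show ?case using coherent_reduced[OF assms] by simp
next
  case (Suc d)
  have "q ^ r dvd q ^ (r + d)" by (simp add: power_add)
  hence "x (Suc (r + d)) mod q ^ (r + d) mod q ^ r = x (Suc (r + d)) mod q ^ r"
    by (rule mod_mod_cancel)
  thus ?case using Suc assms by (metis add_Suc_right)
qed

instance padic_int :: (prime_card) idom
proof
  fix a b :: "'a padic_int"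
  assume "a \<noteq> 0" "b \<noteq> 0"
  thus "a * b \<noteq> 0"
  proof transfer
    fix x y :: "nat \<Rightarrow> int"
    let ?p = "int CARD('a)"
    assume x: "\<forall>r. x r = x (Suc r) mod ?p ^ r" and y: "\<forall>r. y r = y (Suc r) mod ?p ^ r"
      and nz: "x \<noteq> (\<lambda>_. 0)" "y \<noteq> (\<lambda>_. 0)"
    have p: "prime ?p" by (rule prime_card_int)
    from nz obtain u v where uv: "x u \<noteq> 0" "y v \<noteq> 0" by blast
    let ?X = "x (u + v)" and ?Y = "y (u + v)"
    have ndvd: "\<not> ?p ^ u dvd ?X" "\<not> ?p ^ v dvd ?Y"
      using uv coherent_mod_power[OF x, of u v] coherent_mod_power[OF y, of v u]
      by (auto simp: dvd_eq_mod_eq_0 add.commute)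
    hence nz': "?X \<noteq> 0" "?Y \<noteq> 0" by auto
    have "multiplicity ?p ?X < u" "multiplicity ?p ?Y < v"
      using ndvd multiplicity_dvd'[of _ ?p] not_le by blast+
    moreover have "multiplicity ?p (?X * ?Y) = multiplicity ?p ?X + multiplicity ?p ?Y"
      using p nz' by (intro prime_elem_multiplicity_mult_distrib) auto
    ultimately have "multiplicity ?p (?X * ?Y) < u + v" by linarith
    hence "\<not> ?p ^ (u + v) dvd ?X * ?Y"
      using p nz' by (subst power_dvd_iff_le_multiplicity) auto
    hence "(?X * ?Y) mod ?p ^ (u + v) \<noteq> 0" by (simp add: dvd_eq_mod_eq_0)
    thus "(\<lambda>r. (x r * y r) mod ?p ^ r) \<noteq> (\<lambda>_. 0)" by (metis (no_types))
  qed
qed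

lemma Rep_padic_int_of_nat:
  "Rep_padic_int (of_nat a :: 'p :: prime_card padic_int) r = int a mod int CARD('p) ^ r"
proof (induction a)
  case 0
  show ?case by (simp add: zero_padic_int.rep_eq)
next
  case (Suc a)
  thus ?case
    by (simp add: plus_padic_int.rep_eq one_padic_int.rep_eq mod_add_eq)
qed

instance padic_int :: (prime_card) ring_char_0
proof (intro_classes, rule injI)
  fix a b :: nat
  assume eq: "(of_nat a :: 'a padic_int) = of_nat b"
  let ?r = "max a b"
  have "CARD('a) > 1" using prime_card[where 'a = 'a] by (rule prime_gt_1_nat)
  hence "?r < CARD('a) ^ ?r" by (intro power_gt_expt) simp
  hence "int ?r < int CARD('a) ^ ?r" unfolding of_nat_power[symmetric] of_nat_less_iff .
  hence "int a < int CARD('a) ^ ?r" "int b < int CARD('a) ^ ?r" by linarith+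
  moreover have "int a mod int CARD('a) ^ ?r = int b mod int CARD('a) ^ ?r"
    using eq by (metis Rep_padic_int_of_nat)
  ultimately show "a = b" by simp
qed

lemma of_nat_fract: "(of_nat a :: 'a :: idom fract) = to_fract (of_nat a)"
  by (induction a) auto

instance fract :: ("{idom, ring_char_0}") field_char_0
  by (intro_classes, rule injI) (simp add: of_nat_fract)

text \<open>Congruence modulo \<open>p\<^sup>s\<close> in the p-adic integers of two rational numbers, both
  regarded as elements of the p-adic numbers (the fraction field).\<close>

definition rat_cong :: "'p :: prime_card itself \<Rightarrow> nat \<Rightarrow> rat \<Rightarrow> rat \<Rightarrow> bool" where
  "rat_cong _ s a b \<longleftrightarrow>
     (\<exists>c :: 'p padic_int. of_rat a - of_rat b = to_fract (of_nat CARD('p) ^ s * c))"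


section \<open>Polynomials and rational functions\<close>

text \<open>
  Polynomials in infinitely many variables are finitely supported maps from exponent vectors to
  coefficients. The three types below are \<open>Z\<^sub>p[z]\<close>, \<open>Z\<^sub>p[z][\<lambda>]\<close> and \<open>Z\<^sub>p[z][\<lambda>][t]\<close>, so that a
  coefficient at a monomial in t is a polynomial in z and \<open>\<lambda>\<close>.
\<close>

type_synonym 'p zpoly = "(nat \<Rightarrow>\<^sub>0 nat) \<Rightarrow>\<^sub>0 'p padic_int"
type_synonym 'p zlpoly = "'p zpoly poly"
type_synonym 'p tzlpoly = "(nat \<Rightarrow>\<^sub>0 nat) \<Rightarrow>\<^sub>0 'p zlpoly"

definition mconst :: "'a \<Rightarrow> (nat \<Rightarrow>\<^sub>0 nat) \<Rightarrow>\<^sub>0 'a :: comm_ring_1" where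
  "mconst c = Poly_Mapping.single 0 c"

definition mvar :: "nat \<Rightarrow> (nat \<Rightarrow>\<^sub>0 nat) \<Rightarrow>\<^sub>0 'a :: comm_ring_1" where
  "mvar i = Poly_Mapping.single (Poly_Mapping.single i 1) 1"

definition mderiv :: "nat \<Rightarrow> ((nat \<Rightarrow>\<^sub>0 nat) \<Rightarrow>\<^sub>0 'a :: comm_ring_1) \<Rightarrow> (nat \<Rightarrow>\<^sub>0 nat) \<Rightarrow>\<^sub>0 'a" where
  "mderiv i P = (\<Sum>\<alpha>\<in>Poly_Mapping.keys P. Poly_Mapping.single (\<alpha> - Poly_Mapping.single i 1)
                               (of_nat (Poly_Mapping.lookup \<alpha> i) * Poly_Mapping.lookup P \<alpha>))"

definition t_var :: "nat \<Rightarrow> 'p :: prime_card tzlpoly fract" where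
  "t_var i = to_fract (mvar i)"

definition z_var :: "nat \<Rightarrow> 'p :: prime_card tzlpoly fract" where
  "z_var l = to_fract (mconst [:mvar l:])"

definition lam_var :: "'p :: prime_card tzlpoly fract" where
  "lam_var = to_fract (mconst [:0, 1:])"


section \<open>Tensor products of \<open>sl\<^sub>2\<close>-modules\<close>

datatype sl2_basis = sl2_e | sl2_f | sl2_h

text \<open>\<open>sl2_coeff x m a b\<close> is the coefficient of \<open>f\<^sup>b v\<^sub>m\<close> in \<open>x f\<^sup>a v\<^sub>m\<close>, for \<open>a, b \<le> m\<close>.\<close>

fun sl2_coeff :: "sl2_basis \<Rightarrow> nat \<Rightarrow> nat \<Rightarrow> nat \<Rightarrow> int" where
  "sl2_coeff sl2_f m a b = (if a < m \<and> b = a + 1 then 1 else 0)"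
| "sl2_coeff sl2_h m a b = (if b = a then int m - 2 * int a else 0)"
| "sl2_coeff sl2_e m a b = (if a \<ge> 1 \<and> b = a - 1 then int a * (int m - int a + 1) else 0)"

text \<open>
  A vector of the tensor product of the \<open>L\<^bsub>m l\<^esub>\<close> is given by its coordinates in the basis \<open>f\<^sub>J v\<close>,
  that is, by a function of the multi-index J. \<open>act m x i\<close> is the operator \<open>x\<^sup>(\<^sup>i\<^sup>)\<close>.
\<close>

definition act ::
  "(nat \<Rightarrow> nat) \<Rightarrow> sl2_basis \<Rightarrow> nat \<Rightarrow> ((nat \<Rightarrow> nat) \<Rightarrow> 'a) \<Rightarrow> (nat \<Rightarrow> nat) \<Rightarrow> 'a :: field" where
  "act m x i u J = (\<Sum>a\<le>m i. of_int (sl2_coeff x (m i) a (J i)) * u (J(i := a)))"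

definition Omega ::
  "(nat \<Rightarrow> nat) \<Rightarrow> nat \<Rightarrow> nat \<Rightarrow> ((nat \<Rightarrow> nat) \<Rightarrow> 'a) \<Rightarrow> (nat \<Rightarrow> nat) \<Rightarrow> 'a :: field" where
  "Omega m i j u J =
     act m sl2_e i (act m sl2_f j u) J + act m sl2_f i (act m sl2_e j u) J
     + 1 / 2 * act m sl2_h i (act m sl2_h j u) J"

text \<open>The set \<open>\<I>\<^sub>k\<close>. Multi-indices are indexed by \<open>{1..n}\<close> and vanish outside.\<close>

definition multi_indices :: "nat \<Rightarrow> (nat \<Rightarrow> nat) \<Rightarrow> nat \<Rightarrow> (nat \<Rightarrow> nat) set" where
  "multi_indices n m k =
     {J. (\<forall>l. l \<notin> {1..n} \<longrightarrow> J l = 0) \<and> (\<forall>l\<in>{1..n}. J l \<le> m l) \<and> (\<Sum>l=1..n. J l) = k}"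


section \<open>The polynomials \<open>\<Psi>\<^sub>s\<close> and \<open>I\<^sup>\<ell>\<close>\<close>

definition exp_deg :: "nat \<Rightarrow> nat \<Rightarrow> nat" where
  "exp_deg p s = s * (p - 1) div (p - 2) + 1"

definition exp_poly :: "nat \<Rightarrow> nat \<Rightarrow> 'a \<Rightarrow> 'a :: field_char_0" where
  "exp_poly p s x = (\<Sum>k=0..exp_deg p s. x ^ k / fact k)"

definition weight_fun :: "nat \<Rightarrow> nat \<Rightarrow> (nat \<Rightarrow> nat) \<Rightarrow> 'p :: prime_card tzlpoly fract" where
  "weight_fun n k J =
     1 / (\<Prod>l=1..n. fact (J l)) *
     (\<Sum>\<sigma> | \<sigma> permutes {1..k}.
        \<Prod>l=1..n. \<Prod>i=1..J l. 1 / (t_var (\<sigma> ((\<Sum>r=1..<l. J r) + i)) - z_var l))"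

definition master_poly ::
  "nat \<Rightarrow> nat \<Rightarrow> nat \<Rightarrow> (nat \<Rightarrow> nat) \<Rightarrow> rat \<Rightarrow> (nat \<Rightarrow> nat) \<Rightarrow> (nat \<Rightarrow> nat \<Rightarrow> nat) \<Rightarrow> nat
     \<Rightarrow> 'p :: prime_card tzlpoly fract" where
  "master_poly s n k m \<kappa> M M2 M0 =
     (\<Prod>l=1..n. exp_poly CARD('p) s
        (of_nat CARD('p) * (of_nat (m l) * z_var l * lam_var / (2 * of_rat \<kappa>)))) *
     (\<Prod>i=1..k. exp_poly CARD('p) s (- (of_nat CARD('p) * (t_var i * lam_var / of_rat \<kappa>)))) *
     (\<Prod>j=1..n. \<Prod>i=1..<j. (z_var i - z_var j) ^ M2 i j) *
     (\<Prod>j=1..k. \<Prod>i=1..<j. (t_var i - t_var j) ^ M0) *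
     (\<Prod>l=1..n. \<Prod>i=1..k. (t_var i - z_var l) ^ M l)"

definition Psi ::
  "nat \<Rightarrow> nat \<Rightarrow> nat \<Rightarrow> (nat \<Rightarrow> nat) \<Rightarrow> rat \<Rightarrow> (nat \<Rightarrow> nat) \<Rightarrow> (nat \<Rightarrow> nat \<Rightarrow> nat) \<Rightarrow> nat
     \<Rightarrow> (nat \<Rightarrow> nat) \<Rightarrow> 'p :: prime_card tzlpoly fract" where
  "Psi s n k m \<kappa> M M2 M0 J =
     (if J \<in> multi_indices n m k
      then master_poly s n k m \<kappa> M M2 M0 * weight_fun n k J else 0)"

text \<open>\<open>I_vec \<dots> ell\<close> is \<open>I\<^sup>\<ell>\<close>. It is meaningful when the coordinates of \<open>\<Psi>\<^sub>s\<close> lie in the range of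
  \<open>to_fract\<close>; as \<open>to_fract\<close> is injective, the polynomial is then unique.\<close>

definition I_vec ::
  "nat \<Rightarrow> nat \<Rightarrow> nat \<Rightarrow> (nat \<Rightarrow> nat) \<Rightarrow> rat \<Rightarrow> (nat \<Rightarrow> nat) \<Rightarrow> (nat \<Rightarrow> nat \<Rightarrow> nat) \<Rightarrow> nat
     \<Rightarrow> (nat \<Rightarrow> nat) \<Rightarrow> (nat \<Rightarrow> nat) \<Rightarrow> 'p :: prime_card zlpoly" where
  "I_vec s n k m \<kappa> M M2 M0 ell J =
     Poly_Mapping.lookup (THE P. to_fract P = Psi s n k m \<kappa> M M2 M0 J)
       (\<Sum>i=1..k. Poly_Mapping.single i (ell i * CARD('p) ^ s - 1))"


section \<open>Solutions modulo \<open>p\<^sup>s\<close>\<close>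

text \<open>The ring \<open>R = Z\<^sub>p[z\<^sub>1,\<dots>,z\<^sub>n][(z\<^sub>i - z\<^sub>j)\<^sup>-\<^sup>1, i \<noteq> j]\<close> as a subring of the field of
  rational functions in z.\<close>

inductive_set ring_R :: "nat \<Rightarrow> 'p :: prime_card zpoly fract set" for n :: nat where
  const: "to_fract (mconst c) \<in> ring_R n"
| var: "l \<in> {1..n} \<Longrightarrow> to_fract (mvar l) \<in> ring_R n"
| inv_diff: "i \<in> {1..n} \<Longrightarrow> j \<in> {1..n} \<Longrightarrow> i \<noteq> j \<Longrightarrow>
    inverse (to_fract (mvar i) - to_fract (mvar j)) \<in> ring_R n"
| add: "a \<in> ring_R n \<Longrightarrow> b \<in> ring_R n \<Longrightarrow> a + b \<in> ring_R n"
| mult: "a \<in> ring_R n \<Longrightarrow> b \<in> ring_R n \<Longrightarrow> a * b \<in> ring_R n"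

definition p_power_R :: "nat \<Rightarrow> nat \<Rightarrow> 'p :: prime_card zpoly fract set" where
  "p_power_R s n = {of_nat CARD('p) ^ s * r | r. r \<in> ring_R n}"

definition subst_lam :: "'p :: prime_card padic_int \<Rightarrow> 'p zlpoly \<Rightarrow> 'p zpoly fract" where
  "subst_lam lam Q = to_fract (poly Q (mconst lam))"

definition KZ_solution_mod ::
  "nat \<Rightarrow> nat \<Rightarrow> nat \<Rightarrow> (nat \<Rightarrow> nat) \<Rightarrow> rat \<Rightarrow> 'p :: prime_card padic_int
     \<Rightarrow> ((nat \<Rightarrow> nat) \<Rightarrow> 'p zlpoly) \<Rightarrow> bool" where
  "KZ_solution_mod s n k m \<kappa> lam I \<longleftrightarrow>
     (let u = (\<lambda>J. subst_lam lam (I J));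
          z = (\<lambda>l. to_fract (mvar l) :: 'p zpoly fract);
          lc = to_fract (mconst lam) :: 'p zpoly fract
      in \<forall>i\<in>{1..n}. \<forall>J\<in>multi_indices n m k.
           subst_lam lam (map_poly (mderiv i) (I J))
           - 1 / of_rat \<kappa> *
               (of_nat CARD('p) * (lc / 2) * act m sl2_h i u J
                + (\<Sum>j\<in>{1..n} - {i}. Omega m i j u J / (z i - z j)))
           \<in> p_power_R s n)"

definition dynamical_solution_mod ::
  "nat \<Rightarrow> nat \<Rightarrow> nat \<Rightarrow> (nat \<Rightarrow> nat) \<Rightarrow> rat \<Rightarrow> 'p :: prime_card padic_int
     \<Rightarrow> ((nat \<Rightarrow> nat) \<Rightarrow> 'p zlpoly) \<Rightarrow> bool" where
  "dynamical_solution_mod s n k m \<kappa> lam I \<longleftrightarrow>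
     (let u = (\<lambda>J. subst_lam lam (I J));
          z = (\<lambda>l. to_fract (mvar l) :: 'p zpoly fract);
          lc = to_fract (mconst lam) :: 'p zpoly fract
      in \<forall>J\<in>multi_indices n m k.
           subst_lam lam (pderiv (I J))
           - 1 / of_rat \<kappa> *
               (of_nat CARD('p) * (\<Sum>i=1..n. z i / 2 * act m sl2_h i u J)
                + (\<Sum>i=1..n. \<Sum>j=1..n. act m sl2_f i (act m sl2_e j u) J / lc))
           \<in> p_power_R s n)"

end

theory Submission
  imports Defs "HOL-Combinatorics.Multiset_Permutations"
begin

text \<open>
  The weight function \<open>W\<^sub>J\<close> is the sum, over the colorings c of \<open>{1..k}\<close> by \<open>{1..n}\<close> that use the
  color l exactly \<open>J l\<close> times, of \<open>W\<^sub>c = \<Prod>\<^sub>a 1 / (t\<^sub>a - z\<^bsub>c(a)\<^esub>)\<close>. Modulo \<open>p\<^sup>s\<close> the defect of the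
  i-th KZ equation is \<open>- \<Sum>\<^sub>c \<Sum>\<^bsub>a: c(a) = i\<^esub> \<partial>(\<Phi> W\<^sub>c)/\<partial>t\<^sub>a\<close>, and \<open>\<lambda>\<close> times the defect of the dynamical
  equation is \<open>\<Sum>\<^sub>c \<Sum>\<^sub>a \<partial>(\<Phi> W\<^sub>c (t\<^sub>a - z\<^bsub>c(a)\<^esub>))/\<partial>t\<^sub>a\<close>: after taking logarithmic derivatives, the terms that
  do not cancel for a single coloring cancel in pairs when two points exchange their colors.
  The double poles at \<open>t\<^sub>a = z\<^bsub>c(a)\<^esub>\<close> cancel exactly, so the congruences for the exponents are only
  applied to terms that are polynomial in t. The choice of \<open>d(s)\<close> makes \<open>p\<^sup>d / d!\<close> divisible by \<open>p\<^sup>s\<close>, so the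
  truncated exponential satisfies the differential equation of the exponential modulo \<open>p\<^sup>s\<close>.
  Finally a derivative in \<open>t\<^sub>a\<close> does not contribute to the coefficient at an exponent
  \<open>\<ell>\<^sub>a p\<^sup>s - 1\<close> modulo \<open>p\<^sup>s\<close>.
\<close>

section \<open>Derivations and logarithmic derivatives\<close>

text \<open>The choice of the t-derivatives is dictated by two terms. As
  \<open>1 / (t_a - z_i)\<close> has opposite derivatives in \<open>z_i\<close> and
  \<open>t_a\<close>, adding the \<open>t_a\<close>-derivatives over the points of color i to the
  \<open>z_i\<close>-derivative removes all double poles. In the dynamical equation the derivative
  of the exponentials and the operators \<open>h^(i)\<close> differ by \<open>- p / \<kappa>\<close>
  times the sum of the \<open>t_a - z_c(a)\<close>; multiplied by \<lambda>, this is what the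
  \<open>t_a\<close>-derivatives of the exponentials give when weighted with
  \<open>t_a - z_c(a)\<close>. The obstacle is division. The identities hold in a field of rational
  functions, but congruence modulo \<open>p^s\<close> refers to a subring of polynomials. A
  congruence between exponents may therefore be multiplied by a polynomial only, and the positive
  exponents in the master polynomial have to absorb every simple pole. The KZ operators moreover
  divide by 2 and by \<open>z_i - z_j\<close>, so extraction of a coefficient in t has to be
  extended to fractions with denominators in \<open>Z_p[z]\<close>. The scalars
  \<open>1 / \<kappa>\<close> and \<open>1 / 2\<close> stay in \<open>Z_p\<close>, because p is odd
  and does not divide the numerator of \<kappa>.\<close>

locale derivation =
  fixes D :: "'a :: comm_ring_1 \<Rightarrow> 'a"
  assumes add: "D (x + y) = D x + D y"
    and mult: "D (x * y) = D x * y + x * D y"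
begin

lemma zero [simp]: "D 0 = 0"
  using add[of 0 0] by simp

lemma one [simp]: "D 1 = 0"
  using mult[of 1 1] by simp

lemma minus [simp]: "D (- x) = - D x"
  using add[of x "- x"] by (simp add: eq_neg_iff_add_eq_0 add.commute)

lemma diff: "D (x - y) = D x - D y"
  using add[of x "- y"] by simp

lemma of_nat [simp]: "D (of_nat r) = 0"
  by (induction r) (simp_all add: add)

lemma sum: "D (\<Sum>x\<in>A. g x) = (\<Sum>x\<in>A. D (g x))"
  by (induction A rule: infinite_finite_induct) (simp_all add: add)

lemma power: "D (x ^ r) = of_nat r * x ^ (r - 1) * D x"
proof (induction r)
  case (Suc r)
  have "x * (of_nat r * x ^ (r - 1) * D x) = of_nat r * x ^ r * D x"
    by (cases r) (simp_all add: algebra_simps)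
  thus ?case by (simp add: mult Suc algebra_simps)
qed simp

end

text \<open>Demanding \<open>x \<noteq> 0\<close> here lets the rules for products, powers and
  inverses be composed without side conditions. \<open>L\<close> is a free parameter, so that sums
  of simple fractions can be regrouped before they are used.\<close>

definition has_logder :: "('a :: field \<Rightarrow> 'a) \<Rightarrow> 'a \<Rightarrow> 'a \<Rightarrow> bool" where
  "has_logder D x L \<longleftrightarrow> x \<noteq> 0 \<and> D x = x * L"

context
  fixes D :: "'a :: field \<Rightarrow> 'a"
  assumes D: "derivation D"
begin

interpretation derivation D by (rule D)

lemma has_logder_one: "has_logder D 1 0"
  by (simp add: has_logder_def)

lemma has_logder_base: "x \<noteq> 0 \<Longrightarrow> has_logder D x (D x / x)"
  by (simp add: has_logder_def)

lemma has_logder_mult: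
  "has_logder D x L \<Longrightarrow> has_logder D y L' \<Longrightarrow> has_logder D (x * y) (L + L')"
  by (simp add: has_logder_def mult algebra_simps)

lemma has_logder_power:
  assumes "has_logder D x L"
  shows "has_logder D (x ^ r) (of_nat r * L)"
proof (induction r)
  case (Suc r)
  show ?case using has_logder_mult[OF assms Suc] by (simp add: algebra_simps)
qed (simp add: has_logder_one)

lemma has_logder_inverse:
  assumes "has_logder D x L"
  shows "has_logder D (1 / x) (- L)"
proof -
  have x: "x \<noteq> 0" and Dx: "D x = x * L" using assms by (auto simp: has_logder_def)
  have "D (x * (1 / x)) = 0" using x by simp
  hence "D x * (1 / x) + x * D (1 / x) = 0" by (simp only: mult)
  hence "L + x * D (1 / x) = 0" using x by (simp add: Dx)
  hence "x * D (1 / x) = - L" by (simp add: eq_neg_iff_add_eq_0 add.commute)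
  thus ?thesis using x by (simp add: has_logder_def field_simps)
qed

lemma has_logder_prod:
  assumes "\<And>x. x \<in> A \<Longrightarrow> has_logder D (g x) (L x)"
  shows "has_logder D (\<Prod>x\<in>A. g x) (\<Sum>x\<in>A. L x)"
  using assms
  by (induction A rule: infinite_finite_induct) (simp_all add: has_logder_one has_logder_mult)

end

text \<open>A pair \<open>i < j\<close> contains \<open>p\<close> either as its smaller or as its
  larger member. The inner sum over \<open>i\<close> consists of all the \<open>G' p i\<close> for
  \<open>j = p\<close>, of the single term \<open>i = p\<close> for \<open>j > p\<close>, and is
  zero for \<open>j < p\<close>.\<close>

lemma sum_pairs_below:
  fixes G :: "nat \<Rightarrow> nat \<Rightarrow> 'a :: comm_monoid_add"
  assumes "p \<in> {1..n}"
  shows "(\<Sum>j=1..n. \<Sum>i=1..<j. (if i = p then G p j else if j = p then G' p i else 0)) =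
    (\<Sum>j\<in>{1..n} - {p}. if p < j then G p j else G' p j)"
proof -
  have split: "{1..n} - {p} = {1..<p} \<union> {p<..n}" using assms by auto
  have inner: "(\<Sum>i=1..<j. (if i = p then G p j else if j = p then G' p i else 0)) =
    (if j = p then (\<Sum>i=1..<p. G' p i) else if p < j then G p j else 0)" for j
  proof -
    consider "j = p" | "j \<noteq> p" "p < j" | "j < p" by linarith
    thus ?thesis
    proof cases
      case 1 thus ?thesis by (auto intro!: sum.cong)
    next
      case 2
      hence "(\<Sum>i=1..<j. (if i = p then G p j else if j = p then G' p i else 0)) =
        (\<Sum>i=1..<j. (if i = p then G p j else 0))" by (intro sum.cong) auto
      thus ?thesis using 2 assms by simp
    next
      case 3 thus ?thesis by (auto intro!: sum.neutral)
    qed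
  qed
  have "(\<Sum>j=1..n. \<Sum>i=1..<j. (if i = p then G p j else if j = p then G' p i else 0)) =
    (\<Sum>j=1..n. if j = p then (\<Sum>i=1..<p. G' p i) else if p < j then G p j else 0)"
    by (intro sum.cong refl inner)
  also have "\<dots> = (\<Sum>i=1..<p. G' p i) + (\<Sum>j\<in>{1..n} - {p}. if p < j then G p j else 0)"
    using assms by (subst sum.remove[of _ p]) (auto intro!: sum.cong)
  also have "(\<Sum>j\<in>{1..n} - {p}. if p < j then G p j else 0) = (\<Sum>j\<in>{p<..n}. G p j)"
    unfolding split by (subst sum.union_disjoint) (auto intro!: sum.cong)
  also have "(\<Sum>i=1..<p. G' p i) + (\<Sum>j\<in>{p<..n}. G p j) =
     (\<Sum>j\<in>{1..n} - {p}. if p < j then G p j else G' p j)"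
    unfolding split by (subst sum.union_disjoint) (auto intro!: sum.cong arg_cong2[of _ _ _ _ "(+)"])
  finally show ?thesis .
qed

text \<open>Only factors containing \<open>x p\<close> have a nonzero derivative. Where
  \<open>p\<close> is the larger index, the derivative -1 of the difference turns
  \<open>x i - x p\<close> into \<open>x p - x i\<close>, so both kinds of pairs give the same
  fraction and differ only in the exponent.\<close>

lemma has_logder_vandermonde:
  fixes x :: "nat \<Rightarrow> 'a :: field"
  assumes D: "derivation D" and dist: "\<And>i j. i \<in> {1..n} \<Longrightarrow> j \<in> {1..n} \<Longrightarrow> i \<noteq> j \<Longrightarrow> x i \<noteq> x j"
    and p: "p \<in> {1..n}" and Dx: "\<And>j. j \<in> {1..n} \<Longrightarrow> D (x j) = (if j = p then 1 else 0)"
  shows "has_logder D (\<Prod>j=1..n. \<Prod>i=1..<j. (x i - x j) ^ N i j)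
    (\<Sum>j\<in>{1..n} - {p}. of_nat (if p < j then N p j else N j p) / (x p - x j))"
proof -
  interpret derivation D by (rule D)
  have "has_logder D (\<Prod>j=1..n. \<Prod>i=1..<j. (x i - x j) ^ N i j)
    (\<Sum>j=1..n. \<Sum>i=1..<j. of_nat (N i j) * (D (x i - x j) / (x i - x j)))"
    by (intro has_logder_prod has_logder_power has_logder_base D) (use dist in auto)
  also have "(\<Sum>j=1..n. \<Sum>i=1..<j. of_nat (N i j) * (D (x i - x j) / (x i - x j))) =
    (\<Sum>j=1..n. \<Sum>i=1..<j. (if i = p then of_nat (N p j) / (x p - x j)
       else if j = p then of_nat (N i p) / (x p - x i) else 0))"
  proof (intro sum.cong refl)
    fix i j assume *: "j \<in> {1..n}" "i \<in> {1..<j}"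
    hence [simp]: "D (x i - x j) = (if i = p then 1 else if j = p then - 1 else 0)"
      by (subst diff) (auto simp: Dx)
    have "- (of_nat (N i j) / (x i - x j)) = of_nat (N i j) / (x j - x i)"
      by (metis minus_diff_eq minus_divide_right)
    thus "of_nat (N i j) * (D (x i - x j) / (x i - x j)) =
      (if i = p then of_nat (N p j) / (x p - x j)
       else if j = p then of_nat (N i p) / (x p - x i) else 0)"
      by auto
  qed
  also have "\<dots> = (\<Sum>j\<in>{1..n} - {p}. if p < j then of_nat (N p j) / (x p - x j)
       else of_nat (N j p) / (x p - x j))"
    by (rule sum_pairs_below[OF p])
  also have "\<dots> = (\<Sum>j\<in>{1..n} - {p}. of_nat (if p < j then N p j else N j p) / (x p - x j))"
    by (intro sum.cong) auto
  finally show ?thesis .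
qed

section \<open>Colorings\<close>

text \<open>A point \<open>a\<close> of color \<open>l\<close> stands for the factor
  \<open>1 / (t a - z l)\<close>. The functions are extensional, so that a coloring is determined by
  its values on \<open>{1..k}\<close> and sums over colorings are finite.\<close>

definition colorings :: "nat \<Rightarrow> nat \<Rightarrow> (nat \<Rightarrow> nat) \<Rightarrow> (nat \<Rightarrow> nat) set" where
  "colorings k n J =
     {c \<in> {1..k} \<rightarrow>\<^sub>E {1..n}. \<forall>l\<in>{1..n}. card {a\<in>{1..k}. c a = l} = J l}"

lemma finite_colorings [simp]: "finite (colorings k n J)"
  unfolding colorings_def by (auto intro!: finite_PiE)

lemma coloring_range: "c \<in> colorings k n J \<Longrightarrow> a \<in> {1..k} \<Longrightarrow> c a \<in> {1..n}"
  by (auto simp: colorings_def)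

lemma coloring_card: "c \<in> colorings k n J \<Longrightarrow> l \<in> {1..n} \<Longrightarrow> card {a\<in>{1..k}. c a = l} = J l"
  by (auto simp: colorings_def)

lemma coloring_permute:
  assumes c: "c \<in> colorings k n J" and s: "\<sigma> permutes {1..k}"
  shows "c \<circ> \<sigma> \<in> colorings k n J"
proof -
  have "card {a \<in> {1..k}. c (\<sigma> a) = l} = card {a \<in> {1..k}. c a = l}" for l
    using s by (intro bij_betw_same_card[of \<sigma>] bij_betwI[of _ _ _ "Hilbert_Choice.inv \<sigma>"])
      (auto simp: permutes_inverses permutes_in_image permutes_in_image[OF permutes_inv]
        simp del: atLeastAtMost_iff)
  moreover have "c \<circ> \<sigma> \<in> {1..k} \<rightarrow>\<^sub>E {1..n}"
    using c s by (auto simp: colorings_def PiE_iff permutes_in_image extensional_def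
      permutes_not_in simp del: atLeastAtMost_iff)
  ultimately show ?thesis using c by (auto simp: colorings_def)
qed

lemma sum_over_coloring:
  fixes g :: "nat \<Rightarrow> 'a :: comm_semiring_1"
  assumes "c \<in> colorings k n J"
  shows "(\<Sum>a=1..k. g (c a)) = (\<Sum>l=1..n. of_nat (J l) * g l)"
proof -
  have "(\<Sum>a=1..k. g (c a)) = (\<Sum>l=1..n. \<Sum>a\<in>{a\<in>{1..k}. c a = l}. g (c a))"
    using coloring_range[OF assms] by (intro sum.group[symmetric]) auto
  also have "\<dots> = (\<Sum>l=1..n. of_nat (J l) * g l)"
    using coloring_card[OF assms] by (intro sum.cong) auto
  finally show ?thesis .
qed

lemma recolor:
  assumes c: "c \<in> colorings k n J" and ij: "i \<in> {1..n}" "j \<in> {1..n}" "i \<noteq> j"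
    and a: "a \<in> {1..k}" "c a = j"
  shows "c(a := i) \<in> colorings k n (J(i := J i + 1, j := J j - 1))"
proof -
  have "card {b\<in>{1..k}. (c(a := i)) b = l} = (J(i := J i + 1, j := J j - 1)) l"
    if l: "l \<in> {1..n}" for l
  proof -
    have eq: "card {b\<in>{1..k}. c b = l} = J l" by (rule coloring_card[OF c l])
    consider "l = i" | "l = j" | "l \<noteq> i" "l \<noteq> j" by blast
    thus ?thesis
    proof cases
      case 1
      have "{b\<in>{1..k}. (c(a := i)) b = l} = insert a {b\<in>{1..k}. c b = l}"
        using a 1 by auto
      thus ?thesis using eq 1 a ij by simp
    next
      case 2
      have "{b\<in>{1..k}. (c(a := i)) b = l} = {b\<in>{1..k}. c b = l} - {a}"
        using a 2 ij by auto
      thus ?thesis using eq 2 a by simp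
    next
      case 3
      hence "{b\<in>{1..k}. (c(a := i)) b = l} = {b\<in>{1..k}. c b = l}"
        using a by auto
      thus ?thesis using eq 3 by simp
    qed
  qed
  thus ?thesis using c ij a by (auto simp: colorings_def PiE_iff extensional_def)
qed

text \<open>Double counting of colorings with a marked point: recoloring the marked point turns a
  coloring of type \<open>J\<close> marked at color \<open>j\<close> into one of the shifted type
  marked at color \<open>i\<close>, and each of the latter has \<open>J i + 1\<close> possible
  marks. This is what absorbs the factor \<open>J i + 1\<close> in the action of e.\<close>

lemma sum_recolor:
  fixes F :: "(nat \<Rightarrow> nat) \<Rightarrow> 'a :: comm_semiring_1"
  assumes ij: "i \<in> {1..n}" "j \<in> {1..n}" "i \<noteq> j" and Jj: "J j \<ge> 1"
  shows "of_nat (J i + 1) * (\<Sum>c\<in>colorings k n (J(i := J i + 1, j := J j - 1)). F c) =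
    (\<Sum>c\<in>colorings k n J. \<Sum>a\<in>{a\<in>{1..k}. c a = j}. F (c(a := i)))"
proof -
  let ?J = "J(i := J i + 1, j := J j - 1)"
  \<comment> \<open>The assumption \<open>J j \<ge> 1\<close> enters here: it makes the subtraction
    of natural numbers reversible.\<close>
  have undo: "?J(j := ?J j + 1, i := ?J i - 1) = J"
    using ij Jj by auto
  have "of_nat (J i + 1) * (\<Sum>c\<in>colorings k n ?J. F c) =
    (\<Sum>c\<in>colorings k n ?J. \<Sum>a\<in>{a\<in>{1..k}. c a = i}. F c)"
    unfolding sum_distrib_left
    by (intro sum.cong refl) (use coloring_card[of _ k n ?J i] ij in auto)
  also have "\<dots> = (\<Sum>(c, a)\<in>(SIGMA c:colorings k n ?J. {a\<in>{1..k}. c a = i}). F c)"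
    by (rule sum.Sigma) auto
  also have "\<dots> = (\<Sum>(c, a)\<in>(SIGMA c:colorings k n J. {a\<in>{1..k}. c a = j}). F (c(a := i)))"
    by (rule sum.reindex_bij_witness[where i = "\<lambda>(c, a). (c(a := i), a)"
          and j = "\<lambda>(c, a). (c(a := j), a)"])
      (use recolor[where J = J, OF _ ij] recolor[where J = ?J, OF _ ij(2,1) ij(3)[symmetric]] undo
        in \<open>auto simp: fun_upd_idem_iff\<close>)
  also have "\<dots> = (\<Sum>c\<in>colorings k n J. \<Sum>a\<in>{a\<in>{1..k}. c a = j}. F (c(a := i)))"
    by (rule sum.Sigma[symmetric]) auto
  finally show ?thesis .
qed

text \<open>Exchanging the colors of a and b is an involution on the colorings with two marked points.\<close>

lemma sum_colorings_exchange:
  fixes G :: "(nat \<Rightarrow> nat) \<Rightarrow> nat \<Rightarrow> nat \<Rightarrow> 'a :: field_char_0"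
  assumes anti: "\<And>c a b. c \<in> colorings k n J \<Longrightarrow> a \<in> {1..k} \<Longrightarrow> b \<in> {1..k} \<Longrightarrow> P (c a) (c b) \<Longrightarrow>
      G (c \<circ> transpose a b) b a = - G c a b"
  shows "(\<Sum>c\<in>colorings k n J. \<Sum>(a, b)\<in>{(a, b). a \<in> {1..k} \<and> b \<in> {1..k} \<and> P (c a) (c b)}. G c a b) = 0"
proof -
  let ?A = "\<lambda>c. {(a, b). a \<in> {1..k} \<and> b \<in> {1..k} \<and> P (c a) (c b)}"
  let ?S = "SIGMA c:colorings k n J. ?A c"
  have fin: "finite (?A c)" for c
    by (rule finite_subset[of _ "{1..k} \<times> {1..k}"]) auto
  have tr: "c \<circ> transpose a b \<in> colorings k n J"
    if "c \<in> colorings k n J" "a \<in> {1..k}" "b \<in> {1..k}" for c a b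
    using that by (intro coloring_permute permutes_swap_id) auto
  have S: "(\<Sum>c\<in>colorings k n J. \<Sum>(a, b)\<in>?A c. G c a b) = (\<Sum>(c, a, b)\<in>?S. G c a b)"
    by (subst sum.Sigma) (use fin in simp_all)
  have "(\<Sum>(c, a, b)\<in>?S. G c a b) = (\<Sum>(c, a, b)\<in>?S. - G c a b)"
    by (rule sum.reindex_bij_witness[where i = "\<lambda>(c, a, b). (c \<circ> transpose a b, b, a)"
          and j = "\<lambda>(c, a, b). (c \<circ> transpose a b, b, a)"])
      (use tr in \<open>auto simp: anti transpose_commute comp_assoc simp del: atLeastAtMost_iff\<close>)
  also have "\<dots> = - (\<Sum>(c, a, b)\<in>?S. G c a b)"
    by (simp add: sum_negf[symmetric] case_prod_unfold)
  finally show ?thesis unfolding S by (simp add: eq_neg_iff_add_eq_0)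
qed

lemma sum_antisymmetric:
  fixes g :: "nat \<Rightarrow> nat \<Rightarrow> 'a :: field_char_0"
  assumes "\<And>a b. a \<in> A \<Longrightarrow> b \<in> A \<Longrightarrow> g a b = - g b a"
  shows "(\<Sum>a\<in>A. \<Sum>b\<in>A. g a b) = 0"
proof -
  have "(\<Sum>a\<in>A. \<Sum>b\<in>A. g a b) = (\<Sum>a\<in>A. \<Sum>b\<in>A. - g b a)"
    by (intro sum.cong refl assms)
  also have "\<dots> = - (\<Sum>b\<in>A. \<Sum>a\<in>A. g b a)"
    by (subst sum.swap) (simp add: sum_negf)
  finally show ?thesis by (simp add: eq_neg_iff_add_eq_0)
qed

section \<open>The operators of the equations\<close>

lemma act_e:
  "act m sl2_e i u J =
     (if J i < m i then of_nat (J i + 1) * (of_nat (m i) - of_nat (J i)) * u (J(i := J i + 1)) else 0)"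
proof -
  have "act m sl2_e i u J = (\<Sum>a\<le>m i. if a = J i + 1 then
      of_nat (J i + 1) * (of_nat (m i) - of_nat (J i)) * u (J(i := J i + 1)) else 0)"
    unfolding act_def by (intro sum.cong) (auto simp: algebra_simps)
  thus ?thesis by auto
qed

lemma act_f:
  "act m sl2_f i u J = (if 1 \<le> J i \<and> J i \<le> m i then u (J(i := J i - 1)) else 0)"
proof (cases "1 \<le> J i \<and> J i \<le> m i")
  case True
  have "act m sl2_f i u J = (\<Sum>a\<le>m i. if a = J i - 1 then u (J(i := J i - 1)) else 0)"
    unfolding act_def using True by (intro sum.cong) auto
  thus ?thesis using True by auto
next
  case False
  thus ?thesis unfolding act_def by (auto intro!: sum.neutral)
qed

lemma act_h:
  assumes "J i \<le> m i"
  shows "act m sl2_h i u J = (of_nat (m i) - 2 * of_nat (J i)) * u J"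
proof -
  have "act m sl2_h i u J = (\<Sum>a\<le>m i. if a = J i then (of_nat (m i) - 2 * of_nat (J i)) * u J else 0)"
    unfolding act_def by (intro sum.cong) auto
  thus ?thesis using assms by auto
qed

section \<open>The weight functions as sums over colorings\<close>

text \<open>Cuts \<open>{1..k}\<close> into consecutive blocks of lengths \<open>J 1\<close>,
  \<open>J 2\<close> and so on, as the arguments of the permutations in the weight function are
  arranged. Taking the least \<open>l\<close> skips the empty blocks.\<close>

definition block_color :: "(nat \<Rightarrow> nat) \<Rightarrow> nat \<Rightarrow> nat" where
  "block_color J a = (LEAST l. a \<le> (\<Sum>r=1..l. J r))"

lemma block_color_eq_iff:
  assumes "l \<ge> 1" "a \<ge> 1" "a \<le> (\<Sum>r=1..n. J r)"
  shows "block_color J a = l \<longleftrightarrow> a \<in> {(\<Sum>r=1..<l. J r) + 1..(\<Sum>r=1..<l. J r) + J l}"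
proof -
  have mono: "(\<Sum>r=1..i. J r) \<le> (\<Sum>r=1..j. J r)" if "i \<le> j" for i j
    using that by (intro sum_mono2) auto
  obtain l' where l': "l = Suc l'" using assms(1) by (cases l) auto
  have ends: "(\<Sum>r=1..<l. J r) = (\<Sum>r=1..l'. J r)" "(\<Sum>r=1..l'. J r) + J l = (\<Sum>r=1..l. J r)"
    unfolding l' by (simp_all add: atLeastLessThanSuc_atLeastAtMost)
  show ?thesis
  proof
    assume b: "block_color J a = l"
    have "a \<le> (\<Sum>r=1..l. J r)"
      unfolding b[symmetric] block_color_def by (rule LeastI) (rule assms(3))
    moreover have "\<not> a \<le> (\<Sum>r=1..l'. J r)"
      by (rule not_less_Least) (use b in \<open>simp add: block_color_def l'\<close>)
    ultimately show "a \<in> {(\<Sum>r=1..<l. J r) + 1..(\<Sum>r=1..<l. J r) + J l}"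
      unfolding ends by auto
  next
    assume "a \<in> {(\<Sum>r=1..<l. J r) + 1..(\<Sum>r=1..<l. J r) + J l}"
    hence a: "a > (\<Sum>r=1..l'. J r)" "a \<le> (\<Sum>r=1..l. J r)" unfolding ends by auto
    show "block_color J a = l"
      unfolding block_color_def
    proof (rule Least_equality)
      fix y assume y: "a \<le> (\<Sum>r=1..y. J r)"
      show "l \<le> y"
        using mono[of y l'] y a(1) unfolding l' by (cases "y \<le> l'") auto
    qed (rule a(2))
  qed
qed

lemma block_color_range:
  assumes "a \<ge> 1" "a \<le> (\<Sum>r=1..n. J r)"
  shows "block_color J a \<in> {1..n}"
proof -
  have "block_color J a \<le> n"
    unfolding block_color_def using assms(2) by (rule Least_le)
  moreover have "a \<le> (\<Sum>r=1..block_color J a. J r)"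
    unfolding block_color_def using assms(2) by (rule LeastI)
  hence "block_color J a \<noteq> 0" using assms(1) by (intro notI) simp
  ultimately show ?thesis by simp
qed

lemma block_color_fiber:
  assumes k: "(\<Sum>l=1..n. J l) = k" and l: "l \<in> {1..n}"
  shows "{a\<in>{1..k}. block_color J a = l} = {(\<Sum>r=1..<l. J r) + 1..(\<Sum>r=1..<l. J r) + J l}"
proof (rule equalityI; rule subsetI)
  fix a assume "a \<in> {a\<in>{1..k}. block_color J a = l}"
  hence a: "a \<ge> 1" "a \<le> (\<Sum>l=1..n. J l)" "block_color J a = l" unfolding k by auto
  show "a \<in> {(\<Sum>r=1..<l. J r) + 1..(\<Sum>r=1..<l. J r) + J l}"
    using block_color_eq_iff[OF _ a(1,2), of l] a(3) l by simp
next
  fix a assume a: "a \<in> {(\<Sum>r=1..<l. J r) + 1..(\<Sum>r=1..<l. J r) + J l}"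
  have "(\<Sum>r=1..<l. J r) + J l = (\<Sum>r=1..l. J r)"
    using l by (simp add: sum.last_plus add.commute atLeastLessThanSuc_atLeastAtMost[symmetric])
  also have "\<dots> \<le> (\<Sum>l=1..n. J l)" using l by (intro sum_mono2) auto
  finally have a': "a \<ge> 1" "a \<le> (\<Sum>l=1..n. J l)" using a by auto
  hence "block_color J a = l" using block_color_eq_iff[OF _ a', of l] a l by simp
  thus "a \<in> {a\<in>{1..k}. block_color J a = l}" using a' unfolding k by simp
qed

lemma prod_blocks:
  fixes h :: "nat \<Rightarrow> nat \<Rightarrow> 'a :: comm_monoid_mult"
  assumes k: "(\<Sum>l=1..n. J l) = k"
  shows "(\<Prod>l=1..n. \<Prod>i=1..J l. h l ((\<Sum>r=1..<l. J r) + i)) = (\<Prod>a=1..k. h (block_color J a) a)"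
proof -
  have "(\<Prod>a=1..k. h (block_color J a) a) =
      (\<Prod>l=1..n. \<Prod>a\<in>{a\<in>{1..k}. block_color J a = l}. h (block_color J a) a)"
    using block_color_range[of _ J n] k by (intro prod.group[symmetric]) auto
  also have "\<dots> = (\<Prod>l=1..n. \<Prod>a\<in>{(\<Sum>r=1..<l. J r) + 1..(\<Sum>r=1..<l. J r) + J l}. h l a)"
  proof (rule prod.cong[OF refl])
    fix l assume l: "l \<in> {1..n}"
    show "(\<Prod>a\<in>{a\<in>{1..k}. block_color J a = l}. h (block_color J a) a) =
        (\<Prod>a\<in>{(\<Sum>r=1..<l. J r) + 1..(\<Sum>r=1..<l. J r) + J l}. h l a)"
      unfolding block_color_fiber[OF k l, symmetric] by (rule prod.cong) auto
  qed
  also have "\<dots> = (\<Prod>l=1..n. \<Prod>i=1..J l. h l ((\<Sum>r=1..<l. J r) + i))"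
  proof (rule prod.cong[OF refl])
    fix l
    show "(\<Prod>a\<in>{(\<Sum>r=1..<l. J r) + 1..(\<Sum>r=1..<l. J r) + J l}. h l a) =
      (\<Prod>i=1..J l. h l ((\<Sum>r=1..<l. J r) + i))"
      by (rule prod.reindex_bij_witness[where i = "\<lambda>i. (\<Sum>r=1..<l. J r) + i"
            and j = "\<lambda>a. a - (\<Sum>r=1..<l. J r)"]) auto
  qed
  finally show ?thesis by simp
qed

lemma count_image_mset_set:
  assumes "finite A"
  shows "count (image_mset d (mset_set A)) l = card {a\<in>A. d a = l}"
proof -
  have "count (image_mset d (mset_set A)) l = (\<Sum>a\<in>{a\<in>A. d a = l}. 1)"
    unfolding count_image_mset' using assms by (intro sum.cong) auto
  thus ?thesis by simp
qed

text \<open>Prescribing the number of points of each color is the same as prescribing the multiset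
  of values, which connects colorings with permutations of multisets.\<close>

lemma mem_colorings_iff_mset:
  assumes c: "c \<in> colorings k n J" and c': "c' \<in> {1..k} \<rightarrow>\<^sub>E {1..n}"
  shows "c' \<in> colorings k n J \<longleftrightarrow>
    image_mset c' (mset_set {1..k}) = image_mset c (mset_set {1..k})"
proof -
  have cnt: "count (image_mset d (mset_set {1..k})) l = card {a\<in>{1..k}. d a = l}" for d :: "nat \<Rightarrow> nat" and l
    by (rule count_image_mset_set) simp
  have out: "card {a\<in>{1..k}. d a = l} = 0" if "d \<in> {1..k} \<rightarrow>\<^sub>E {1..n}" "l \<notin> {1..n}" for d l
    using that by (auto simp: PiE_iff)
  show ?thesis
  proof
    assume c'': "c' \<in> colorings k n J"
    have cE: "c \<in> {1..k} \<rightarrow>\<^sub>E {1..n}" using c by (simp add: colorings_def)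
    have "card {a\<in>{1..k}. c' a = l} = card {a\<in>{1..k}. c a = l}" for l
    proof (cases "l \<in> {1..n}")
      case True
      show ?thesis by (simp only: coloring_card[OF c'' True] coloring_card[OF c True])
    next
      case False
      show ?thesis by (simp only: out[OF c' False] out[OF cE False])
    qed
    thus "image_mset c' (mset_set {1..k}) = image_mset c (mset_set {1..k})"
      by (intro multiset_eqI) (simp only: cnt)
  next
    assume "image_mset c' (mset_set {1..k}) = image_mset c (mset_set {1..k})"
    hence "card {a\<in>{1..k}. c' a = l} = card {a\<in>{1..k}. c a = l}" for l
      by (metis cnt)
    thus "c' \<in> colorings k n J" using c c' by (simp add: colorings_def)
  qed
qed

text \<open>Written as the word \<open>c 1, ..., c k\<close>, a coloring is a permutation of the
  multiset in which \<open>l\<close> occurs \<open>J l\<close> times, so the number of colorings is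
  a multinomial coefficient. Lists are indexed from 0 and points from 1, hence the index
  \<open>a - 1\<close>.\<close>

lemma card_colorings_fact:
  assumes c: "c \<in> colorings k n J"
  shows "card (colorings k n J) * (\<Prod>l=1..n. fact (J l)) = fact k"
proof -
  let ?A = "image_mset c (mset_set {1..k})"
  have cnt: "count ?A l = card {a\<in>{1..k}. c a = l}" for l
    by (rule count_image_mset_set) simp
  have msetmap: "mset (map d [1..<Suc k]) = image_mset d (mset_set {1..k})" for d :: "nat \<Rightarrow> nat"
    by (metis atLeastLessThanSuc_atLeastAtMost mset_map mset_upt)
  have "bij_betw (\<lambda>d. map d [1..<Suc k]) (colorings k n J) (permutations_of_multiset ?A)"
  proof (rule bij_betw_byWitness[where f' = "\<lambda>xs. restrict (\<lambda>a. xs ! (a - 1)) {1..k}"])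
    show "\<forall>d\<in>colorings k n J. restrict (\<lambda>a. map d [1..<Suc k] ! (a - 1)) {1..k} = d"
      by (auto simp: colorings_def PiE_iff extensional_def fun_eq_iff simp del: upt_Suc)
    have len: "length xs = k" if "xs \<in> permutations_of_multiset ?A" for xs
      using that by (metis card_atLeastAtMost diff_Suc_1 permutations_of_multisetD size_image_mset
          size_mset size_mset_set)
    have map: "map (restrict (\<lambda>a. xs ! (a - 1)) {1..k}) [1..<Suc k] = xs"
      if "xs \<in> permutations_of_multiset ?A" for xs
      using len[OF that] by (intro nth_equalityI) (auto simp del: upt_Suc)
    show "\<forall>xs\<in>permutations_of_multiset ?A.
        map (restrict (\<lambda>a. xs ! (a - 1)) {1..k}) [1..<Suc k] = xs"
      using map by blast
    show "(\<lambda>d. map d [1..<Suc k]) ` colorings k n J \<subseteq> permutations_of_multiset ?A"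
    proof (intro image_subsetI permutations_of_multisetI)
      fix d assume d: "d \<in> colorings k n J"
      hence "d \<in> {1..k} \<rightarrow>\<^sub>E {1..n}" by (simp add: colorings_def)
      thus "mset (map d [1..<Suc k]) = ?A"
        unfolding msetmap using mem_colorings_iff_mset[OF c] d by blast
    qed
    show "(\<lambda>xs. restrict (\<lambda>a. xs ! (a - 1)) {1..k}) ` permutations_of_multiset ?A \<subseteq> colorings k n J"
    proof (intro image_subsetI)
      fix xs assume xs: "xs \<in> permutations_of_multiset ?A"
      let ?d = "restrict (\<lambda>a. xs ! (a - 1)) {1..k}"
      have "set xs \<subseteq> {1..n}"
        using permutations_of_multisetD[OF xs] coloring_range[OF c]
        by (auto simp flip: set_mset_mset simp del: atLeastAtMost_iff)
      hence "?d \<in> {1..k} \<rightarrow>\<^sub>E {1..n}"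
        using len[OF xs] nth_mem[of _ xs] by (intro restrict_PiE_iff[THEN iffD2] ballI) fastforce
      moreover have "image_mset ?d (mset_set {1..k}) = ?A"
        using permutations_of_multisetD[OF xs] by (simp only: msetmap[symmetric] map[OF xs])
      ultimately show "?d \<in> colorings k n J" using mem_colorings_iff_mset[OF c] by blast
    qed
  qed
  hence "card (colorings k n J) = card (permutations_of_multiset ?A)"
    by (rule bij_betw_same_card)
  moreover have "(\<Prod>l\<in>set_mset ?A. fact (count ?A l)) = (\<Prod>l=1..n. fact (J l) :: nat)"
  proof (rule prod.mono_neutral_cong_left)
    show "set_mset ?A \<subseteq> {1..n}" using coloring_range[OF c] by auto
    show "\<forall>l\<in>{1..n} - set_mset ?A. fact (J l) = (1 :: nat)"
      using coloring_card[OF c] cnt by (metis DiffE count_eq_zero_iff fact_0)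
    show "fact (count ?A l) = (fact (J l) :: nat)" if "l \<in> set_mset ?A" for l
      using coloring_card[OF c] coloring_range[OF c] that unfolding cnt by auto
  qed simp
  ultimately show ?thesis using card_permutations_of_multiset_aux[of ?A] by simp
qed

text \<open>Permutations act transitively on the colorings of type \<open>J\<close>: some
  \<open>\<tau>\<close> satisfies \<open>d = c o \<tau>\<close>, and composing with its inverse
  matches the fibre over \<open>d\<close> with the fibre over \<open>c\<close>. As all fibres are
  equally large and together contain \<open>fact k\<close> permutations,
  \<open>card_colorings_fact\<close> determines their size.\<close>

lemma card_permutations_to_coloring:
  assumes c: "c \<in> colorings k n J" and d: "d \<in> colorings k n J"
  shows "card {\<sigma>. \<sigma> permutes {1..k} \<and> c \<circ> \<sigma> = d} = (\<Prod>l=1..n. fact (J l))"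
proof -
  let ?N = "\<lambda>d. card {\<sigma>. \<sigma> permutes {1..k} \<and> c \<circ> \<sigma> = d}"
  have const: "?N d = ?N c" if d: "d \<in> colorings k n J" for d
  proof -
    have ext: "d' \<in> {1..k} \<rightarrow>\<^sub>E {1..n}" if "d' \<in> colorings k n J" for d'
      using that by (simp add: colorings_def)
    have "image_mset d (mset_set {1..k}) = image_mset c (mset_set {1..k})"
      using mem_colorings_iff_mset[OF c ext[OF d]] d by blast
    then obtain \<tau> where \<tau>: "\<tau> permutes {1..k}" "\<forall>a\<in>{1..k}. d a = c (\<tau> a)"
      using image_mset_eq_implies_permutes[of "{1..k}" d c] by auto
    have dc: "d = c \<circ> \<tau>"
    proof
      fix a
      show "d a = (c \<circ> \<tau>) a"
        using \<tau> ext[OF d] ext[OF c]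
        by (cases "a \<in> {1..k}") (auto simp: PiE_iff extensional_def permutes_not_in simp del: atLeastAtMost_iff)
    qed
    show ?thesis
    proof (rule bij_betw_same_card[of "\<lambda>\<sigma>. \<sigma> \<circ> Hilbert_Choice.inv \<tau>"],
        rule bij_betw_byWitness[where f' = "\<lambda>\<sigma>. \<sigma> \<circ> \<tau>"])
      have i: "\<tau> \<circ> Hilbert_Choice.inv \<tau> = id" "Hilbert_Choice.inv \<tau> \<circ> \<tau> = id"
        using permutes_inv_o[OF \<tau>(1)] by auto
      show "\<forall>\<sigma>\<in>{\<sigma>. \<sigma> permutes {1..k} \<and> c \<circ> \<sigma> = d}. \<sigma> \<circ> Hilbert_Choice.inv \<tau> \<circ> \<tau> = \<sigma>"
        by (simp add: comp_assoc i)
      show "\<forall>\<sigma>\<in>{\<sigma>. \<sigma> permutes {1..k} \<and> c \<circ> \<sigma> = c}. \<sigma> \<circ> \<tau> \<circ> Hilbert_Choice.inv \<tau> = \<sigma>"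
        by (simp add: comp_assoc i)
      show "(\<lambda>\<sigma>. \<sigma> \<circ> Hilbert_Choice.inv \<tau>) ` {\<sigma>. \<sigma> permutes {1..k} \<and> c \<circ> \<sigma> = d}
          \<subseteq> {\<sigma>. \<sigma> permutes {1..k} \<and> c \<circ> \<sigma> = c}"
        using \<tau>(1) by (auto simp: dc permutes_compose permutes_inv comp_assoc[symmetric])
          (metis comp_assoc comp_id dc i(1))
      show "(\<lambda>\<sigma>. \<sigma> \<circ> \<tau>) ` {\<sigma>. \<sigma> permutes {1..k} \<and> c \<circ> \<sigma> = c}
          \<subseteq> {\<sigma>. \<sigma> permutes {1..k} \<and> c \<circ> \<sigma> = d}"
        using \<tau>(1) by (auto simp: dc permutes_compose comp_assoc[symmetric])
    qed
  qed
  have "fact k = (\<Sum>\<sigma> | \<sigma> permutes {1..k}. 1 :: nat)"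
    using card_permutations[of "{1..k}" k] by simp
  also have "\<dots> = (\<Sum>d\<in>colorings k n J. \<Sum>\<sigma>\<in>{\<sigma> \<in> {\<sigma>. \<sigma> permutes {1..k}}. c \<circ> \<sigma> = d}. 1)"
    using coloring_permute[OF c] by (intro sum.group[symmetric]) (auto simp: finite_permutations)
  also have "\<dots> = (\<Sum>d\<in>colorings k n J. ?N c)"
    by (intro sum.cong refl) (simp only: mem_Collect_eq card_eq_sum[symmetric] const)
  finally have "card (colorings k n J) * ?N c = card (colorings k n J) * (\<Prod>l=1..n. fact (J l))"
    unfolding card_colorings_fact[OF c] by simp
  moreover have "card (colorings k n J) \<noteq> 0" using c by (auto simp: card_eq_0_iff)
  ultimately have "?N c = (\<Prod>l=1..n. fact (J l))" 
    using mult_left_cancel[of "card (colorings k n J)"] by blast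
  with const[OF d] show ?thesis by (rule trans)
qed

text \<open>Applying \<open>\<sigma>\<close> to the blocks colors the points by
  \<open>c o inv \<sigma>\<close>, where \<open>c\<close> is the block coloring. Every coloring
  arises from the same number of permutations, namely the product of the \<open>fact (J l)\<close>,
  and this cancels the prefactor.\<close>

lemma sum_permutations_blocks:
  fixes g :: "nat \<Rightarrow> nat \<Rightarrow> 'a :: field_char_0"
  assumes k: "(\<Sum>l=1..n. J l) = k"
  shows "1 / (\<Prod>l=1..n. fact (J l)) * (\<Sum>\<sigma> | \<sigma> permutes {1..k}.
      \<Prod>l=1..n. \<Prod>i=1..J l. g (\<sigma> ((\<Sum>r=1..<l. J r) + i)) l) =
    (\<Sum>c\<in>colorings k n J. \<Prod>a=1..k. g a (c a))"
proof -
  define c where "c = restrict (block_color J) {1..k}"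
  define w where "w d = (\<Prod>a=1..k. g a (d a))" for d
  have c: "c \<in> colorings k n J"
  proof -
    have "card {a\<in>{1..k}. c a = l} = J l" if l: "l \<in> {1..n}" for l
    proof -
      have "{a\<in>{1..k}. c a = l} = {a\<in>{1..k}. block_color J a = l}" by (auto simp: c_def)
      also have "\<dots> = {(\<Sum>r=1..<l. J r) + 1..(\<Sum>r=1..<l. J r) + J l}"
        by (rule block_color_fiber[OF k l])
      finally show ?thesis by simp
    qed
    thus ?thesis using block_color_range[of _ J n] k by (auto simp: colorings_def c_def)
  qed
  have "(\<Sum>\<sigma> | \<sigma> permutes {1..k}. \<Prod>l=1..n. \<Prod>i=1..J l. g (\<sigma> ((\<Sum>r=1..<l. J r) + i)) l) =
    (\<Sum>\<sigma> | \<sigma> permutes {1..k}. w (c \<circ> Hilbert_Choice.inv \<sigma>))"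
  proof (intro sum.cong refl)
    fix \<sigma> assume "\<sigma> \<in> {\<sigma>. \<sigma> permutes {1..k}}"
    hence \<sigma>: "\<sigma> permutes {1..k}" by simp
    have "(\<Prod>l=1..n. \<Prod>i=1..J l. g (\<sigma> ((\<Sum>r=1..<l. J r) + i)) l) =
        (\<Prod>a=1..k. g (\<sigma> a) (block_color J a))"
      by (rule prod_blocks[OF k, of "\<lambda>l a. g (\<sigma> a) l"])
    also have "\<dots> = (\<Prod>a=1..k. g (\<sigma> a) (c (Hilbert_Choice.inv \<sigma> (\<sigma> a))))"
      by (intro prod.cong refl) (simp add: permutes_inverses[OF \<sigma>] c_def)
    also have "\<dots> = w (c \<circ> Hilbert_Choice.inv \<sigma>)"
      unfolding w_def using prod.permute[OF \<sigma>, of "\<lambda>a. g a (c (Hilbert_Choice.inv \<sigma> a))"]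
      by (simp add: comp_def)
    finally show "(\<Prod>l=1..n. \<Prod>i=1..J l. g (\<sigma> ((\<Sum>r=1..<l. J r) + i)) l) =
      w (c \<circ> Hilbert_Choice.inv \<sigma>)" .
  qed
  also have "\<dots> = (\<Sum>\<sigma> | \<sigma> permutes {1..k}. w (c \<circ> \<sigma>))"
    by (rule sum_permutations_inverse[symmetric])
  also have "\<dots> = (\<Sum>d\<in>colorings k n J. \<Sum>\<sigma>\<in>{\<sigma> \<in> {\<sigma>. \<sigma> permutes {1..k}}. c \<circ> \<sigma> = d}. w (c \<circ> \<sigma>))"
    using coloring_permute[OF c] by (intro sum.group[symmetric]) (auto simp: finite_permutations)
  also have "\<dots> = (\<Sum>d\<in>colorings k n J. of_nat (\<Prod>l=1..n. fact (J l)) * w d)"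
  proof (rule sum.cong[OF refl])
    fix d assume d: "d \<in> colorings k n J"
    have "(\<Sum>\<sigma>\<in>{\<sigma> \<in> {\<sigma>. \<sigma> permutes {1..k}}. c \<circ> \<sigma> = d}. w (c \<circ> \<sigma>)) =
        of_nat (card {\<sigma>. \<sigma> permutes {1..k} \<and> c \<circ> \<sigma> = d}) * w d"
      by simp
    thus "(\<Sum>\<sigma>\<in>{\<sigma> \<in> {\<sigma>. \<sigma> permutes {1..k}}. c \<circ> \<sigma> = d}. w (c \<circ> \<sigma>)) =
        of_nat (\<Prod>l=1..n. fact (J l)) * w d"
      unfolding card_permutations_to_coloring[OF c d] .
  qed
  also have "\<dots> = (\<Prod>l=1..n. fact (J l)) * (\<Sum>d\<in>colorings k n J. w d)"
    by (simp add: sum_distrib_left)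
  finally show ?thesis unfolding w_def by simp
qed

section \<open>Master functions with coefficients in a subring\<close>

locale subring_congruence =
  fixes S :: "'f :: field_char_0 set" and q :: 'f
  assumes S_one: "1 \<in> S" and S_uminus: "x \<in> S \<Longrightarrow> - x \<in> S"
    and S_add: "x \<in> S \<Longrightarrow> y \<in> S \<Longrightarrow> x + y \<in> S"
    and S_mult: "x \<in> S \<Longrightarrow> y \<in> S \<Longrightarrow> x * y \<in> S"
begin

lemma S_zero: "0 \<in> S"
  using S_add[OF S_one S_uminus[OF S_one]] by simp

lemma S_diff: "x \<in> S \<Longrightarrow> y \<in> S \<Longrightarrow> x - y \<in> S"
  using S_add[of x "- y"] S_uminus by simp

lemma S_sum: "(\<And>x. x \<in> A \<Longrightarrow> g x \<in> S) \<Longrightarrow> (\<Sum>x\<in>A. g x) \<in> S"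
  by (induction A rule: infinite_finite_induct) (auto simp: S_zero S_add)

lemma S_prod: "(\<And>x. x \<in> A \<Longrightarrow> g x \<in> S) \<Longrightarrow> (\<Prod>x\<in>A. g x) \<in> S"
  by (induction A rule: infinite_finite_induct) (auto simp: S_one S_mult)

lemma S_power: "x \<in> S \<Longrightarrow> x ^ r \<in> S"
  by (induction r) (auto simp: S_one S_mult)

definition congr :: "'f \<Rightarrow> 'f \<Rightarrow> bool" (infix "\<approx>" 50) where
  "x \<approx> y \<longleftrightarrow> x - y \<in> (*) q ` S"

lemma congrI: "x - y = q * s \<Longrightarrow> s \<in> S \<Longrightarrow> x \<approx> y"
  by (auto simp: congr_def)

lemma congr_refl [simp]: "x \<approx> x"
  using S_zero by (auto simp: congr_def intro!: image_eqI[of _ _ 0])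

lemma congr_add: "x \<approx> y \<Longrightarrow> x' \<approx> y' \<Longrightarrow> x + x' \<approx> y + y'"
  unfolding congr_def
proof (elim imageE)
  fix u v assume "x - y = q * u" "u \<in> S" "x' - y' = q * v" "v \<in> S"
  thus "x + x' - (y + y') \<in> (*) q ` S"
    by (intro image_eqI[of _ _ "u + v"]) (auto simp: S_add algebra_simps)
qed

lemma congr_mult: "s \<in> S \<Longrightarrow> x \<approx> y \<Longrightarrow> s * x \<approx> s * y"
  unfolding congr_def
proof (elim imageE)
  fix u assume "s \<in> S" "x - y = q * u" "u \<in> S"
  thus "s * x - s * y \<in> (*) q ` S"
    by (intro image_eqI[of _ _ "s * u"])
      (auto simp: S_mult mult.left_commute right_diff_distrib[symmetric])
qed

lemma congr_minus: "x \<approx> y \<Longrightarrow> - x \<approx> - y"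
  using congr_mult[OF S_uminus[OF S_one], of x y] by simp

lemma congr_diff: "x \<approx> y \<Longrightarrow> x' \<approx> y' \<Longrightarrow> x - x' \<approx> y - y'"
  using congr_add[of x y "- x'" "- y'"] congr_minus by simp

lemma congr_sum: "(\<And>x. x \<in> A \<Longrightarrow> f x \<approx> g x) \<Longrightarrow> (\<Sum>x\<in>A. f x) \<approx> (\<Sum>x\<in>A. g x)"
  by (induction A rule: infinite_finite_induct) (auto simp: congr_add)

lemma congr_trans [trans]: "x \<approx> y \<Longrightarrow> y \<approx> w \<Longrightarrow> x \<approx> w"
  using congr_add[of x y y w] by (simp add: congr_def)

lemma congr_eq_trans [trans]: "x \<approx> y \<Longrightarrow> y = w \<Longrightarrow> x \<approx> w"
  and eq_congr_trans [trans]: "x = y \<Longrightarrow> y \<approx> w \<Longrightarrow> x \<approx> w"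
  by simp_all

text \<open>Since \<open>Y\<close> is a set, every factor is divided out at most once, and its
  positive exponent pays for that.\<close>

lemma S_prod_power_div:
  assumes "finite I" "Y \<subseteq> I" "\<And>y. y \<in> I \<Longrightarrow> g y \<in> S" "\<And>y. y \<in> Y \<Longrightarrow> e y > 0 \<and> g y \<noteq> 0"
  shows "(\<Prod>y\<in>I. g y ^ e y) * (\<Prod>y\<in>Y. 1 / g y) \<in> S"
proof -
  have "(\<Prod>y\<in>I. g y ^ e y) * (\<Prod>y\<in>Y. 1 / g y) =
    (\<Prod>y\<in>I. g y ^ e y * (if y \<in> Y then 1 / g y else 1))"
    using assms(1,2) by (simp add: prod.distrib prod.inter_restrict[symmetric] Int_absorb1)
  also have "\<dots> = (\<Prod>y\<in>I. g y ^ (e y - (if y \<in> Y then 1 else 0)))"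
  proof (intro prod.cong refl)
    fix y assume "y \<in> I"
    show "g y ^ e y * (if y \<in> Y then 1 / g y else 1) = g y ^ (e y - (if y \<in> Y then 1 else 0))"
      using assms(4)[of y] by (cases "y \<in> Y"; cases "e y") auto
  qed
  also have "\<dots> \<in> S" using assms(3) by (intro S_prod S_power)
  finally show ?thesis .
qed

text \<open>The denominator is attached to \<open>s\<close> rather than to the congruent quantities.
  This is how a simple pole passes through a congruence.\<close>

lemma congr_div: "s / d \<in> S \<Longrightarrow> x \<approx> y \<Longrightarrow> s * (x / d) \<approx> s * (y / d)"
  using congr_mult[of "s / d" x y] by simp

text \<open>Stated multiplicatively, because a quotient \<open>D (f x) / f x\<close> may leave
  \<open>S\<close>. The cofactors in the product rule lie in \<open>S\<close> and therefore preserve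
  the congruence.\<close>

lemma congr_derivation_prod:
  assumes D: "derivation D" and "\<And>x. x \<in> A \<Longrightarrow> f x \<in> S" "\<And>x. x \<in> A \<Longrightarrow> D (f x) \<approx> g x * f x"
  shows "D (\<Prod>x\<in>A. f x) \<approx> (\<Sum>x\<in>A. g x) * (\<Prod>x\<in>A. f x)"
proof -
  interpret derivation D by (rule D)
  show ?thesis
    using assms(2,3)
  proof (induction A rule: infinite_finite_induct)
    case (insert x A)
    have "(\<Prod>y\<in>A. f y) * D (f x) + f x * D (\<Prod>y\<in>A. f y) \<approx>
        (\<Prod>y\<in>A. f y) * (g x * f x) + f x * ((\<Sum>y\<in>A. g y) * (\<Prod>y\<in>A. f y))"
      using insert by (intro congr_add congr_mult S_prod) auto
    thus ?case using insert.hyps by (simp add: mult algebra_simps)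
  qed simp_all
qed

end

text \<open>\<open>h\<close> stands for \<open>1 / \<kappa>\<close>, \<open>q\<close> for the prime
  power and \<open>E\<close> for the product of the truncated exponentials. The variables are merely
  distinct elements of a field whose derivatives are prescribed in the lemmas, so the computation is
  separated from the construction of the rational functions.\<close>

locale master_function = subring_congruence S q
  for S :: "'f :: field_char_0 set" and q :: 'f +
  fixes k n :: nat and m M :: "nat \<Rightarrow> nat" and M2 :: "nat \<Rightarrow> nat \<Rightarrow> nat" and M0 :: nat
    and t z :: "nat \<Rightarrow> 'f" and h E :: 'f
  assumes t_S: "a \<in> {1..k} \<Longrightarrow> t a \<in> S" and z_S: "l \<in> {1..n} \<Longrightarrow> z l \<in> S"
    and E_S: "E \<in> S"
    and t_z: "a \<in> {1..k} \<Longrightarrow> l \<in> {1..n} \<Longrightarrow> t a \<noteq> z l"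
    and t_t: "a \<in> {1..k} \<Longrightarrow> b \<in> {1..k} \<Longrightarrow> a \<noteq> b \<Longrightarrow> t a \<noteq> t b"
    and z_z: "i \<in> {1..n} \<Longrightarrow> j \<in> {1..n} \<Longrightarrow> i \<noteq> j \<Longrightarrow> z i \<noteq> z j"
    and M_pos: "l \<in> {1..n} \<Longrightarrow> M l > 0"
    and M_cong: "l \<in> {1..n} \<Longrightarrow> of_nat (M l) + of_nat (m l) * h \<in> (*) q ` S"
    and M2_pos: "i \<in> {1..n} \<Longrightarrow> j \<in> {1..n} \<Longrightarrow> i < j \<Longrightarrow> M2 i j > 0"
    and M2_cong: "i \<in> {1..n} \<Longrightarrow> j \<in> {1..n} \<Longrightarrow> i < j \<Longrightarrow>
      of_nat (M2 i j) - of_nat (m i) * of_nat (m j) * h / 2 \<in> (*) q ` S"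
    and M0_pos: "M0 > 0" and M0_cong: "of_nat M0 - 2 * h \<in> (*) q ` S"
begin

lemma S_vandermonde:
  fixes x :: "nat \<Rightarrow> 'f"
  assumes xS: "\<And>i. i \<in> {1..r} \<Longrightarrow> x i \<in> S"
  shows "(\<Prod>j=1..r. \<Prod>i=1..<j. (x i - x j) ^ N i j) \<in> S"
  by (intro S_prod S_power S_diff xS) auto

lemma S_vandermonde_div:
  fixes x :: "nat \<Rightarrow> 'f"
  assumes xS: "\<And>i. i \<in> {1..r} \<Longrightarrow> x i \<in> S"
    and ij: "i \<in> {1..r}" "j \<in> {1..r}" "i \<noteq> j" and x: "x i \<noteq> x j"
    and N: "i < j \<Longrightarrow> N i j > 0" "j < i \<Longrightarrow> N j i > 0"
  shows "(\<Prod>j=1..r. \<Prod>i=1..<j. (x i - x j) ^ N i j) / (x i - x j) \<in> S" (is "?V / _ \<in> S")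
proof -
  define g where "g = (\<lambda>(j, i). x i - x j)"
  define e where "e = (\<lambda>(j, i). N i j)"
  let ?I = "SIGMA j:{1..r}. {1..<j}"
  have V: "?V = (\<Prod>y\<in>?I. g y ^ e y)"
    by (subst prod.Sigma) (auto simp: g_def e_def case_prod_unfold)
  have *: "?V / (x i' - x j') \<in> S"
    if "i' \<in> {1..r}" "j' \<in> {1..r}" "i' < j'" "N i' j' > 0" "x i' \<noteq> x j'" for i' j'
  proof -
    have "(\<Prod>y\<in>?I. g y ^ e y) * (\<Prod>y\<in>{(j', i')}. 1 / g y) \<in> S"
      by (rule S_prod_power_div) (use that xS in \<open>auto simp: g_def e_def intro!: S_diff\<close>)
    thus ?thesis unfolding V by (simp add: g_def)
  qed
  show ?thesis
  proof (cases "i < j")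
    case True
    show ?thesis by (rule *[OF ij(1,2) True N(1)[OF True] x])
  next
    case False
    hence "j < i" using ij(3) by simp
    hence "- (?V / (x j - x i)) \<in> S"
      by (intro S_uminus *[OF ij(2,1)] N(2) x[symmetric])
    also have "- (?V / (x j - x i)) = ?V / (x i - x j)"
      by (simp only: minus_divide_right minus_diff_eq)
    finally show ?thesis .
  qed
qed

definition Zf :: 'f where "Zf = (\<Prod>j=1..n. \<Prod>i=1..<j. (z i - z j) ^ M2 i j)"
definition Tf :: 'f where "Tf = (\<Prod>j=1..k. \<Prod>i=1..<j. (t i - t j) ^ M0)"
definition Xf :: 'f where "Xf = (\<Prod>l=1..n. \<Prod>i=1..k. (t i - z l) ^ M l)"
text \<open>The master polynomial without its exponential factors.\<close>

definition B :: 'f where "B = Zf * Tf * Xf"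

definition W :: "(nat \<Rightarrow> nat) \<Rightarrow> 'f" where
  "W c = (\<Prod>a=1..k. 1 / (t a - z (c a)))"

text \<open>This is \<open>W c\<close> without the pole of the point \<open>a\<close>, that is,
  \<open>W c * (t a - z (c a))\<close> for \<open>a\<close> in range. It does not depend on the
  color of \<open>a\<close>.\<close>

definition V :: "(nat \<Rightarrow> nat) \<Rightarrow> nat \<Rightarrow> 'f" where
  "V c a = (\<Prod>b\<in>{1..k} - {a}. 1 / (t b - z (c b)))"

lemma W_V: "a \<in> {1..k} \<Longrightarrow> W c = V c a / (t a - z (c a))"
  unfolding W_def V_def by (subst prod.remove[of _ a]) auto

lemma V_upd [simp]: "V (c(a := i)) a = V c a"
  unfolding V_def by (intro prod.cong) auto

lemma W_upd:
  assumes "a \<in> {1..k}" "c a \<in> {1..n}" "i \<in> {1..n}"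
  shows "W (c(a := i)) = W c * ((t a - z (c a)) / (t a - z i))"
  using assms t_z[of a] by (simp add: W_V del: atLeastAtMost_iff)

lemma Z_S: "Zf \<in> S" and T_S: "Tf \<in> S"
  unfolding Zf_def Tf_def by (intro S_vandermonde t_S z_S; assumption)+

lemma Z_div_S: "i \<in> {1..n} \<Longrightarrow> j \<in> {1..n} \<Longrightarrow> i \<noteq> j \<Longrightarrow> Zf / (z i - z j) \<in> S"
  unfolding Zf_def by (intro S_vandermonde_div z_S z_z M2_pos)

lemma T_div_S: "a \<in> {1..k} \<Longrightarrow> b \<in> {1..k} \<Longrightarrow> Tf / (t a - t b) \<in> S"
  unfolding Tf_def
  \<comment> \<open>For \<open>a = b\<close> the quotient is 0, because division by 0 gives
    0.\<close>
  by (cases "a = b") (simp add: S_zero, intro S_vandermonde_div t_S t_t M0_pos)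

lemma X_div_S:
  assumes "Y \<subseteq> {1..n} \<times> {1..k}"
  shows "Xf * (\<Prod>(l, a)\<in>Y. 1 / (t a - z l)) \<in> S"
proof -
  have "Xf = (\<Prod>(l, a)\<in>{1..n} \<times> {1..k}. (t a - z l) ^ M l)"
    unfolding Xf_def by (rule prod.cartesian_product)
  moreover have "(\<Prod>y\<in>{1..n} \<times> {1..k}. (case y of (l, a) \<Rightarrow> t a - z l) ^ (case y of (l, a) \<Rightarrow> M l)) *
      (\<Prod>y\<in>Y. 1 / (case y of (l, a) \<Rightarrow> t a - z l)) \<in> S"
  proof (rule S_prod_power_div)
    fix y assume "y \<in> {1..n} \<times> {1..k}"
    thus "(case y of (l, a) \<Rightarrow> t a - z l) \<in> S"
      by (cases y) (auto intro!: S_diff t_S z_S simp del: atLeastAtMost_iff)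
  next
    fix y assume "y \<in> Y"
    then obtain l a where "y = (l, a)" "l \<in> {1..n}" "a \<in> {1..k}" using assms by blast
    thus "(case y of (l, a) \<Rightarrow> M l) > 0 \<and> (case y of (l, a) \<Rightarrow> t a - z l) \<noteq> 0"
      using M_pos t_z by simp
  qed (use assms in auto)
  ultimately show ?thesis by (simp add: case_prod_unfold)
qed

text \<open>\<open>W c\<close> uses up one linear factor of \<open>Xf\<close> for each pair
  \<open>(c b, b)\<close>, and \<open>c a \<noteq> j\<close> makes \<open>(j, a)\<close> a new pair.
  For \<open>c a = j\<close> the pole would be double, and an exponent \<open>M j = 1\<close> could
  not absorb it.\<close>

lemma X_W_div_S:
  assumes c: "\<And>b. b \<in> {1..k} \<Longrightarrow> c b \<in> {1..n}"
    and a: "a \<in> {1..k}" "j \<in> {1..n}" "c a \<noteq> j"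
  shows "Xf * W c / (t a - z j) \<in> S"
proof -
  have "W c = (\<Prod>(l, b)\<in>(\<lambda>b. (c b, b)) ` {1..k}. 1 / (t b - z l))"
    unfolding W_def by (subst prod.reindex) (auto simp: inj_on_def)
  hence "W c / (t a - z j) =
      (\<Prod>(l, b)\<in>insert (j, a) ((\<lambda>b. (c b, b)) ` {1..k}). 1 / (t b - z l))"
    using a by (subst prod.insert) auto
  moreover have "insert (j, a) ((\<lambda>b. (c b, b)) ` {1..k}) \<subseteq> {1..n} \<times> {1..k}"
    using a c by auto
  ultimately show ?thesis using X_div_S by (simp only: times_divide_eq_right[symmetric])
qed

lemma X_V_S:
  assumes c: "\<And>b. b \<in> {1..k} \<Longrightarrow> c b \<in> {1..n}"
  shows "Xf * V c a \<in> S"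
proof -
  have "V c a = (\<Prod>(l, b)\<in>(\<lambda>b. (c b, b)) ` ({1..k} - {a}). 1 / (t b - z l))"
    unfolding V_def by (subst prod.reindex) (auto simp: inj_on_def)
  moreover have "(\<lambda>b. (c b, b)) ` ({1..k} - {a}) \<subseteq> {1..n} \<times> {1..k}"
    using c by auto
  ultimately show ?thesis using X_div_S by simp
qed

lemma X_W_S:
  assumes c: "\<And>b. b \<in> {1..k} \<Longrightarrow> c b \<in> {1..n}"
  shows "Xf * W c \<in> S"
proof -
  have "W c = (\<Prod>(l, b)\<in>(\<lambda>b. (c b, b)) ` {1..k}. 1 / (t b - z l))"
    unfolding W_def by (subst prod.reindex) (auto simp: inj_on_def)
  moreover have "(\<lambda>b. (c b, b)) ` {1..k} \<subseteq> {1..n} \<times> {1..k}"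
    using c by auto
  ultimately show ?thesis using X_div_S by simp
qed

text \<open>\<open>V c a / (t a - z j)\<close> is \<open>W\<close> for the coloring that gives
  \<open>a\<close> the color \<open>j\<close>, so its poles are simple even when
  \<open>j = c a\<close>.\<close>

lemma X_V_div_S:
  assumes c: "\<And>b. b \<in> {1..k} \<Longrightarrow> c b \<in> {1..n}" and a: "a \<in> {1..k}" "j \<in> {1..n}"
  shows "Xf * V c a / (t a - z j) \<in> S"
  using X_W_S[of "c(a := j)"] W_V[of a "c(a := j)"] c a by auto

context
  fixes c :: "nat \<Rightarrow> nat"
  assumes c: "\<And>b. b \<in> {1..k} \<Longrightarrow> c b \<in> {1..n}"
begin

lemma B_W_S: "B * W c \<in> S"
  unfolding B_def using S_mult[OF S_mult[OF Z_S T_S] X_W_S[of c, OF c]] by (simp add: mult_ac)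

lemma B_V_S: "B * V c a \<in> S"
  unfolding B_def using S_mult[OF S_mult[OF Z_S T_S] X_V_S[of c, OF c]] by (simp add: mult_ac)

lemma B_W_div_z_S: "i \<in> {1..n} \<Longrightarrow> j \<in> {1..n} \<Longrightarrow> i \<noteq> j \<Longrightarrow> B * W c / (z i - z j) \<in> S"
  unfolding B_def using S_mult[OF S_mult[OF Z_div_S T_S] X_W_S[of c, OF c]] by (simp add: mult_ac)

lemma B_W_div_t_S: "a \<in> {1..k} \<Longrightarrow> b \<in> {1..k} \<Longrightarrow> B * W c / (t a - t b) \<in> S"
  unfolding B_def using S_mult[OF S_mult[OF Z_S T_div_S] X_W_S[of c, OF c]] by (simp add: mult_ac)

lemma B_V_div_t_S: "a \<in> {1..k} \<Longrightarrow> b \<in> {1..k} \<Longrightarrow> B * V c a / (t a - t b) \<in> S"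
  unfolding B_def using S_mult[OF S_mult[OF Z_S T_div_S] X_V_S[of c, OF c]] by (simp add: mult_ac)

lemma B_W_div_S: "a \<in> {1..k} \<Longrightarrow> j \<in> {1..n} \<Longrightarrow> c a \<noteq> j \<Longrightarrow> B * W c / (t a - z j) \<in> S"
  unfolding B_def using S_mult[OF S_mult[OF Z_S T_S] X_W_div_S[of c, OF c]] by (simp add: mult_ac)

lemma B_V_div_S: "a \<in> {1..k} \<Longrightarrow> j \<in> {1..n} \<Longrightarrow> B * V c a / (t a - z j) \<in> S"
  unfolding B_def using S_mult[OF S_mult[OF Z_S T_S] X_V_div_S[of c, OF c]] by (simp add: mult_ac)

end

lemma M2_congr:
  assumes "i \<in> {1..n}" "j \<in> {1..n}" "i \<noteq> j"
  shows "of_nat (if i < j then M2 i j else M2 j i) \<approx> of_nat (m i) * of_nat (m j) * h / 2"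
  using M2_cong[of i j] M2_cong[of j i] assms by (auto simp: congr_def mult_ac)

lemma M_congr: "l \<in> {1..n} \<Longrightarrow> of_nat (M l) \<approx> - (of_nat (m l) * h)"
  using M_cong by (simp add: congr_def)

lemma M0_congr: "of_nat M0 \<approx> 2 * h"
  using M0_cong by (simp add: congr_def)

end

section \<open>Action of e, f, h and Omega on vectors of sums over colorings\<close>

lemma act_e_f_commute:
  assumes "i \<noteq> j"
  shows "act m sl2_e i (act m sl2_f j u) J = act m sl2_f j (act m sl2_e i u) J"
  using assms by (simp add: act_e act_f fun_upd_twist)

lemma multi_indices_le: "J \<in> multi_indices n m k \<Longrightarrow> l \<in> {1..n} \<Longrightarrow> J l \<le> m l"
  by (auto simp: multi_indices_def)

lemma multi_indices_move:
  assumes J: "J \<in> multi_indices n m k" and ij: "i \<in> {1..n}" "j \<in> {1..n}" "i \<noteq> j"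
    and le: "J i < m i" "1 \<le> J j"
  shows "J(i := J i + 1, j := J j - 1) \<in> multi_indices n m k"
proof -
  have *: "(\<Sum>l=1..n. g l) = g i + (g j + (\<Sum>l\<in>{1..n} - {i} - {j}. g l))" for g :: "nat \<Rightarrow> nat"
    using ij by (simp add: sum.remove[of _ i] sum.remove[of _ j])
  have "(\<Sum>l=1..n. (J(i := J i + 1, j := J j - 1)) l) = (\<Sum>l=1..n. J l)"
    unfolding * using ij le by simp
  moreover have "J j - 1 \<le> m j" using multi_indices_le[OF J ij(2)] by simp
  ultimately show ?thesis using J ij le by (auto simp: multi_indices_def)
qed

context master_function
begin

text \<open>The coordinate of \<open>Psi\<close> after resummation of the weight function over
  colorings.\<close>

definition U :: "(nat \<Rightarrow> nat) \<Rightarrow> 'f" where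
  "U J = (if J \<in> multi_indices n m k then (\<Sum>c\<in>colorings k n J. E * (B * W c)) else 0)"

text \<open>The coordinate at \<open>J\<close> sees the value of \<open>U\<close> where one point
  has moved from color \<open>j\<close> to color \<open>i\<close>, and \<open>sum_recolor\<close>
  uses up the factor \<open>J i + 1\<close> of e. In the degenerate cases both sides vanish: either
  \<open>m i - J i\<close> is 0, or no point has color \<open>j\<close>.\<close>

lemma act_e_f_U:
  assumes J: "J \<in> multi_indices n m k" and ij: "i \<in> {1..n}" "j \<in> {1..n}" "i \<noteq> j"
  shows "act m sl2_e i (act m sl2_f j U) J = (of_nat (m i) - of_nat (J i)) *
    (\<Sum>c\<in>colorings k n J. \<Sum>a\<in>{a\<in>{1..k}. c a = j}. E * (B * W (c(a := i))))"
proof (cases "J i < m i \<and> 1 \<le> J j")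
  case True
  let ?J = "J(i := J i + 1, j := J j - 1)"
  have "act m sl2_e i (act m sl2_f j U) J =
      (of_nat (m i) - of_nat (J i)) * (of_nat (J i + 1) * U ?J)"
    using True ij multi_indices_le[OF J ij(2)] by (simp add: act_e act_f)
  also have "of_nat (J i + 1) * U ?J =
      (\<Sum>c\<in>colorings k n J. \<Sum>a\<in>{a\<in>{1..k}. c a = j}. E * (B * W (c(a := i))))"
    using multi_indices_move[OF J ij] True
    by (subst sum_recolor[OF ij, symmetric]) (simp_all add: U_def)
  finally show ?thesis .
next
  case False
  have "(\<Sum>c\<in>colorings k n J. \<Sum>a\<in>{a\<in>{1..k}. c a = j}. E * (B * W (c(a := i)))) = 0"
    if "J j = 0"
  proof (rule sum.neutral, rule ballI)
    fix c assume "c \<in> colorings k n J"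
    hence "card {a\<in>{1..k}. c a = j} = 0" using coloring_card[OF _ ij(2)] that by metis
    hence *: "{a\<in>{1..k}. c a = j} = {}" by simp
    show "(\<Sum>a\<in>{a\<in>{1..k}. c a = j}. E * (B * W (c(a := i)))) = 0"
      unfolding * by simp
  qed
  thus ?thesis
    using False ij multi_indices_le[OF J ij(1)] by (cases "J j = 0") (auto simp: act_e act_f)
qed

text \<open>For \<open>i = j\<close> the recoloring changes nothing and each coloring is counted
  \<open>J i\<close> times; e is then evaluated at \<open>J i - 1\<close>, which is the source of
  the extra 1. For distinct indices the two operators commute and \<open>act_e_f_U\<close>
  applies.\<close>

lemma act_f_e_U:
  assumes J: "J \<in> multi_indices n m k" and ij: "i \<in> {1..n}" "j \<in> {1..n}"
  shows "act m sl2_f i (act m sl2_e j U) J =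
    (of_nat (m j) - of_nat (J j) + (if i = j then 1 else 0)) *
    (\<Sum>c\<in>colorings k n J. \<Sum>a\<in>{a\<in>{1..k}. c a = i}. E * (B * W (c(a := j))))"
proof (cases "i = j")
  case True
  have "(\<Sum>c\<in>colorings k n J. \<Sum>a\<in>{a\<in>{1..k}. c a = i}. E * (B * W (c(a := i)))) =
    (\<Sum>c\<in>colorings k n J. \<Sum>a\<in>{a\<in>{1..k}. c a = i}. E * (B * W c))"
    by (intro sum.cong refl) (auto simp: fun_upd_idem)
  also have "\<dots> = of_nat (J i) * U J"
    using J ij(1) by (auto simp: U_def coloring_card[unfolded One_nat_def] sum_distrib_left
      simp del: atLeastAtMost_iff)
  moreover have "act m sl2_f i (act m sl2_e i U) J =
      (of_nat (m i) - of_nat (J i) + 1) * (of_nat (J i) * U J)"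
    using multi_indices_le[OF J ij(1)]
    by (cases "J i") (simp_all add: act_f act_e algebra_simps fun_upd_idem)
  ultimately show ?thesis using True by simp
next
  case False
  thus ?thesis
    using act_e_f_commute[of j i m U J] act_e_f_U[OF J ij(2,1)] by simp
qed

lemma act_h_U:
  assumes J: "J \<in> multi_indices n m k" and i: "i \<in> {1..n}"
  shows "act m sl2_h i U J =
    (\<Sum>c\<in>colorings k n J. E * (B * W c) * (of_nat (m i) - 2 * of_nat (J i)))"
  using J multi_indices_le[OF J i] by (simp add: act_h U_def sum_distrib_left mult.commute)

text \<open>Recoloring \<open>a\<close> from \<open>j\<close> to \<open>i\<close> multiplies
  \<open>W c\<close> by \<open>1 + (z i - z j) / (t a - z i)\<close>. The ones are counted by
  \<open>J\<close> and combine with the h-part: the sum of \<open>(m i - J i) * J j\<close>,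
  \<open>(m j - J j) * J i\<close> and \<open>(m i - 2 * J i) * (m j - 2 * J j) / 2\<close> is
  \<open>m i * m j / 2\<close>. Everything else carries the factor \<open>z i - z j\<close>, which
  the division removes.\<close>

lemma Omega_U:
  assumes J: "J \<in> multi_indices n m k" and ij: "i \<in> {1..n}" "j \<in> {1..n}" "i \<noteq> j"
  shows "Omega m i j U J / (z i - z j) = (\<Sum>c\<in>colorings k n J. E * (B * W c) *
    (of_nat (m i) * of_nat (m j) / 2 / (z i - z j)
     + (of_nat (m i) - of_nat (J i)) * (\<Sum>a\<in>{a\<in>{1..k}. c a = j}. 1 / (t a - z i))
     - (of_nat (m j) - of_nat (J j)) * (\<Sum>a\<in>{a\<in>{1..k}. c a = i}. 1 / (t a - z j))))"
proof -
  have zz: "z i - z j \<noteq> 0" using z_z[OF ij] by simp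
  have *: "(\<Sum>a\<in>{a\<in>{1..k}. c a = j'}. E * (B * W (c(a := i')))) =
    E * (B * W c) * (of_nat (J j') + (z i' - z j') * (\<Sum>a\<in>{a\<in>{1..k}. c a = j'}. 1 / (t a - z i')))"
    if c: "c \<in> colorings k n J" and ij': "i' \<in> {1..n}" "j' \<in> {1..n}" for c i' j'
  proof -
    have "(\<Sum>a\<in>{a\<in>{1..k}. c a = j'}. E * (B * W (c(a := i')))) =
      (\<Sum>a\<in>{a\<in>{1..k}. c a = j'}. E * (B * W c) * (1 + (z i' - z j') * (1 / (t a - z i'))))"
    proof (intro sum.cong refl)
      fix a assume a: "a \<in> {a\<in>{1..k}. c a = j'}"
      hence "t a - z i' \<noteq> 0" using t_z ij' by auto
      hence "(t a - z j') / (t a - z i') = 1 + (z i' - z j') * (1 / (t a - z i'))"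
        by (simp add: divide_simps)
      thus "E * (B * W (c(a := i'))) = E * (B * W c) * (1 + (z i' - z j') * (1 / (t a - z i')))"
        using W_upd[of a c i'] a ij' by (simp only: mem_Collect_eq) (simp only: mult.assoc)
    qed
    thus ?thesis using coloring_card[OF c ij'(2)]
      by (simp only: sum_distrib_left[symmetric] sum.distrib sum_constant) simp
  qed
  have "Omega m i j U J = (\<Sum>c\<in>colorings k n J.
      (of_nat (m i) - of_nat (J i)) * (E * (B * W c) * (of_nat (J j) + (z i - z j) * (\<Sum>a\<in>{a\<in>{1..k}. c a = j}. 1 / (t a - z i))))
    + (of_nat (m j) - of_nat (J j)) * (E * (B * W c) * (of_nat (J i) + (z j - z i) * (\<Sum>a\<in>{a\<in>{1..k}. c a = i}. 1 / (t a - z j))))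
    + 1 / 2 * (of_nat (m i) - 2 * of_nat (J i)) * (of_nat (m j) - 2 * of_nat (J j)) * (E * (B * W c)))"
  proof -
    have hh: "act m sl2_h i (act m sl2_h j U) J = (of_nat (m i) - 2 * of_nat (J i)) *
        ((of_nat (m j) - 2 * of_nat (J j)) * (\<Sum>c\<in>colorings k n J. E * (B * W c)))"
      using J ij multi_indices_le[OF J ij(1)] multi_indices_le[OF J ij(2)]
      by (simp add: act_h U_def)
    have **: "(\<Sum>c\<in>colorings k n J. \<Sum>a\<in>{a\<in>{1..k}. c a = j'}. E * (B * W (c(a := i')))) =
      (\<Sum>c\<in>colorings k n J. E * (B * W c) *
        (of_nat (J j') + (z i' - z j') * (\<Sum>a\<in>{a\<in>{1..k}. c a = j'}. 1 / (t a - z i'))))"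
      if "i' \<in> {1..n}" "j' \<in> {1..n}" for i' j'
      by (intro sum.cong refl * that)
    show ?thesis
      unfolding Omega_def act_e_f_U[OF J ij] act_f_e_U[OF J ij(1,2)] hh
        **[OF ij(1,2)] **[OF ij(2,1)] sum_distrib_left sum.distrib
      using ij(3) by (simp add: mult.assoc)
  qed
  also have "\<dots> = (\<Sum>c\<in>colorings k n J. (z i - z j) * (E * (B * W c) *
    (of_nat (m i) * of_nat (m j) / 2 / (z i - z j)
     + (of_nat (m i) - of_nat (J i)) * (\<Sum>a\<in>{a\<in>{1..k}. c a = j}. 1 / (t a - z i))
     - (of_nat (m j) - of_nat (J j)) * (\<Sum>a\<in>{a\<in>{1..k}. c a = i}. 1 / (t a - z j)))))"
    (is "_ = (\<Sum>c\<in>_. ?R c)")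
  proof (intro sum.cong refl)
    fix c
    define x where "x = (\<Sum>a\<in>{a\<in>{1..k}. c a = j}. 1 / (t a - z i))"
    define y where "y = (\<Sum>a\<in>{a\<in>{1..k}. c a = i}. 1 / (t a - z j))"
    define d where "d = z i - z j"
    have d: "z j - z i = - d" "d \<noteq> 0" using zz by (auto simp: d_def)
    show "(of_nat (m i) - of_nat (J i)) * (E * (B * W c) * (of_nat (J j) + (z i - z j) * (\<Sum>a\<in>{a\<in>{1..k}. c a = j}. 1 / (t a - z i))))
    + (of_nat (m j) - of_nat (J j)) * (E * (B * W c) * (of_nat (J i) + (z j - z i) * (\<Sum>a\<in>{a\<in>{1..k}. c a = i}. 1 / (t a - z j))))
    + 1 / 2 * (of_nat (m i) - 2 * of_nat (J i)) * (of_nat (m j) - 2 * of_nat (J j)) * (E * (B * W c)) = ?R c"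
      unfolding x_def[symmetric] y_def[symmetric] d(1) d_def[symmetric]
      using d(2) by (simp add: field_simps)
  qed
  finally show ?thesis using zz by (simp add: sum_distrib_left[symmetric])
qed

lemma has_logder_Z0:
  assumes D: "derivation D" and "\<And>l. l \<in> {1..n} \<Longrightarrow> D (z l) = 0"
  shows "has_logder D Zf 0"
proof -
  interpret derivation D by (rule D)
  have "has_logder D Zf (\<Sum>j=1..n. \<Sum>i=1..<j. of_nat (M2 i j) * (D (z i - z j) / (z i - z j)))"
    unfolding Zf_def by (intro has_logder_prod has_logder_power has_logder_base D) (use z_z in auto)
  also have "(\<Sum>j=1..n. \<Sum>i=1..<j. of_nat (M2 i j) * (D (z i - z j) / (z i - z j))) = 0"
    using assms by (intro sum.neutral ballI) (auto simp: diff)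
  finally show ?thesis .
qed

lemma has_logder_T0:
  assumes D: "derivation D" and "\<And>a. a \<in> {1..k} \<Longrightarrow> D (t a) = 0"
  shows "has_logder D Tf 0"
proof -
  interpret derivation D by (rule D)
  have "has_logder D Tf (\<Sum>j=1..k. \<Sum>i=1..<j. of_nat M0 * (D (t i - t j) / (t i - t j)))"
    unfolding Tf_def by (intro has_logder_prod has_logder_power has_logder_base D) (use t_t in auto)
  also have "(\<Sum>j=1..k. \<Sum>i=1..<j. of_nat M0 * (D (t i - t j) / (t i - t j))) = 0"
    using assms by (intro sum.neutral ballI) (auto simp: diff)
  finally show ?thesis .
qed

lemma has_logder_X:
  assumes D: "derivation D"
  shows "has_logder D Xf (\<Sum>l=1..n. \<Sum>a=1..k. of_nat (M l) * (D (t a - z l) / (t a - z l)))"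
  unfolding Xf_def by (intro has_logder_prod has_logder_power has_logder_base D) (use t_z in auto)

lemma has_logder_W:
  assumes D: "derivation D" and c: "\<And>b. b \<in> {1..k} \<Longrightarrow> c b \<in> {1..n}"
  shows "has_logder D (W c) (\<Sum>a=1..k. - (D (t a - z (c a)) / (t a - z (c a))))"
  unfolding W_def
  by (intro has_logder_prod has_logder_inverse has_logder_base D) (use c t_z in auto)

lemma has_logder_V:
  assumes D: "derivation D" and c: "\<And>b. b \<in> {1..k} \<Longrightarrow> c b \<in> {1..n}"
  shows "has_logder D (V c a) (\<Sum>b\<in>{1..k} - {a}. - (D (t b - z (c b)) / (t b - z (c b))))"
  unfolding V_def
  by (intro has_logder_prod has_logder_inverse has_logder_base D) (use c t_z in auto)

end

section \<open>Derivatives of the term of a single coloring, modulo \<open>q\<close>\<close>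

lemma sum_split_filter:
  assumes "finite A"
  shows "(\<Sum>a\<in>A. if P a then f a else g a) = (\<Sum>a\<in>{a\<in>A. P a}. f a) + (\<Sum>a\<in>{a\<in>A. \<not> P a}. g a)"
  using assms by (simp add: sum.If_cases Int_def Collect_neg_eq[symmetric] conj_commute)

context master_function
begin

lemma derivation_term:
  assumes D: "derivation D" and L: "has_logder D x L"
  shows "D (E * x) = x * D E + E * (x * L)"
proof -
  interpret derivation D by (rule D)
  show ?thesis using L by (simp add: has_logder_def mult mult_ac)
qed

text \<open>In the logarithmic derivative the exponents are replaced by their residues except at the
  points of color \<open>i\<close>. There \<open>W c\<close> has the pole already,
  \<open>B * W c / (t a - z i)\<close> need not lie in \<open>S\<close>, and \<open>1 - M i\<close>
  is kept exactly.\<close>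

lemma dz_term:
  assumes D: "derivation D" and Dt: "\<And>a. a \<in> {1..k} \<Longrightarrow> D (t a) = 0"
    and Dz: "\<And>l. l \<in> {1..n} \<Longrightarrow> D (z l) = (if l = i then 1 else 0)"
    and DE: "D E \<approx> pl * of_nat (m i) * h / 2 * E" and i: "i \<in> {1..n}"
    and c: "\<And>b. b \<in> {1..k} \<Longrightarrow> c b \<in> {1..n}"
  shows "D (E * (B * W c)) \<approx> E * (B * W c) * (pl * of_nat (m i) * h / 2
      + (\<Sum>j\<in>{1..n} - {i}. of_nat (m i) * of_nat (m j) * h / 2 / (z i - z j))
      + (\<Sum>a\<in>{a\<in>{1..k}. c a \<noteq> i}. of_nat (m i) * h / (t a - z i))
      + (\<Sum>a\<in>{a\<in>{1..k}. c a = i}. (1 - of_nat (M i)) / (t a - z i)))"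
proof -
  interpret derivation D by (rule D)
  let ?N = "\<lambda>j. of_nat (if i < j then M2 i j else M2 j i) :: 'f"
  have dtz: "D (t a - z l) = (if l = i then - 1 else 0)" if "a \<in> {1..k}" "l \<in> {1..n}" for a l
    using that by (simp add: diff Dt Dz)
  have Z: "has_logder D Zf (\<Sum>j\<in>{1..n} - {i}. ?N j / (z i - z j))"
    unfolding Zf_def by (rule has_logder_vandermonde[OF D z_z i Dz])
  have "(\<Sum>l=1..n. \<Sum>a=1..k. of_nat (M l) * (D (t a - z l) / (t a - z l))) =
      (\<Sum>l=1..n. if l = i then (\<Sum>a=1..k. - (of_nat (M i) / (t a - z i))) else 0)"
    by (intro sum.cong refl) (auto simp: dtz intro!: sum.cong sum.neutral)
  also have "\<dots> = (\<Sum>a=1..k. - (of_nat (M i) / (t a - z i)))" using i by simp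
  finally have X: "has_logder D Xf (\<Sum>a=1..k. - (of_nat (M i) / (t a - z i)))"
    using has_logder_X[OF D] by simp
  have "(\<Sum>a=1..k. - (D (t a - z (c a)) / (t a - z (c a)))) =
      (\<Sum>a=1..k. if c a = i then 1 / (t a - z i) else 0)"
    using c by (intro sum.cong refl) (auto simp: dtz)
  hence W: "has_logder D (W c) (\<Sum>a=1..k. if c a = i then 1 / (t a - z i) else 0)"
    using has_logder_W[OF D, of c, OF c] by simp
  have "(\<Sum>a=1..k. - (of_nat (M i) / (t a - z i))) + (\<Sum>a=1..k. if c a = i then 1 / (t a - z i) else 0) =
    (\<Sum>a=1..k. if c a = i then (1 - of_nat (M i)) / (t a - z i) else - (of_nat (M i) / (t a - z i)))"
    unfolding sum.distrib[symmetric] by (intro sum.cong refl) (simp add: diff_divide_distrib)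
  hence eq: "(\<Sum>a=1..k. - (of_nat (M i) / (t a - z i))) + (\<Sum>a=1..k. if c a = i then 1 / (t a - z i) else 0) =
      (\<Sum>a\<in>{a\<in>{1..k}. c a \<noteq> i}. - of_nat (M i) / (t a - z i))
      + (\<Sum>a\<in>{a\<in>{1..k}. c a = i}. (1 - of_nat (M i)) / (t a - z i))"
    by (simp add: sum_split_filter add.commute)
  have L: "has_logder D (B * W c) ((\<Sum>j\<in>{1..n} - {i}. ?N j / (z i - z j))
      + (\<Sum>a\<in>{a\<in>{1..k}. c a \<noteq> i}. - of_nat (M i) / (t a - z i))
      + (\<Sum>a\<in>{a\<in>{1..k}. c a = i}. (1 - of_nat (M i)) / (t a - z i)))"
    using has_logder_mult[OF D has_logder_mult[OF D has_logder_mult[OF D Z has_logder_T0[OF D Dt]] X] W]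
    by (simp only: B_def add_0_right add.assoc eq)
  have BS: "B * W c \<in> S" by (rule B_W_S) (rule c)
  have "D (E * (B * W c)) = B * W c * D E + E * (
      (\<Sum>j\<in>{1..n} - {i}. B * W c * (?N j / (z i - z j)))
      + (\<Sum>a\<in>{a\<in>{1..k}. c a \<noteq> i}. B * W c * (- of_nat (M i) / (t a - z i)))
      + (\<Sum>a\<in>{a\<in>{1..k}. c a = i}. B * W c * ((1 - of_nat (M i)) / (t a - z i))))"
    unfolding derivation_term[OF D L] by (simp only: distrib_left sum_distrib_left)
  also have "\<dots> \<approx> B * W c * (pl * of_nat (m i) * h / 2 * E) + E * (
      (\<Sum>j\<in>{1..n} - {i}. B * W c * (of_nat (m i) * of_nat (m j) * h / 2 / (z i - z j)))
      + (\<Sum>a\<in>{a\<in>{1..k}. c a \<noteq> i}. B * W c * (of_nat (m i) * h / (t a - z i)))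
      + (\<Sum>a\<in>{a\<in>{1..k}. c a = i}. B * W c * ((1 - of_nat (M i)) / (t a - z i))))"
  proof (rule congr_add[OF congr_mult[OF BS DE] congr_mult[OF E_S]], intro congr_add congr_sum congr_refl)
    fix j assume "j \<in> {1..n} - {i}"
    thus "B * W c * (?N j / (z i - z j)) \<approx> B * W c * (of_nat (m i) * of_nat (m j) * h / 2 / (z i - z j))"
      using i by (intro congr_div B_W_div_z_S[of c, OF c] M2_congr) auto
  next
    fix a assume "a \<in> {a\<in>{1..k}. c a \<noteq> i}"
    thus "B * W c * (- of_nat (M i) / (t a - z i)) \<approx> B * W c * (of_nat (m i) * h / (t a - z i))"
      using i congr_minus[OF M_congr[OF i]] by (intro congr_div B_W_div_S[of c, OF c]) auto
  qed
  also have "\<dots> = E * (B * W c) * (pl * of_nat (m i) * h / 2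
      + (\<Sum>j\<in>{1..n} - {i}. of_nat (m i) * of_nat (m j) * h / 2 / (z i - z j))
      + (\<Sum>a\<in>{a\<in>{1..k}. c a \<noteq> i}. of_nat (m i) * h / (t a - z i))
      + (\<Sum>a\<in>{a\<in>{1..k}. c a = i}. (1 - of_nat (M i)) / (t a - z i)))"
    unfolding sum_distrib_left[symmetric] by (simp only: distrib_left mult_ac add_ac)
  finally show ?thesis .
qed

lemma has_logder_T_dt:
  assumes D: "derivation D" and a: "a \<in> {1..k}"
    and Dt: "\<And>b. b \<in> {1..k} \<Longrightarrow> D (t b) = (if b = a then 1 else 0)"
  shows "has_logder D Tf (\<Sum>b\<in>{1..k} - {a}. of_nat M0 / (t a - t b))"
  using has_logder_vandermonde[OF D t_t a Dt, of "\<lambda>_ _. M0"] by (simp add: Tf_def)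

lemma has_logder_X_dt:
  assumes D: "derivation D" and a: "a \<in> {1..k}"
    and Dt: "\<And>b. b \<in> {1..k} \<Longrightarrow> D (t b) = (if b = a then 1 else 0)"
    and Dz: "\<And>l. l \<in> {1..n} \<Longrightarrow> D (z l) = 0"
  shows "has_logder D Xf (\<Sum>l=1..n. of_nat (M l) / (t a - z l))"
proof -
  interpret derivation D by (rule D)
  have "(\<Sum>b=1..k. of_nat (M l) * (D (t b - z l) / (t b - z l))) = of_nat (M l) / (t a - z l)"
    if l: "l \<in> {1..n}" for l
  proof -
    have "(\<Sum>b=1..k. of_nat (M l) * (D (t b - z l) / (t b - z l))) =
      (\<Sum>b=1..k. if b = a then of_nat (M l) / (t a - z l) else 0)"
      by (intro sum.cong refl) (use l in \<open>auto simp: diff Dt Dz\<close>)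
    thus ?thesis using a by simp
  qed
  thus ?thesis using has_logder_X[OF D] by simp
qed

text \<open>As in \<open>dz_term\<close>, the exponent at the pole \<open>z (c a)\<close> is kept
  exactly. Its coefficient \<open>M (c a) - 1\<close> is the opposite of the one found there, so the
  two cancel without any congruence.\<close>

lemma dt_W_term:
  assumes D: "derivation D" and a: "a \<in> {1..k}"
    and Dt: "\<And>b. b \<in> {1..k} \<Longrightarrow> D (t b) = (if b = a then 1 else 0)"
    and Dz: "\<And>l. l \<in> {1..n} \<Longrightarrow> D (z l) = 0"
    and DE: "D E \<approx> - (pl * h) * E"
    and c: "\<And>b. b \<in> {1..k} \<Longrightarrow> c b \<in> {1..n}"
  shows "D (E * (B * W c)) \<approx> E * (B * W c) * (- (pl * h)
      + (\<Sum>b\<in>{1..k} - {a}. 2 * h / (t a - t b))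
      + (\<Sum>l\<in>{1..n} - {c a}. - (of_nat (m l) * h) / (t a - z l))
      + (of_nat (M (c a)) - 1) / (t a - z (c a)))"
proof -
  interpret derivation D by (rule D)
  have ca: "c a \<in> {1..n}" using c a by blast
  have "(\<Sum>b=1..k. - (D (t b - z (c b)) / (t b - z (c b)))) =
      (\<Sum>b=1..k. if b = a then - 1 / (t a - z (c a)) else 0)"
    using c by (intro sum.cong refl) (auto simp: diff Dt Dz)
  hence W: "has_logder D (W c) (- 1 / (t a - z (c a)))"
    using has_logder_W[OF D, of c, OF c] a by simp
  have "(\<Sum>l=1..n. of_nat (M l) / (t a - z l)) + - 1 / (t a - z (c a)) =
    (\<Sum>l\<in>{1..n} - {c a}. of_nat (M l) / (t a - z l)) + (of_nat (M (c a)) - 1) / (t a - z (c a))"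
    using ca by (simp add: sum.remove[of _ "c a"] diff_divide_distrib)
  hence L: "has_logder D (B * W c) ((\<Sum>b\<in>{1..k} - {a}. of_nat M0 / (t a - t b))
      + (\<Sum>l\<in>{1..n} - {c a}. of_nat (M l) / (t a - z l)) + (of_nat (M (c a)) - 1) / (t a - z (c a)))"
    using has_logder_mult[OF D has_logder_mult[OF D has_logder_mult[OF D has_logder_Z0[OF D Dz]
        has_logder_T_dt[OF D a Dt]] has_logder_X_dt[OF D a Dt Dz]] W]
    by (simp only: B_def add.assoc add_0_left)
  have BS: "B * W c \<in> S" by (rule B_W_S) (rule c)
  have "D (E * (B * W c)) = B * W c * D E + E * (
      (\<Sum>b\<in>{1..k} - {a}. B * W c * (of_nat M0 / (t a - t b)))
      + (\<Sum>l\<in>{1..n} - {c a}. B * W c * (of_nat (M l) / (t a - z l)))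
      + B * W c * ((of_nat (M (c a)) - 1) / (t a - z (c a))))"
    unfolding derivation_term[OF D L] by (simp only: distrib_left sum_distrib_left)
  also have "\<dots> \<approx> B * W c * (- (pl * h) * E) + E * (
      (\<Sum>b\<in>{1..k} - {a}. B * W c * (2 * h / (t a - t b)))
      + (\<Sum>l\<in>{1..n} - {c a}. B * W c * (- (of_nat (m l) * h) / (t a - z l)))
      + B * W c * ((of_nat (M (c a)) - 1) / (t a - z (c a))))"
  proof (rule congr_add[OF congr_mult[OF BS DE] congr_mult[OF E_S]], intro congr_add congr_sum congr_refl)
    fix b assume "b \<in> {1..k} - {a}"
    thus "B * W c * (of_nat M0 / (t a - t b)) \<approx> B * W c * (2 * h / (t a - t b))"
      using a by (intro congr_div B_W_div_t_S[of c, OF c] M0_congr) auto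
  next
    fix l assume "l \<in> {1..n} - {c a}"
    thus "B * W c * (of_nat (M l) / (t a - z l)) \<approx> B * W c * (- (of_nat (m l) * h) / (t a - z l))"
      using a by (intro congr_div B_W_div_S[of c, OF c] M_congr) auto
  qed
  also have "\<dots> = E * (B * W c) * (- (pl * h)
      + (\<Sum>b\<in>{1..k} - {a}. 2 * h / (t a - t b))
      + (\<Sum>l\<in>{1..n} - {c a}. - (of_nat (m l) * h) / (t a - z l))
      + (of_nat (M (c a)) - 1) / (t a - z (c a)))"
    unfolding sum_distrib_left[symmetric] by (simp only: distrib_left mult_ac add_ac)
  finally show ?thesis .
qed

text \<open>Without the factor of \<open>a\<close>, every pole in \<open>t a\<close> is simple, so
  all exponents may be replaced by their residues.\<close>

lemma dt_V_term:
  assumes D: "derivation D" and a: "a \<in> {1..k}"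
    and Dt: "\<And>b. b \<in> {1..k} \<Longrightarrow> D (t b) = (if b = a then 1 else 0)"
    and Dz: "\<And>l. l \<in> {1..n} \<Longrightarrow> D (z l) = 0"
    and DE: "D E \<approx> - (pl * h) * E"
    and c: "\<And>b. b \<in> {1..k} \<Longrightarrow> c b \<in> {1..n}"
  shows "D (E * (B * V c a)) \<approx> E * (B * V c a) * (- (pl * h)
      + (\<Sum>b\<in>{1..k} - {a}. 2 * h / (t a - t b))
      + (\<Sum>l=1..n. - (of_nat (m l) * h) / (t a - z l)))"
proof -
  interpret derivation D by (rule D)
  have "(\<Sum>b\<in>{1..k} - {a}. - (D (t b - z (c b)) / (t b - z (c b)))) = 0"
    using c by (intro sum.neutral) (auto simp: diff Dt Dz)
  hence V: "has_logder D (V c a) 0"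
    using has_logder_V[OF D, of c a, OF c] a by simp
  have L: "has_logder D (B * V c a) ((\<Sum>b\<in>{1..k} - {a}. of_nat M0 / (t a - t b))
      + (\<Sum>l=1..n. of_nat (M l) / (t a - z l)))"
    using has_logder_mult[OF D has_logder_mult[OF D has_logder_mult[OF D has_logder_Z0[OF D Dz]
        has_logder_T_dt[OF D a Dt]] has_logder_X_dt[OF D a Dt Dz]] V]
    by (simp only: B_def add.assoc add_0_left add_0_right)
  have BS: "B * V c a \<in> S" by (rule B_V_S) (rule c)
  have "D (E * (B * V c a)) = B * V c a * D E + E * (
      (\<Sum>b\<in>{1..k} - {a}. B * V c a * (of_nat M0 / (t a - t b)))
      + (\<Sum>l=1..n. B * V c a * (of_nat (M l) / (t a - z l))))"
    unfolding derivation_term[OF D L] by (simp only: distrib_left sum_distrib_left)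
  also have "\<dots> \<approx> B * V c a * (- (pl * h) * E) + E * (
      (\<Sum>b\<in>{1..k} - {a}. B * V c a * (2 * h / (t a - t b)))
      + (\<Sum>l=1..n. B * V c a * (- (of_nat (m l) * h) / (t a - z l))))"
  proof (rule congr_add[OF congr_mult[OF BS DE] congr_mult[OF E_S]], intro congr_add congr_sum)
    fix b assume "b \<in> {1..k} - {a}"
    thus "B * V c a * (of_nat M0 / (t a - t b)) \<approx> B * V c a * (2 * h / (t a - t b))"
      using a by (intro congr_div B_V_div_t_S[of c, OF c] M0_congr) auto
  next
    fix l assume "l \<in> {1..n}"
    thus "B * V c a * (of_nat (M l) / (t a - z l)) \<approx> B * V c a * (- (of_nat (m l) * h) / (t a - z l))"
      using a by (intro congr_div B_V_div_S[of c, OF c] M_congr) auto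
  qed
  also have "\<dots> = E * (B * V c a) * (- (pl * h)
      + (\<Sum>b\<in>{1..k} - {a}. 2 * h / (t a - t b))
      + (\<Sum>l=1..n. - (of_nat (m l) * h) / (t a - z l)))"
    unfolding sum_distrib_left[symmetric] by (simp only: distrib_left mult_ac add_ac)
  finally show ?thesis .
qed

end

section \<open>Cancellation between colorings and the two congruences\<close>

lemma times_divide_flip:
  fixes R :: "'a :: field"
  assumes "x / p = - (y / q)"
  shows "R / p * x = - (R / q * y)"
proof -
  have "R / p * x = R * (x / p)" by simp
  also have "\<dots> = - (R / q * y)" unfolding assms by simp
  finally show ?thesis .
qed

context master_function
begin

text \<open>\<open>R\<close> collects the factors of the points other than \<open>a\<close> and
  \<open>b\<close>, on which the two colorings agree.\<close>

lemma W_exchange: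
  assumes c: "\<And>b. b \<in> {1..k} \<Longrightarrow> c b \<in> {1..n}" and ab: "a \<in> {1..k}" "b \<in> {1..k}" "a \<noteq> b"
  obtains R where "W c = R / ((t a - z (c a)) * (t b - z (c b)))"
    "W (c \<circ> transpose a b) = R / ((t a - z (c b)) * (t b - z (c a)))"
    "V c a = R / (t b - z (c b))" "V (c \<circ> transpose a b) b = R / (t a - z (c b))"
proof
  let ?R = "\<lambda>c. \<Prod>d\<in>{1..k} - {a} - {b}. 1 / (t d - z (c d))"
  have V1: "V c a = ?R c / (t b - z (c b))" for c
    unfolding V_def using ab by (subst prod.remove[of _ b]) auto
  have V2: "V c b = ?R c / (t a - z (c a))" for c
    unfolding V_def using ab by (subst prod.remove[of _ a]) (auto simp: insert_commute Diff_insert2[symmetric] Diff_insert[symmetric])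
  have R: "?R (c \<circ> transpose a b) = ?R c"
    by (intro prod.cong) auto
  show "V c a = ?R c / (t b - z (c b))" by (rule V1)
  show "V (c \<circ> transpose a b) b = ?R c / (t a - z (c b))"
    using V2[of "c \<circ> transpose a b"] R by simp
  show "W c = ?R c / ((t a - z (c a)) * (t b - z (c b)))"
    using W_V[OF ab(1), of c] V1[of c] by (simp add: mult.commute)
  show "W (c \<circ> transpose a b) = ?R c / ((t a - z (c b)) * (t b - z (c a)))"
    using W_V[OF ab(1), of "c \<circ> transpose a b"] V1[of "c \<circ> transpose a b"] R by (simp add: mult.commute)
qed

text \<open>Let \<open>u = t a\<close>, \<open>v = t b\<close> be the marked points and
  \<open>w = z (c a)\<close>, \<open>x = z (c b)\<close> their poles. By partial fractions the
  summand is \<open>R / (u - v)\<close> times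
  \<open>1 / ((u - w) * (u - x)) + 1 / ((v - w) * (v - x))\<close>, with \<open>R\<close> from
  \<open>W_exchange\<close>. Exchanging the colors and the marks amounts to exchanging
  \<open>u\<close> and \<open>v\<close>, which changes only the sign.\<close>

lemma kz_leftover:
  assumes i: "i \<in> {1..n}"
  shows "(\<Sum>c\<in>colorings k n J. W c * (\<Sum>a\<in>{a\<in>{1..k}. c a = i}. \<Sum>b\<in>{b\<in>{1..k}. c b \<noteq> i}.
     2 / (t a - t b) - 1 / (t a - z (c b)) + 1 / (t b - z i))) = 0"
proof -
  let ?P = "\<lambda>x y. x = i \<and> y \<noteq> i"
  let ?G = "\<lambda>c a b. W c * (2 / (t a - t b) - 1 / (t a - z (c b)) + 1 / (t b - z (c a)))"
  have "(\<Sum>c\<in>colorings k n J. W c * (\<Sum>a\<in>{a\<in>{1..k}. c a = i}. \<Sum>b\<in>{b\<in>{1..k}. c b \<noteq> i}.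
     2 / (t a - t b) - 1 / (t a - z (c b)) + 1 / (t b - z i))) =
    (\<Sum>c\<in>colorings k n J. \<Sum>(a, b)\<in>{(a, b). a \<in> {1..k} \<and> b \<in> {1..k} \<and> ?P (c a) (c b)}. ?G c a b)"
  proof (intro sum.cong refl)
    fix c
    have "{(a, b). a \<in> {1..k} \<and> b \<in> {1..k} \<and> ?P (c a) (c b)} =
      {a\<in>{1..k}. c a = i} \<times> {b\<in>{1..k}. c b \<noteq> i}" by auto
    thus "W c * (\<Sum>a\<in>{a\<in>{1..k}. c a = i}. \<Sum>b\<in>{b\<in>{1..k}. c b \<noteq> i}.
        2 / (t a - t b) - 1 / (t a - z (c b)) + 1 / (t b - z i)) =
      (\<Sum>(a, b)\<in>{(a, b). a \<in> {1..k} \<and> b \<in> {1..k} \<and> ?P (c a) (c b)}. ?G c a b)"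
      by (simp only: sum.cartesian_product[symmetric] sum_distrib_left)
        (auto intro!: sum.cong)
  qed
  also have "\<dots> = 0"
  proof (rule sum_colorings_exchange)
    fix c a b assume c: "c \<in> colorings k n J" and ab: "a \<in> {1..k}" "b \<in> {1..k}" and P: "?P (c a) (c b)"
    have cr: "\<And>d. d \<in> {1..k} \<Longrightarrow> c d \<in> {1..n}" using coloring_range[OF c] .
    have ne: "a \<noteq> b" using P by auto
    obtain R where R: "W c = R / ((t a - z (c a)) * (t b - z (c b)))"
      "W (c \<circ> transpose a b) = R / ((t a - z (c b)) * (t b - z (c a)))"
      by (rule W_exchange[OF _ ab ne, of c]) (use cr in blast, blast)
    define u v w x where "u = t a" "v = t b" "w = z (c a)" "x = z (c b)"
    have nz: "u \<noteq> v" "u \<noteq> w" "u \<noteq> x" "v \<noteq> w" "v \<noteq> x"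
      using t_t[OF ab ne] t_z[OF ab(1) cr[OF ab(1)]] t_z[OF ab(1) cr[OF ab(2)]]
        t_z[OF ab(2) cr[OF ab(1)]] t_z[OF ab(2) cr[OF ab(2)]] by (auto simp: u_v_w_x_def)
    have "2 / (v - u) - 1 / (v - x) + 1 / (u - w) =
        ((u - x) * (v - w)) * (- ((2 / (u - v) - 1 / (u - x) + 1 / (v - w)) / ((u - w) * (v - x))))"
      using nz by (simp add: divide_simps) (simp add: algebra_simps)
    moreover have "(u - x) * (v - w) \<noteq> 0" using nz by simp
    ultimately have "(2 / (v - u) - 1 / (v - x) + 1 / (u - w)) / ((u - x) * (v - w)) =
        - ((2 / (u - v) - 1 / (u - x) + 1 / (v - w)) / ((u - w) * (v - x)))"
      by (simp add: divide_eq_eq mult.commute)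
    hence "R / ((u - x) * (v - w)) * (2 / (v - u) - 1 / (v - x) + 1 / (u - w)) =
        - (R / ((u - w) * (v - x)) * (2 / (u - v) - 1 / (u - x) + 1 / (v - w)))"
      by (rule times_divide_flip)
    thus "?G (c \<circ> transpose a b) b a = - ?G c a b"
      unfolding R by (simp add: u_v_w_x_def)
  qed
  finally show ?thesis .
qed

text \<open>With \<open>u = t a\<close>, \<open>v = t b\<close>, \<open>x = z (c b)\<close> and
  \<open>R\<close> from \<open>W_exchange\<close>, the summand is
  \<open>R * (2 * x - u - v) / ((u - x) * (v - x) * (u - v))\<close>. It changes sign when
  \<open>u\<close> and \<open>v\<close> are exchanged, which is the effect of exchanging colors and
  marks.\<close>

lemma dynamical_leftover:
  "(\<Sum>c\<in>colorings k n J. \<Sum>a=1..k. \<Sum>b\<in>{1..k} - {a}.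
     V c a * (1 / (t a - z (c b)) - 2 / (t a - t b))) = 0"
proof -
  \<comment> \<open>The exchange lemma is applied to all ordered pairs of points, so the diagonal is
    filled in with 0.\<close>
  let ?G = "\<lambda>c a b. if a = b then 0 else V c a * (1 / (t a - z (c b)) - 2 / (t a - t b))"
  have "(\<Sum>c\<in>colorings k n J. \<Sum>a=1..k. \<Sum>b\<in>{1..k} - {a}.
      V c a * (1 / (t a - z (c b)) - 2 / (t a - t b))) =
    (\<Sum>c\<in>colorings k n J. \<Sum>(a, b)\<in>{(a, b). a \<in> {1..k} \<and> b \<in> {1..k} \<and> True}. ?G c a b)"
  proof (intro sum.cong refl)
    fix c
    have "(\<Sum>b\<in>{1..k} - {a}. V c a * (1 / (t a - z (c b)) - 2 / (t a - t b))) = (\<Sum>b=1..k. ?G c a b)" for a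
      by (rule sum.mono_neutral_cong_left) auto
    moreover have "{(a, b). a \<in> {1..k} \<and> b \<in> {1..k} \<and> True} = {1..k} \<times> {1..k}" by auto
    ultimately show "(\<Sum>a=1..k. \<Sum>b\<in>{1..k} - {a}.
      V c a * (1 / (t a - z (c b)) - 2 / (t a - t b))) =
      (\<Sum>(a, b)\<in>{(a, b). a \<in> {1..k} \<and> b \<in> {1..k} \<and> True}. ?G c a b)"
      by (simp only: sum.cartesian_product)
  qed
  also have "\<dots> = 0"
  proof (rule sum_colorings_exchange)
    fix c a b assume c: "c \<in> colorings k n J" and ab: "a \<in> {1..k}" "b \<in> {1..k}"
    have cr: "\<And>d. d \<in> {1..k} \<Longrightarrow> c d \<in> {1..n}" using coloring_range[OF c] .
    show "?G (c \<circ> transpose a b) b a = - ?G c a b"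
    proof (cases "a = b")
      case False
      obtain R where R: "V c a = R / (t b - z (c b))" "V (c \<circ> transpose a b) b = R / (t a - z (c b))"
        by (rule W_exchange[OF _ ab False, of c]) (use cr in blast, blast)
      define u v x where "u = t a" "v = t b" "x = z (c b)"
      have nz: "u \<noteq> v" "u \<noteq> x" "v \<noteq> x"
        using t_t[OF ab False] t_z[OF ab(1) cr[OF ab(2)]] t_z[OF ab(2) cr[OF ab(2)]]
        by (auto simp: u_v_x_def)
      have "R / (u - x) * (1 / (v - x) - 2 / (v - u)) = - (R / (v - x) * (1 / (u - x) - 2 / (u - v)))"
        using nz by (simp add: divide_simps) (simp add: algebra_simps)
      thus ?thesis using False unfolding R by (simp add: u_v_x_def)
    qed simp
  qed
  finally show ?thesis .
qed

text \<open>For one coloring, with \<open>J i\<close> points of color \<open>i\<close>, the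
  multiples of \<open>pl\<close>, the poles in \<open>z i - z j\<close>, the exact exponents
  \<open>M i\<close> and all terms with a factor \<open>m l\<close> cancel. Pairs of points both of
  color \<open>i\<close> cancel by antisymmetry of \<open>2 / (t a - t b)\<close>. The remaining
  terms with \<open>J l\<close> are rewritten as sums over the points \<open>b\<close> of color
  \<open>l\<close>, so that only pairs of different colors are left.\<close>

lemma kz_coloring:
  assumes c: "c \<in> colorings k n J" and i: "i \<in> {1..n}"
  shows "(pl * of_nat (m i) * h / 2
      + (\<Sum>j\<in>{1..n} - {i}. of_nat (m i) * of_nat (m j) * h / 2 / (z i - z j))
      + (\<Sum>a\<in>{a\<in>{1..k}. c a \<noteq> i}. of_nat (m i) * h / (t a - z i))
      + (\<Sum>a\<in>{a\<in>{1..k}. c a = i}. (1 - of_nat (M i)) / (t a - z i)))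
    - h * (pl / 2 * (of_nat (m i) - 2 * of_nat (J i)) + (\<Sum>j\<in>{1..n} - {i}.
      of_nat (m i) * of_nat (m j) / 2 / (z i - z j)
     + (of_nat (m i) - of_nat (J i)) * (\<Sum>a\<in>{a\<in>{1..k}. c a = j}. 1 / (t a - z i))
     - (of_nat (m j) - of_nat (J j)) * (\<Sum>a\<in>{a\<in>{1..k}. c a = i}. 1 / (t a - z j))))
    + (\<Sum>a\<in>{a\<in>{1..k}. c a = i}. - (pl * h)
      + (\<Sum>b\<in>{1..k} - {a}. 2 * h / (t a - t b))
      + (\<Sum>l\<in>{1..n} - {i}. - (of_nat (m l) * h) / (t a - z l))
      + (of_nat (M i) - 1) / (t a - z i))
   = h * (\<Sum>a\<in>{a\<in>{1..k}. c a = i}. \<Sum>b\<in>{b\<in>{1..k}. c b \<noteq> i}.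
     2 / (t a - t b) - 1 / (t a - z (c b)) + 1 / (t b - z i))"
proof -
  define A C I where AC: "A = {a\<in>{1..k}. c a = i}" "C = {b\<in>{1..k}. c b \<noteq> i}" "I = {1..n} - {i}"
  have fin: "finite A" "finite C" "finite I" by (auto simp: AC)
  have cA: "card A = J i" unfolding AC by (rule coloring_card[OF c i])
  define P where "P = (\<Sum>j\<in>I. of_nat (m i) * of_nat (m j) / 2 / (z i - z j))"
  define Q where "Q = (\<Sum>a\<in>C. 1 / (t a - z i))"
  define R where "R = (\<Sum>a\<in>A. 1 / (t a - z i))"
  define T where "T = (\<Sum>a\<in>A. \<Sum>l\<in>I. of_nat (m l) * (1 / (t a - z l)))"
  define K where "K = (\<Sum>a\<in>A. \<Sum>l\<in>I. of_nat (J l) * (1 / (t a - z l)))"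
  define Y where "Y = (\<Sum>a\<in>A. \<Sum>b\<in>C. 2 / (t a - t b))"
  have CI: "C = (\<Union>j\<in>I. {a\<in>{1..k}. c a = j})"
    using coloring_range[OF c] by (auto simp: AC)
  have by_color: "(\<Sum>b\<in>C. g b) = (\<Sum>j\<in>I. \<Sum>a\<in>{a\<in>{1..k}. c a = j}. g a)" for g :: "nat \<Rightarrow> 'f"
    unfolding CI using fin by (intro sum.UNION_disjoint) auto
  have e1: "(\<Sum>j\<in>I. of_nat (m i) * of_nat (m j) * h / 2 / (z i - z j)) = h * P"
    unfolding P_def sum_distrib_left by (intro sum.cong) auto
  have e2: "(\<Sum>a\<in>C. of_nat (m i) * h / (t a - z i)) = of_nat (m i) * h * Q"
    unfolding Q_def sum_distrib_left by (intro sum.cong) auto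
  have e3: "(\<Sum>a\<in>A. (1 - of_nat (M i)) / (t a - z i)) = (1 - of_nat (M i)) * R"
    unfolding R_def sum_distrib_left by (intro sum.cong) auto
  have e4: "(\<Sum>j\<in>I. of_nat (m i) * of_nat (m j) / 2 / (z i - z j)
     + (of_nat (m i) - of_nat (J i)) * (\<Sum>a\<in>{a\<in>{1..k}. c a = j}. 1 / (t a - z i))
     - (of_nat (m j) - of_nat (J j)) * (\<Sum>a\<in>A. 1 / (t a - z j))) =
     P + (of_nat (m i) - of_nat (J i)) * Q - (T - K)"
  proof -
    have "T - K = (\<Sum>l\<in>I. (of_nat (m l) - of_nat (J l)) * (\<Sum>a\<in>A. 1 / (t a - z l)))"
      unfolding T_def K_def
      by (subst (1 2) sum.swap) (simp only: sum_distrib_left[symmetric] sum_subtractf[symmetric] left_diff_distrib)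
    thus ?thesis unfolding P_def Q_def by_color
      by (simp only: sum_distrib_left sum.distrib sum_subtractf)
  qed
  have inner: "(\<Sum>b\<in>{1..k} - {a}. 2 * h / (t a - t b)) =
      h * (\<Sum>b\<in>A. 2 / (t a - t b)) + h * (\<Sum>b\<in>C. 2 / (t a - t b))" if "a \<in> A" for a
  proof -
    \<comment> \<open>The term \<open>b = a\<close> may be put back, since it is a division by 0 and
      hence 0.\<close>
    have "(\<Sum>b\<in>{1..k} - {a}. 2 * h / (t a - t b)) = (\<Sum>b\<in>{1..k}. 2 * h / (t a - t b))"
      by (rule sum.mono_neutral_left) auto
    also have "\<dots> = (\<Sum>b\<in>A \<union> C. 2 * h / (t a - t b))"
      by (intro sum.cong) (auto simp: AC)
    also have "\<dots> = (\<Sum>b\<in>A. 2 * h / (t a - t b)) + (\<Sum>b\<in>C. 2 * h / (t a - t b))"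
      using fin by (intro sum.union_disjoint) (auto simp: AC)
    finally show ?thesis by (simp add: sum_distrib_left mult.commute)
  qed
  have "(\<Sum>a\<in>A. \<Sum>b\<in>A. 2 / (t a - t b)) = 0"
    by (rule sum_antisymmetric) (metis minus_diff_eq minus_divide_right)
  hence e5: "(\<Sum>a\<in>A. \<Sum>b\<in>{1..k} - {a}. 2 * h / (t a - t b)) = h * Y"
    by (simp only: inner sum.cong[OF refl inner] sum.distrib sum_distrib_left[symmetric] Y_def) simp
  have e6: "(\<Sum>a\<in>A. \<Sum>l\<in>I. - (of_nat (m l) * h) / (t a - z l)) = - (h * T)"
    by (simp add: T_def sum_distrib_left sum_negf mult_ac)
  have e7: "(\<Sum>a\<in>A. (of_nat (M i) - 1) / (t a - z i)) = (of_nat (M i) - 1) * R"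
    unfolding R_def sum_distrib_left by (intro sum.cong) auto
  have e8: "(\<Sum>a\<in>A. \<Sum>b\<in>C. 2 / (t a - t b) - 1 / (t a - z (c b)) + 1 / (t b - z i)) =
    Y - K + of_nat (J i) * Q"
  proof -
    have "(\<Sum>b\<in>C. 1 / (t a - z (c b))) = (\<Sum>l\<in>I. of_nat (J l) * (1 / (t a - z l)))" for a
      unfolding by_color using coloring_card[OF c] by (intro sum.cong refl) (auto simp: AC)
    hence "K = (\<Sum>a\<in>A. \<Sum>b\<in>C. 1 / (t a - z (c b)))" by (simp add: K_def)
    moreover have "of_nat (J i) * Q = (\<Sum>a\<in>A. \<Sum>b\<in>C. 1 / (t b - z i))"
      by (simp add: Q_def cA)
    ultimately show ?thesis unfolding Y_def by (simp only: sum.distrib sum_subtractf)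
  qed
  show ?thesis
    unfolding AC[symmetric] e8 e1 e2 e3 e4 unfolding sum.distrib e5 e6 e7
    by (simp add: cA field_simps)
qed

text \<open>\<open>D\<close> is the derivative in \<open>z i\<close>, \<open>D' a\<close> the
  derivative in \<open>t a\<close>, and \<open>pl\<close> stands for p times \<lambda>. The terms
  are first replaced coloring by coloring, then \<open>kz_coloring\<close> reduces each to its mixed
  pairs; only the sum over all colorings of type \<open>J\<close> vanishes, by
  \<open>kz_leftover\<close>.\<close>

theorem kz_congruence:
  assumes D: "derivation D" and Dt: "\<And>a. a \<in> {1..k} \<Longrightarrow> D (t a) = 0"
    and Dz: "\<And>l. l \<in> {1..n} \<Longrightarrow> D (z l) = (if l = i then 1 else 0)"
    and DE: "D E \<approx> pl * of_nat (m i) * h / 2 * E" and i: "i \<in> {1..n}"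
    and D': "\<And>a. a \<in> {1..k} \<Longrightarrow> derivation (D' a)"
    and D't: "\<And>a b. a \<in> {1..k} \<Longrightarrow> b \<in> {1..k} \<Longrightarrow> D' a (t b) = (if b = a then 1 else 0)"
    and D'z: "\<And>a l. a \<in> {1..k} \<Longrightarrow> l \<in> {1..n} \<Longrightarrow> D' a (z l) = 0"
    and D'E: "\<And>a. a \<in> {1..k} \<Longrightarrow> D' a E \<approx> - (pl * h) * E"
    and J: "J \<in> multi_indices n m k"
  shows "D (U J) - h * (pl / 2 * act m sl2_h i U J + (\<Sum>j\<in>{1..n} - {i}. Omega m i j U J / (z i - z j)))
    + (\<Sum>c\<in>colorings k n J. \<Sum>a\<in>{a\<in>{1..k}. c a = i}. D' a (E * (B * W c))) \<approx> 0"
proof -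
  interpret derivation D by (rule D)
  define F1 where "F1 c = pl * of_nat (m i) * h / 2
      + (\<Sum>j\<in>{1..n} - {i}. of_nat (m i) * of_nat (m j) * h / 2 / (z i - z j))
      + (\<Sum>a\<in>{a\<in>{1..k}. c a \<noteq> i}. of_nat (m i) * h / (t a - z i))
      + (\<Sum>a\<in>{a\<in>{1..k}. c a = i}. (1 - of_nat (M i)) / (t a - z i))" for c
  define F2 where "F2 c j = of_nat (m i) * of_nat (m j) / 2 / (z i - z j)
     + (of_nat (m i) - of_nat (J i)) * (\<Sum>a\<in>{a\<in>{1..k}. c a = j}. 1 / (t a - z i))
     - (of_nat (m j) - of_nat (J j)) * (\<Sum>a\<in>{a\<in>{1..k}. c a = i}. 1 / (t a - z j))" for c j
  define F3 where "F3 a = - (pl * h)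
      + (\<Sum>b\<in>{1..k} - {a}. 2 * h / (t a - t b))
      + (\<Sum>l\<in>{1..n} - {i}. - (of_nat (m l) * h) / (t a - z l))
      + (of_nat (M i) - 1) / (t a - z i)" for a
  let ?G = "\<lambda>c. E * (B * W c)"
  let ?H = "of_nat (m i) - 2 * of_nat (J i) :: 'f"
  have U: "U J = (\<Sum>c\<in>colorings k n J. ?G c)" using J by (simp add: U_def)
  have "(\<Sum>j\<in>{1..n} - {i}. Omega m i j U J / (z i - z j)) =
      (\<Sum>j\<in>{1..n} - {i}. \<Sum>c\<in>colorings k n J. ?G c * F2 c j)"
    unfolding F2_def using i by (intro sum.cong refl Omega_U J) auto
  also have "\<dots> = (\<Sum>c\<in>colorings k n J. ?G c * (\<Sum>j\<in>{1..n} - {i}. F2 c j))"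
    by (subst sum.swap) (simp only: sum_distrib_left)
  finally have Om: "h * (pl / 2 * act m sl2_h i U J + (\<Sum>j\<in>{1..n} - {i}. Omega m i j U J / (z i - z j))) =
      (\<Sum>c\<in>colorings k n J. h * (pl / 2 * (?G c * ?H) + ?G c * (\<Sum>j\<in>{1..n} - {i}. F2 c j)))"
    by (simp only: act_h_U[OF J i] sum_distrib_left sum.distrib distrib_left)
  have "D (U J) - h * (pl / 2 * act m sl2_h i U J + (\<Sum>j\<in>{1..n} - {i}. Omega m i j U J / (z i - z j)))
    + (\<Sum>c\<in>colorings k n J. \<Sum>a\<in>{a\<in>{1..k}. c a = i}. D' a (?G c)) \<approx>
    (\<Sum>c\<in>colorings k n J. ?G c * F1 c)
    - (\<Sum>c\<in>colorings k n J. h * (pl / 2 * (?G c * ?H) + ?G c * (\<Sum>j\<in>{1..n} - {i}. F2 c j)))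
    + (\<Sum>c\<in>colorings k n J. \<Sum>a\<in>{a\<in>{1..k}. c a = i}. ?G c * F3 a)"
    unfolding Om unfolding U sum
  proof (intro congr_add congr_diff congr_sum congr_refl)
    fix c assume "c \<in> colorings k n J"
    hence cr: "\<And>b. b \<in> {1..k} \<Longrightarrow> c b \<in> {1..n}" by (rule coloring_range)
    show "D (?G c) \<approx> ?G c * F1 c"
      unfolding F1_def by (rule dz_term[OF D Dt Dz DE i cr])
    fix a assume "a \<in> {a\<in>{1..k}. c a = i}"
    hence a: "a \<in> {1..k}" "c a = i" by auto
    have "D' a (?G c) \<approx> ?G c * (- (pl * h)
      + (\<Sum>b\<in>{1..k} - {a}. 2 * h / (t a - t b))
      + (\<Sum>l\<in>{1..n} - {c a}. - (of_nat (m l) * h) / (t a - z l))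
      + (of_nat (M (c a)) - 1) / (t a - z (c a)))"
      by (rule dt_W_term) (use a D' D't D'z D'E cr in auto)
    thus "D' a (?G c) \<approx> ?G c * F3 a"
      unfolding F3_def a(2) .
  qed
  also have "\<dots> = (\<Sum>c\<in>colorings k n J. ?G c * (F1 c - h * (pl / 2 * ?H + (\<Sum>j\<in>{1..n} - {i}. F2 c j))
      + (\<Sum>a\<in>{a\<in>{1..k}. c a = i}. F3 a)))"
    by (simp only: right_diff_distrib distrib_left sum.distrib sum_subtractf sum_distrib_left mult_ac)
  also have "\<dots> = (\<Sum>c\<in>colorings k n J. E * B * h * (W c *
     (\<Sum>a\<in>{a\<in>{1..k}. c a = i}. \<Sum>b\<in>{b\<in>{1..k}. c b \<noteq> i}.
     2 / (t a - t b) - 1 / (t a - z (c b)) + 1 / (t b - z i))))"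
  proof (intro sum.cong refl)
    fix c assume c: "c \<in> colorings k n J"
    show "?G c * (F1 c - h * (pl / 2 * ?H + (\<Sum>j\<in>{1..n} - {i}. F2 c j))
      + (\<Sum>a\<in>{a\<in>{1..k}. c a = i}. F3 a)) = E * B * h * (W c *
     (\<Sum>a\<in>{a\<in>{1..k}. c a = i}. \<Sum>b\<in>{b\<in>{1..k}. c b \<noteq> i}.
     2 / (t a - t b) - 1 / (t a - z (c b)) + 1 / (t b - z i)))"
      unfolding F1_def F2_def F3_def kz_coloring[OF c i] by (simp only: mult_ac)
  qed
  also have "\<dots> = 0"
    by (simp only: sum_distrib_left[symmetric] kz_leftover[OF i] mult_zero_right)
  finally show ?thesis .
qed


text \<open>The sum of the \<open>J j / (t a - z j)\<close> is a sum over all points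
  \<open>b\<close>, each contributing the pole of its color. The contribution of
  \<open>b = a\<close> is cancelled by the extra 1 coming from \<open>f^(i) e^(i)\<close>; the terms
  with \<open>m j\<close> and those with \<open>lam\<close> cancel directly.\<close>

lemma dynamical_coloring:
  assumes c: "c \<in> colorings k n J" and a: "a \<in> {1..k}"
  shows "- (p * lam * h) - h * (\<Sum>j=1..n. (of_nat (m j) - of_nat (J j) + (if c a = j then 1 else 0)) * (1 / (t a - z j)))
    - (- (p * lam * h) + (\<Sum>b\<in>{1..k} - {a}. 2 * h / (t a - t b))
      + (\<Sum>l=1..n. - (of_nat (m l) * h) / (t a - z l)))
    = h * (\<Sum>b\<in>{1..k} - {a}. 1 / (t a - z (c b)) - 2 / (t a - t b))"
proof -
  define x where "x = (\<Sum>j=1..n. of_nat (m j) * (1 / (t a - z j)))"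
  define y where "y = (\<Sum>b\<in>{1..k} - {a}. 1 / (t a - z (c b)))"
  define w where "w = (\<Sum>b\<in>{1..k} - {a}. 2 / (t a - t b))"
  have ca: "c a \<in> {1..n}" using coloring_range[OF c a] .
  have "(\<Sum>j=1..n. of_nat (J j) * (1 / (t a - z j))) = 1 / (t a - z (c a)) + y"
    unfolding sum_over_coloring[OF c, symmetric] y_def using a by (intro sum.remove) auto
  moreover have "(\<Sum>j=1..n. (if c a = j then 1 else 0) * (1 / (t a - z j))) = 1 / (t a - z (c a))"
    using ca by (simp add: if_distrib[of "\<lambda>x. x / _"] cong: if_cong)
  ultimately have e1: "(\<Sum>j=1..n. (of_nat (m j) - of_nat (J j) + (if c a = j then 1 else 0)) * (1 / (t a - z j))) = x - y"
    by (simp only: distrib_right left_diff_distrib sum.distrib sum_subtractf x_def) simp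
  have e2: "(\<Sum>b\<in>{1..k} - {a}. 2 * h / (t a - t b)) = h * w"
    by (simp add: w_def sum_distrib_left mult.commute)
  have e3: "(\<Sum>l=1..n. - (of_nat (m l) * h) / (t a - z l)) = - (h * x)"
    by (simp add: x_def sum_distrib_left sum_negf mult_ac)
  have e4: "(\<Sum>b\<in>{1..k} - {a}. 1 / (t a - z (c b)) - 2 / (t a - t b)) = y - w"
    by (simp only: y_def w_def sum_subtractf)
  show ?thesis unfolding e1 e2 e3 e4 by (simp add: algebra_simps)
qed

text \<open>After the recoloring, \<open>W\<close> is \<open>V c a / (t a - z j)\<close>, where the
  old color of \<open>a\<close> has disappeared. Summing over the old color \<open>i\<close> and the
  points of that color is thus a sum over all points.\<close>

lemma sum_act_f_e_U:
  assumes J: "J \<in> multi_indices n m k"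
  shows "(\<Sum>i=1..n. \<Sum>j=1..n. act m sl2_f i (act m sl2_e j U) J) =
    (\<Sum>c\<in>colorings k n J. \<Sum>a=1..k. E * (B * V c a) *
      (\<Sum>j=1..n. (of_nat (m j) - of_nat (J j) + (if c a = j then 1 else 0)) * (1 / (t a - z j))))"
proof -
  let ?g = "\<lambda>i j. of_nat (m j) - of_nat (J j) + (if i = j then 1 else 0) :: 'f"
  have "(\<Sum>i=1..n. \<Sum>j=1..n. act m sl2_f i (act m sl2_e j U) J) =
    (\<Sum>i=1..n. \<Sum>j=1..n. \<Sum>c\<in>colorings k n J. \<Sum>a\<in>{a\<in>{1..k}. c a = i}. ?g i j * (E * (B * W (c(a := j)))))"
    by (intro sum.cong refl) (simp only: act_f_e_U[OF J] sum_distrib_left)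
  also have "\<dots> = (\<Sum>c\<in>colorings k n J. \<Sum>i=1..n. \<Sum>j=1..n. \<Sum>a\<in>{a\<in>{1..k}. c a = i}. ?g i j * (E * (B * W (c(a := j)))))"
    by (subst (2) sum.swap, subst sum.swap) simp
  also have "\<dots> = (\<Sum>c\<in>colorings k n J. \<Sum>i=1..n. \<Sum>a\<in>{a\<in>{1..k}. c a = i}. \<Sum>j=1..n. ?g (c a) j * (E * (B * W (c(a := j)))))"
  proof (rule sum.cong[OF refl], rule sum.cong[OF refl])
    fix c i
    show "(\<Sum>j=1..n. \<Sum>a\<in>{a\<in>{1..k}. c a = i}. ?g i j * (E * (B * W (c(a := j))))) =
      (\<Sum>a\<in>{a\<in>{1..k}. c a = i}. \<Sum>j=1..n. ?g (c a) j * (E * (B * W (c(a := j)))))"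
      by (subst sum.swap) (auto intro!: sum.cong)
  qed
  also have "\<dots> = (\<Sum>c\<in>colorings k n J. \<Sum>a=1..k. \<Sum>j=1..n. ?g (c a) j * (E * (B * W (c(a := j)))))"
    by (intro sum.cong refl sum.group) (use coloring_range in auto)
  also have "\<dots> = (\<Sum>c\<in>colorings k n J. \<Sum>a=1..k. E * (B * V c a) *
      (\<Sum>j=1..n. ?g (c a) j * (1 / (t a - z j))))"
    unfolding sum_distrib_left by (intro sum.cong refl) (simp add: W_V[of _ "_(_ := _)"])
  finally show ?thesis .
qed

text \<open>The derivative of \<open>E\<close> and the h-part together leave the factor
  \<open>\<Sum>a. t a - z (c a)\<close> on each coloring. Each of its summands removes one pole and
  turns \<open>W c\<close> into \<open>V c a\<close>, which is why the corrections are derivatives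
  of \<open>E * (B * V c a)\<close>. The multiplication by \<open>lam\<close> keeps the inverse of
  \<lambda> out of the congruence.\<close>

theorem dynamical_congruence:
  assumes D: "derivation D" and Dt: "\<And>a. a \<in> {1..k} \<Longrightarrow> D (t a) = 0"
    and Dz: "\<And>l. l \<in> {1..n} \<Longrightarrow> D (z l) = 0"
    and DE: "D E \<approx> p * h * ((\<Sum>l=1..n. z l / 2 * of_nat (m l)) - (\<Sum>a=1..k. t a)) * E"
    and lam: "lam \<in> S"
    and D': "\<And>a. a \<in> {1..k} \<Longrightarrow> derivation (D' a)"
    and D't: "\<And>a b. a \<in> {1..k} \<Longrightarrow> b \<in> {1..k} \<Longrightarrow> D' a (t b) = (if b = a then 1 else 0)"
    and D'z: "\<And>a l. a \<in> {1..k} \<Longrightarrow> l \<in> {1..n} \<Longrightarrow> D' a (z l) = 0"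
    and D'E: "\<And>a. a \<in> {1..k} \<Longrightarrow> D' a E \<approx> - (p * lam * h) * E"
    and J: "J \<in> multi_indices n m k"
  shows "lam * (D (U J) - h * (p * (\<Sum>i=1..n. z i / 2 * act m sl2_h i U J)))
    - h * (\<Sum>i=1..n. \<Sum>j=1..n. act m sl2_f i (act m sl2_e j U) J)
    - (\<Sum>c\<in>colorings k n J. \<Sum>a=1..k. D' a (E * (B * V c a))) \<approx> 0"
proof -
  interpret derivation D by (rule D)
  let ?G = "\<lambda>c. E * (B * W c)"
  let ?s = "(\<Sum>l=1..n. z l / 2 * of_nat (m l)) - (\<Sum>a=1..k. t a)"
  define F1 where "F1 c a = (\<Sum>j=1..n. (of_nat (m j) - of_nat (J j) + (if c a = j then 1 else 0)) * (1 / (t a - z j)))" for c a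
  define F2 where "F2 a = - (p * lam * h) + (\<Sum>b\<in>{1..k} - {a}. 2 * h / (t a - t b))
      + (\<Sum>l=1..n. - (of_nat (m l) * h) / (t a - z l))" for a
  have U: "U J = (\<Sum>c\<in>colorings k n J. ?G c)" using J by (simp add: U_def)
  have DG: "D (?G c) \<approx> ?G c * (p * h * ?s)" if c: "c \<in> colorings k n J" for c
  proof -
    have cr: "\<And>b. b \<in> {1..k} \<Longrightarrow> c b \<in> {1..n}" using coloring_range[OF c] .
    have "(\<Sum>l=1..n. \<Sum>a=1..k. of_nat (M l) * (D (t a - z l) / (t a - z l))) = 0"
      by (intro sum.neutral ballI) (simp add: diff Dt Dz)
    hence X: "has_logder D Xf 0" using has_logder_X[OF D] by simp
    have "(\<Sum>a=1..k. - (D (t a - z (c a)) / (t a - z (c a)))) = 0"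
      using cr by (intro sum.neutral ballI) (simp add: diff Dt Dz)
    hence W: "has_logder D (W c) 0" using has_logder_W[OF D, of c] cr by simp
    have L: "has_logder D (B * W c) 0"
      using has_logder_mult[OF D has_logder_mult[OF D has_logder_mult[OF D has_logder_Z0[OF D Dz] has_logder_T0[OF D Dt]] X] W]
      by (simp only: B_def add_0_right)
    have "B * W c \<in> S" by (rule B_W_S) (rule cr)
    hence "B * W c * D E \<approx> B * W c * (p * h * ?s * E)" by (rule congr_mult[OF _ DE])
    thus ?thesis unfolding derivation_term[OF D L] by (simp add: mult_ac)
  qed
  have "(\<Sum>i=1..n. z i / 2 * act m sl2_h i U J) =
      (\<Sum>i=1..n. \<Sum>c\<in>colorings k n J. ?G c * (z i / 2 * (of_nat (m i) - 2 * of_nat (J i))))"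
    by (intro sum.cong refl) (simp only: act_h_U[OF J] sum_distrib_left mult_ac)
  also have "\<dots> = (\<Sum>c\<in>colorings k n J. ?G c * (\<Sum>i=1..n. z i / 2 * (of_nat (m i) - 2 * of_nat (J i))))"
    by (subst sum.swap) (simp only: sum_distrib_left)
  also have "\<dots> = (\<Sum>c\<in>colorings k n J. ?G c * (?s + (\<Sum>a=1..k. t a - z (c a))))"
  proof (intro sum.cong refl)
    fix c assume c: "c \<in> colorings k n J"
    have "(\<Sum>i=1..n. z i / 2 * (of_nat (m i) - 2 * of_nat (J i))) =
        (\<Sum>l=1..n. z l / 2 * of_nat (m l)) - (\<Sum>a=1..k. z (c a))"
      unfolding sum_over_coloring[OF c] sum_subtractf[symmetric]
      by (intro sum.cong refl) (simp add: algebra_simps)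
    thus "?G c * (\<Sum>i=1..n. z i / 2 * (of_nat (m i) - 2 * of_nat (J i))) =
      ?G c * (?s + (\<Sum>a=1..k. t a - z (c a)))"
      by (simp add: sum_subtractf)
  qed
  finally have hU: "(\<Sum>i=1..n. z i / 2 * act m sl2_h i U J) =
      (\<Sum>c\<in>colorings k n J. ?G c * (?s + (\<Sum>a=1..k. t a - z (c a))))" .
  have "lam * (D (U J) - h * (p * (\<Sum>i=1..n. z i / 2 * act m sl2_h i U J)))
    - h * (\<Sum>i=1..n. \<Sum>j=1..n. act m sl2_f i (act m sl2_e j U) J)
    - (\<Sum>c\<in>colorings k n J. \<Sum>a=1..k. D' a (E * (B * V c a))) \<approx>
    lam * ((\<Sum>c\<in>colorings k n J. ?G c * (p * h * ?s)) - h * (p * (\<Sum>i=1..n. z i / 2 * act m sl2_h i U J)))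
    - h * (\<Sum>i=1..n. \<Sum>j=1..n. act m sl2_f i (act m sl2_e j U) J)
    - (\<Sum>c\<in>colorings k n J. \<Sum>a=1..k. E * (B * V c a) * F2 a)"
    unfolding U sum
  proof (intro congr_diff congr_mult[OF lam] congr_sum congr_refl DG)
    fix c a assume c: "c \<in> colorings k n J" and a: "a \<in> {1..k}"
    show "D' a (E * (B * V c a)) \<approx> E * (B * V c a) * F2 a"
      unfolding F2_def by (rule dt_V_term) (use a D' D't D'z D'E coloring_range[OF c] in auto)
  qed
  also have "\<dots> = (\<Sum>c\<in>colorings k n J. \<Sum>a=1..k.
      E * (B * V c a) * (- (p * lam * h) - h * F1 c a - F2 a))"
  proof -
    have GV: "?G c * (\<Sum>a=1..k. t a - z (c a)) = (\<Sum>a=1..k. E * (B * V c a))"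
      if c: "c \<in> colorings k n J" for c
      unfolding sum_distrib_left
    proof (intro sum.cong refl)
      fix a assume a: "a \<in> {1..k}"
      hence "t a - z (c a) \<noteq> 0" using t_z coloring_range[OF c] by simp
      thus "?G c * (t a - z (c a)) = E * (B * V c a)" using W_V[OF a, of c] by simp
    qed
    have "lam * ((\<Sum>c\<in>colorings k n J. ?G c * (p * h * ?s)) - h * (p * (\<Sum>i=1..n. z i / 2 * act m sl2_h i U J)))
      = lam * (\<Sum>c\<in>colorings k n J. - (h * p) * (?G c * (\<Sum>a=1..k. t a - z (c a))))"
      unfolding hU sum_distrib_left[of p] sum_distrib_left[of h] sum_subtractf[symmetric]
      by (intro arg_cong[of _ _ "(*) lam"] sum.cong refl) (simp add: algebra_simps)
    also have "\<dots> = (\<Sum>c\<in>colorings k n J. \<Sum>a=1..k. E * (B * V c a) * - (p * lam * h))"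
      by (subst sum.cong[OF refl arg_cong[OF GV]], assumption) (simp add: sum_distrib_left mult_ac)
    finally show ?thesis
      unfolding sum_act_f_e_U[OF J] F1_def[symmetric]
      by (simp only: right_diff_distrib sum_subtractf sum_distrib_left mult_ac)
  qed
  also have "\<dots> = (\<Sum>c\<in>colorings k n J. \<Sum>a=1..k. E * (B * V c a) *
      (h * (\<Sum>b\<in>{1..k} - {a}. 1 / (t a - z (c b)) - 2 / (t a - t b))))"
    unfolding F1_def F2_def by (intro sum.cong refl) (simp only: dynamical_coloring)
  also have "\<dots> = E * B * h * (\<Sum>c\<in>colorings k n J. \<Sum>a=1..k. \<Sum>b\<in>{1..k} - {a}.
     V c a * (1 / (t a - z (c b)) - 2 / (t a - t b)))"
    by (simp only: sum_distrib_left mult_ac)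
  also have "\<dots> = 0" by (simp only: dynamical_leftover mult_zero_right)
  finally show ?thesis .
qed

end

section \<open>Divisibility in the p-adic integers\<close>

lemma Rep_padic_int_of_int:
  "Rep_padic_int (of_int b :: 'p :: prime_card padic_int) r = b mod int CARD('p) ^ r"
proof (cases b rule: int_cases2)
  case (nonneg a)
  thus ?thesis by (simp add: Rep_padic_int_of_nat)
next
  case (nonpos a)
  thus ?thesis by (simp add: Rep_padic_int_of_nat uminus_padic_int.rep_eq mod_minus_eq)
qed

text \<open>Inverses of \<open>b\<close> modulo the powers of p exist and are unique as residues.
  They are therefore compatible under reduction, that is, they form a p-adic integer.\<close>

lemma padic_int_unit:
  assumes "\<not> int CARD('p :: prime_card) dvd b"
  shows "\<exists>c :: 'p padic_int. of_int b * c = 1"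
proof -
  let ?p = "int CARD('p)"
  have cop: "coprime b (?p ^ r)" for r
    using prime_imp_coprime[OF prime_card_int assms] by (simp add: coprime_commute)
  hence "\<forall>r. \<exists>y. [b * y = 1] (mod ?p ^ r)"
    using cong_solve_coprime_int by blast
  then obtain y where y: "\<And>r. [b * y r = 1] (mod ?p ^ r)" by metis
  define x where "x r = y r mod ?p ^ r" for r
  have "x r = x (Suc r) mod ?p ^ r" for r
  proof -
    have "[b * y (Suc r) = 1] (mod ?p ^ r)"
      by (rule cong_dvd_modulus[OF y]) (simp add: le_imp_power_dvd)
    hence "[b * y r = b * y (Suc r)] (mod ?p ^ r)"
      using y[of r] by (metis cong_sym cong_trans)
    hence "[y r = y (Suc r)] (mod ?p ^ r)"
      using cop[of r] by (simp add: cong_mult_lcancel)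
    thus ?thesis unfolding x_def by (simp only: mod_power_Suc_cancel) (simp add: cong_def)
  qed
  hence rep: "Rep_padic_int (Abs_padic_int x :: 'p padic_int) = x"
    by (intro Abs_padic_int_inverse CollectI allI)
  have "Rep_padic_int (of_int b * (Abs_padic_int x :: 'p padic_int)) r = Rep_padic_int (1 :: 'p padic_int) r" for r
    unfolding times_padic_int.rep_eq rep Rep_padic_int_of_int one_padic_int.rep_eq x_def mod_mult_eq
    using y[of r] by (simp only: cong_def)
  hence "of_int b * (Abs_padic_int x :: 'p padic_int) = 1"
    by (simp add: Rep_padic_int_inject[symmetric] fun_eq_iff)
  thus ?thesis ..
qed

lemma multiplicity_fact_add:
  assumes p: "prime p" and r: "r < p"
  shows "multiplicity p (fact (p * q + r) :: nat) = multiplicity p (fact (p * q) :: nat)"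
  using r
proof (induction r)
  case (Suc r)
  have "\<not> p dvd Suc (p * q + r)"
  proof
    assume "p dvd Suc (p * q + r)"
    hence "p dvd Suc r" by (metis add_Suc_right dvd_add_right_iff dvd_triv_left)
    thus False using Suc.prems by (auto dest: dvd_imp_le)
  qed
  hence "multiplicity p (Suc (p * q + r)) = 0" by (rule not_dvd_imp_multiplicity_0)
  moreover have "multiplicity p (fact (p * q + Suc r) :: nat) =
      multiplicity p (Suc (p * q + r)) + multiplicity p (fact (p * q + r) :: nat)"
    unfolding add_Suc_right fact_Suc
    using p by (subst prime_elem_multiplicity_mult_distrib) auto
  ultimately show ?case using Suc by simp
qed simp

text \<open>Among the factors between \<open>p * q\<close> and \<open>p * Suc q\<close> only the
  last is a multiple of p. Together with \<open>multiplicity_fact_add\<close> this is Legendre's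
  recursion.\<close>

lemma multiplicity_fact_mult:
  assumes p: "prime p"
  shows "multiplicity p (fact (p * q) :: nat) = q + multiplicity p (fact q :: nat)"
proof (induction q)
  case (Suc q)
  have p1: "p > 1" using p by (rule prime_gt_1_nat)
  have "p * Suc q = Suc (p * q + (p - 1))" using p1 by simp
  hence "fact (p * Suc q) = (p * Suc q) * (fact (p * q + (p - 1)) :: nat)"
    by (metis fact_Suc of_nat_id)
  hence "multiplicity p (fact (p * Suc q) :: nat) =
      multiplicity p (p * Suc q) + multiplicity p (fact (p * q + (p - 1)) :: nat)"
    using p p1 by (simp add: prime_elem_multiplicity_mult_distrib)
  also have "multiplicity p (p * Suc q) = Suc (multiplicity p (Suc q))"
    using p p1 by (intro multiplicity_times_same) auto
  also have "multiplicity p (fact (p * q + (p - 1)) :: nat) = multiplicity p (fact (p * q) :: nat)"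
    using p1 by (intro multiplicity_fact_add p) simp
  finally show ?case
    using p Suc by (simp add: fact_Suc prime_elem_multiplicity_mult_distrib del: mult_Suc)
qed simp

text \<open>Legendre's bound in strict form. For \<open>q = k div p\<close> the recursion reads
  \<open>v = q + v'\<close>, where \<open>v'\<close> belongs to \<open>fact q\<close>; if
  \<open>q > 0\<close>, then \<open>v' * (p - 1) < q\<close> gives
  \<open>v * (p - 1) < q * (p - 1) + q = p * q \<le> k\<close>.\<close>

lemma multiplicity_fact_less:
  assumes p: "prime p" and "k > 0"
  shows "multiplicity p (fact k :: nat) * (p - 1) < k"
  using assms(2)
proof (induction k rule: less_induct)
  case (less k)
  have p1: "p > 1" using p by (rule prime_gt_1_nat)
  define q where "q = k div p"
  have k: "k = p * q + k mod p" by (simp add: q_def)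
  have "multiplicity p (fact k :: nat) = q + multiplicity p (fact q :: nat)"
    using multiplicity_fact_add[OF p, of "k mod p" q] multiplicity_fact_mult[OF p, of q] p1 k by simp
  moreover have "(q + multiplicity p (fact q :: nat)) * (p - 1) < k"
  proof (cases "q = 0")
    case False
    hence "multiplicity p (fact q :: nat) * (p - 1) < q"
      using less.prems p1 by (intro less.IH) (auto simp: q_def)
    moreover have "q * (p - 1) + q = p * q" using p1 by (cases p) auto
    ultimately have "(q + multiplicity p (fact q :: nat)) * (p - 1) < p * q"
      by (simp add: distrib_right)
    thus ?thesis using k by linarith
  qed (use less.prems in simp)
  ultimately show ?case by simp
qed

text \<open>\<open>fact k\<close> is a power of p times a factor prime to p, and the latter is a
  unit. The statement is multiplicative because \<open>fact k\<close> need not be invertible in the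
  p-adic integers.\<close>

lemma padic_int_power_div_fact:
  assumes "r + multiplicity CARD('p :: prime_card) (fact k :: nat) \<le> k"
  shows "\<exists>c :: 'p padic_int. of_nat CARD('p) ^ k = of_nat CARD('p) ^ r * (fact k * c)"
proof -
  let ?p = "CARD('p)"
  define v where "v = multiplicity ?p (fact k :: nat)"
  have "(fact k :: nat) \<noteq> 0" "\<not> is_unit ?p"
    using prime_card[where 'a = 'p] by (auto simp: prime_nat_iff)
  then obtain w where w: "fact k = ?p ^ v * w" "\<not> ?p dvd w"
    unfolding v_def using multiplicity_decompose' by metis
  obtain c :: "'p padic_int" where c: "of_int (int w) * c = 1"
    using padic_int_unit[of "int w"] w(2) by auto
  have "fact k = (of_nat (fact k) :: 'p padic_int)" by simp
  also have "\<dots> = of_nat ?p ^ v * of_nat w" unfolding w(1) by simp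
  finally have "of_nat ?p ^ r * (fact k * (of_nat ?p ^ (k - r - v) * c)) =
      of_nat ?p ^ r * of_nat ?p ^ v * of_nat ?p ^ (k - r - v) * (of_nat w * c)"
    by (simp only: mult_ac)
  also have "\<dots> = of_nat ?p ^ k"
    using c assms by (simp add: power_add[symmetric] v_def[symmetric])
  finally show ?thesis by metis
qed

lemma padic_int_power_dvd_fact:
  "\<exists>c :: 'p :: prime_card padic_int. of_nat CARD('p) ^ k = fact k * c"
proof -
  have "multiplicity CARD('p) (fact k :: nat) \<le> k"
  proof (cases "k = 0")
    case False
    let ?v = "multiplicity CARD('p) (fact k :: nat)"
    have "CARD('p) - 1 \<ge> 1" using prime_gt_1_nat[OF prime_card[where 'a = 'p]] by simp
    hence "?v \<le> ?v * (CARD('p) - 1)" using mult_le_mono2[of 1 _ ?v] by (simp only: mult_1_right)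
    also have "\<dots> < k" using multiplicity_fact_less[OF prime_card[where 'a = 'p]] False by simp
    finally show ?thesis by simp
  qed simp
  thus ?thesis using padic_int_power_div_fact[of 0 k, where 'p = 'p] by simp
qed

text \<open>The origin of the degree \<open>d = exp_deg p s\<close>: rounding down and adding 1
  gives \<open>s * (p - 1) < (p - 2) * d\<close>. If \<open>v\<close> is the multiplicity of p in
  \<open>fact d\<close>, then also \<open>v * (p - 1) < d\<close>. The sum of both is
  \<open>(s + v) * (p - 1) < (p - 1) * d\<close>, so \<open>s + v < d\<close>.\<close>

lemma padic_int_power_exp_deg:
  assumes p2: "CARD('p :: prime_card) > 2"
  shows "\<exists>c :: 'p padic_int. of_nat CARD('p) ^ exp_deg CARD('p) s =
    of_nat CARD('p) ^ s * (fact (exp_deg CARD('p) s) * c)"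
proof (rule padic_int_power_div_fact)
  let ?p = "CARD('p)" let ?d = "exp_deg CARD('p) s"
  define v where "v = multiplicity ?p (fact ?d :: nat)"
  \<comment> \<open>\<open>e\<close> is p - 2, the divisor in \<open>exp_deg\<close>; it is positive
    because p > 2.\<close>
  obtain e where e: "?p = Suc (Suc e)" "e > 0"
    using p2 by (metis Suc_lessD less_imp_Suc_add add_Suc_right add_Suc numeral_2_eq_2 zero_less_Suc plus_nat.add_0)
  have "v * (?p - 1) < ?d"
    unfolding v_def by (rule multiplicity_fact_less[OF prime_card]) (simp add: exp_deg_def)
  hence v: "v * Suc e < ?d" using e by simp
  have "s * Suc e < e * ?d"
    unfolding exp_deg_def e(1) using e(2) dividend_less_div_times[of e "s * Suc e"]
    by (simp add: mult.commute)
  hence "s * Suc e + v * Suc e < ?d * Suc e" using v by (simp add: mult.commute)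
  hence "(s + v) * Suc e < ?d * Suc e" by (simp only: distrib_right)
  hence "s + v < ?d" by (simp only: mult_less_cancel2)
  thus "s + multiplicity ?p (fact ?d :: nat) \<le> ?d" by (simp add: v_def)
qed

section \<open>Derivations of polynomial rings and their fraction fields\<close>

definition fract_deriv :: "('a :: idom \<Rightarrow> 'a) \<Rightarrow> 'a fract \<Rightarrow> 'a fract" where
  "fract_deriv d x = (THE y. \<exists>a b. b \<noteq> 0 \<and> x = to_fract a / to_fract b \<and>
     y = (to_fract (d a) * to_fract b - to_fract a * to_fract (d b)) / to_fract b ^ 2)"

lemma fract_cases_to_fract:
  obtains a b where "b \<noteq> 0" "x = to_fract a / to_fract b"
proof (cases x)
  case (Fract a b)
  thus ?thesis using that[of b a] by (simp add: Fract_conv_to_fract)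
qed

context
  fixes d :: "'a :: idom \<Rightarrow> 'a"
  assumes d: "derivation d"
begin

interpretation derivation d by (rule d)

text \<open>The quotient rule does not depend on the representation: applying \<open>d\<close> to
  \<open>a * b' = a' * b\<close> yields the relation between the derivatives that identifies the two
  formulas. This justifies the definite description in \<open>fract_deriv\<close>.\<close>

lemma fract_deriv_quotient:
  assumes "b \<noteq> 0"
  shows "fract_deriv d (to_fract a / to_fract b) =
    (to_fract (d a) * to_fract b - to_fract a * to_fract (d b)) / to_fract b ^ 2"
  unfolding fract_deriv_def
proof (rule the_equality)
  fix y assume "\<exists>a' b'. b' \<noteq> 0 \<and> to_fract a / to_fract b = to_fract a' / to_fract b' \<and>
    y = (to_fract (d a') * to_fract b' - to_fract a' * to_fract (d b')) / to_fract b' ^ 2"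
  then obtain a' b' where b': "b' \<noteq> 0" and eq: "to_fract a / to_fract b = to_fract a' / to_fract b'"
    and y: "y = (to_fract (d a') * to_fract b' - to_fract a' * to_fract (d b')) / to_fract b' ^ 2"
    by blast
  from eq have "to_fract (a * b') = to_fract (a' * b)"
    using assms b' by (simp add: frac_eq_eq)
  hence ab: "a * b' = a' * b" by (simp only: to_fract_eq_iff)
  hence dab: "d a * b' + a * d b' = d a' * b + a' * d b" by (metis mult)
  have "(d a' * b' - a' * d b') * b ^ 2 = (d a * b - a * d b) * b' ^ 2"
  proof -
    have "(d a' * b' - a' * d b') * b ^ 2 = (d a' * b) * (b' * b) - (a' * b) * (d b' * b)"
      by (simp add: algebra_simps power2_eq_square)
    also have "d a' * b = d a * b' + a * d b' - a' * d b" using dab by (simp add: algebra_simps)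
    also have "(d a * b' + a * d b' - a' * d b) * (b' * b) - (a' * b) * (d b' * b) =
        d a * b * b' ^ 2 + (a * b') * (d b' * b) - (a' * b) * (b' * d b) - (a' * b) * (d b' * b)"
      by (simp add: algebra_simps power2_eq_square)
    also have "\<dots> = (d a * b - a * d b) * b' ^ 2"
      unfolding ab[symmetric] by (simp add: algebra_simps power2_eq_square)
    finally show ?thesis .
  qed
  hence "to_fract ((d a' * b' - a' * d b') * b ^ 2) = to_fract ((d a * b - a * d b) * b' ^ 2)"
    by simp
  thus "y = (to_fract (d a) * to_fract b - to_fract a * to_fract (d b)) / to_fract b ^ 2"
    unfolding y using assms b'
    by (subst frac_eq_eq) (simp_all add: power2_eq_square)
qed (use assms in blast)

lemma fract_deriv_to_fract: "fract_deriv d (to_fract a) = to_fract (d a)"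
  using fract_deriv_quotient[of 1 a] by simp

lemma derivation_fract_deriv: "derivation (fract_deriv d)"
proof
  fix x y :: "'a fract"
  obtain a b where x: "b \<noteq> 0" "x = to_fract a / to_fract b" by (rule fract_cases_to_fract)
  obtain a' b' where y: "b' \<noteq> 0" "y = to_fract a' / to_fract b'" by (rule fract_cases_to_fract)
  have "x + y = to_fract (a * b' + a' * b) / to_fract (b * b')"
    using x y by (simp add: divide_simps) (simp add: algebra_simps)
  hence "fract_deriv d (x + y) = (to_fract (d (a * b' + a' * b)) * to_fract (b * b')
      - to_fract (a * b' + a' * b) * to_fract (d (b * b'))) / to_fract (b * b') ^ 2"
    using x y by (simp add: fract_deriv_quotient del: to_fract_add to_fract_mult)
  also have "\<dots> = fract_deriv d x + fract_deriv d y"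
    unfolding x(2) y(2) fract_deriv_quotient[OF x(1)] fract_deriv_quotient[OF y(1)]
    using x(1) y(1)
    by (simp add: add mult divide_simps) (simp add: algebra_simps power2_eq_square)
  finally show "fract_deriv d (x + y) = fract_deriv d x + fract_deriv d y" .
  have "x * y = to_fract (a * a') / to_fract (b * b')"
    using x y by simp
  hence "fract_deriv d (x * y) = (to_fract (d (a * a')) * to_fract (b * b')
      - to_fract (a * a') * to_fract (d (b * b'))) / to_fract (b * b') ^ 2"
    using x y by (simp add: fract_deriv_quotient del: to_fract_mult)
  also have "\<dots> = fract_deriv d x * y + x * fract_deriv d y"
    unfolding x(2) y(2) fract_deriv_quotient[OF x(1)] fract_deriv_quotient[OF y(1)]
    using x(1) y(1)
    by (simp add: mult divide_simps) (simp add: algebra_simps power2_eq_square)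
  finally show "fract_deriv d (x * y) = fract_deriv d x * y + x * fract_deriv d y" .
qed

end

lemma poly_mapping_sum_singles:
  "P = (\<Sum>\<alpha>\<in>Poly_Mapping.keys P. Poly_Mapping.single \<alpha> (Poly_Mapping.lookup P \<alpha>))"
  by (rule poly_mapping_eqI) (simp add: lookup_sum lookup_single when_def not_in_keys_iff_lookup_eq_zero)

text \<open>Both sides of the product rule are biadditive, and every element is a finite sum of
  monomials.\<close>

lemma derivation_poly_mapping:
  fixes D :: "('m :: comm_monoid_add \<Rightarrow>\<^sub>0 'a :: comm_ring_1) \<Rightarrow> ('m \<Rightarrow>\<^sub>0 'a)"
  assumes add: "\<And>P Q. D (P + Q) = D P + D Q"
    and single: "\<And>\<alpha> \<beta> a b. D (Poly_Mapping.single (\<alpha> + \<beta>) (a * b)) =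
      D (Poly_Mapping.single \<alpha> a) * Poly_Mapping.single \<beta> b
      + Poly_Mapping.single \<alpha> a * D (Poly_Mapping.single \<beta> b)"
  shows "derivation D"
proof
  fix P Q :: "'m \<Rightarrow>\<^sub>0 'a"
  have zero: "D 0 = 0" using add[of 0 0] by simp
  have sum: "D (\<Sum>x\<in>A. g x) = (\<Sum>x\<in>A. D (g x))" for g :: "'m \<Rightarrow> 'm \<Rightarrow>\<^sub>0 'a" and A
    by (induction A rule: infinite_finite_induct) (simp_all add: zero add)
  let ?p = "\<lambda>\<alpha>. Poly_Mapping.single \<alpha> (Poly_Mapping.lookup P \<alpha>)"
  let ?q = "\<lambda>\<alpha>. Poly_Mapping.single \<alpha> (Poly_Mapping.lookup Q \<alpha>)"
  let ?K = "Poly_Mapping.keys P" and ?L = "Poly_Mapping.keys Q"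
  have "D ((\<Sum>\<alpha>\<in>?K. ?p \<alpha>) * (\<Sum>\<beta>\<in>?L. ?q \<beta>)) = (\<Sum>\<alpha>\<in>?K. \<Sum>\<beta>\<in>?L. D (?p \<alpha> * ?q \<beta>))"
    by (simp add: sum_product sum)
  also have "\<dots> = (\<Sum>\<alpha>\<in>?K. \<Sum>\<beta>\<in>?L. D (?p \<alpha>) * ?q \<beta> + ?p \<alpha> * D (?q \<beta>))"
    by (simp add: mult_single single)
  also have "\<dots> = D (\<Sum>\<alpha>\<in>?K. ?p \<alpha>) * (\<Sum>\<beta>\<in>?L. ?q \<beta>) + (\<Sum>\<alpha>\<in>?K. ?p \<alpha>) * D (\<Sum>\<beta>\<in>?L. ?q \<beta>)"
    by (simp add: sum sum_product sum.distrib)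
  finally show "D (P * Q) = D P * Q + P * D Q"
    by (simp only: poly_mapping_sum_singles[symmetric])
qed (rule add)

text \<open>The truncated subtraction of exponents in \<open>mderiv\<close> does no harm, since it
  truncates only where the coefficient is 0. The factor in front is the one that becomes a multiple
  of the prime power in the integration by parts.\<close>

lemma lookup_mderiv:
  "Poly_Mapping.lookup (mderiv i P) \<alpha> =
     of_nat (Poly_Mapping.lookup \<alpha> i + 1) * Poly_Mapping.lookup P (\<alpha> + Poly_Mapping.single i 1)"
proof -
  let ?e = "Poly_Mapping.single i (1 :: nat)"
  have "Poly_Mapping.lookup (mderiv i P) \<alpha> = (\<Sum>\<beta>\<in>Poly_Mapping.keys P.
      if \<beta> = \<alpha> + ?e then of_nat (Poly_Mapping.lookup \<beta> i) * Poly_Mapping.lookup P \<beta> else 0)"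
    unfolding mderiv_def lookup_sum
  proof (intro sum.cong refl)
    fix \<beta>
    show "Poly_Mapping.lookup (Poly_Mapping.single (\<beta> - ?e)
        (of_nat (Poly_Mapping.lookup \<beta> i) * Poly_Mapping.lookup P \<beta>)) \<alpha> =
      (if \<beta> = \<alpha> + ?e then of_nat (Poly_Mapping.lookup \<beta> i) * Poly_Mapping.lookup P \<beta> else 0)"
    proof (cases "Poly_Mapping.lookup \<beta> i = 0")
      case False
      have "\<beta> - ?e + ?e = \<beta>"
        using False by (intro poly_mapping_eqI) (auto simp: lookup_add lookup_minus lookup_single when_def)
      hence "\<beta> - ?e = \<alpha> \<longleftrightarrow> \<beta> = \<alpha> + ?e" by (metis add_diff_cancel_right')
      thus ?thesis by (simp add: lookup_single when_def)
    qed (auto simp: lookup_single lookup_add when_def)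
  qed
  also have "\<dots> = (if \<alpha> + ?e \<in> Poly_Mapping.keys P then
      of_nat (Poly_Mapping.lookup \<alpha> i + 1) * Poly_Mapping.lookup P (\<alpha> + ?e) else 0)"
    by (simp add: lookup_add lookup_single)
  also have "\<dots> = of_nat (Poly_Mapping.lookup \<alpha> i + 1) * Poly_Mapping.lookup P (\<alpha> + ?e)"
    by (simp add: not_in_keys_iff_lookup_eq_zero)
  finally show ?thesis .
qed

lemma mderiv_single:
  "mderiv i (Poly_Mapping.single \<alpha> a) =
     Poly_Mapping.single (\<alpha> - Poly_Mapping.single i 1) (of_nat (Poly_Mapping.lookup \<alpha> i) * a)"
  by (cases "a = 0") (simp_all add: mderiv_def)

lemma derivation_mderiv: "derivation (mderiv i :: ((nat \<Rightarrow>\<^sub>0 nat) \<Rightarrow>\<^sub>0 'a :: comm_ring_1) \<Rightarrow> _)"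
proof (rule derivation_poly_mapping)
  fix P Q :: "(nat \<Rightarrow>\<^sub>0 nat) \<Rightarrow>\<^sub>0 'a"
  show "mderiv i (P + Q) = mderiv i P + mderiv i Q"
    by (rule poly_mapping_eqI) (simp add: lookup_mderiv lookup_add algebra_simps)
next
  fix \<alpha> \<beta> :: "nat \<Rightarrow>\<^sub>0 nat" and a b :: 'a
  let ?e = "Poly_Mapping.single i (1 :: nat)"
  have shift: "\<alpha> - ?e + \<beta> = \<alpha> + \<beta> - ?e" if "Poly_Mapping.lookup \<alpha> i \<noteq> 0" for \<alpha> \<beta>
    using that by (intro poly_mapping_eqI) (auto simp: lookup_add lookup_minus lookup_single when_def)
  have "Poly_Mapping.single (\<alpha> - ?e + \<beta>) (of_nat (Poly_Mapping.lookup \<alpha> i) * a * b) =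
      Poly_Mapping.single (\<alpha> + \<beta> - ?e) (of_nat (Poly_Mapping.lookup \<alpha> i) * a * b)" for \<alpha> \<beta> a b
    by (cases "Poly_Mapping.lookup \<alpha> i = 0") (simp_all add: shift[unfolded One_nat_def])
  from this[of \<alpha> \<beta> a b] this[of \<beta> \<alpha> b a]
  show "mderiv i (Poly_Mapping.single (\<alpha> + \<beta>) (a * b)) =
      mderiv i (Poly_Mapping.single \<alpha> a) * Poly_Mapping.single \<beta> b
      + Poly_Mapping.single \<alpha> a * mderiv i (Poly_Mapping.single \<beta> b)"
    by (simp add: mderiv_single mult_single lookup_add single_add[symmetric] algebra_simps)
qed

context
  fixes d :: "'a :: comm_ring_1 \<Rightarrow> 'a"
  assumes d: "derivation d"
begin

interpretation derivation d by (rule d)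

lemma lookup_map_derivation:
  "Poly_Mapping.lookup (Poly_Mapping.map d P) \<alpha> = d (Poly_Mapping.lookup P \<alpha>)"
  by (simp add: map.rep_eq when_def)

lemma map_derivation_single:
  "Poly_Mapping.map d (Poly_Mapping.single \<alpha> a) = Poly_Mapping.single \<alpha> (d a)"
  by (rule poly_mapping_eqI) (simp add: lookup_map_derivation lookup_single when_def)

lemma derivation_map_poly_mapping:
  "derivation (Poly_Mapping.map d :: ('m :: comm_monoid_add \<Rightarrow>\<^sub>0 'a) \<Rightarrow> _)"
proof (rule derivation_poly_mapping)
  fix P Q :: "'m \<Rightarrow>\<^sub>0 'a"
  show "Poly_Mapping.map d (P + Q) = Poly_Mapping.map d P + Poly_Mapping.map d Q"
    by (rule poly_mapping_eqI) (simp add: lookup_map_derivation lookup_add add)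
qed (simp add: map_derivation_single mult_single mult single_add)

lemma derivation_map_poly: "derivation (map_poly d)"
proof
  fix p q :: "'a poly"
  show "map_poly d (p + q) = map_poly d p + map_poly d q"
    by (rule poly_eqI) (simp add: coeff_map_poly add)
  show "map_poly d (p * q) = map_poly d p * q + p * map_poly d q"
    by (rule poly_eqI) (simp add: coeff_map_poly coeff_mult sum mult sum.distrib)
qed

end

lemma derivation_pderiv: "derivation (pderiv :: 'a :: idom poly \<Rightarrow> _)"
  by unfold_locales (simp_all add: pderiv_add pderiv_mult algebra_simps)

definition is_subring :: "'a :: comm_ring_1 set \<Rightarrow> bool" where
  "is_subring A \<longleftrightarrow> 1 \<in> A \<and> (\<forall>x\<in>A. - x \<in> A) \<and> (\<forall>x\<in>A. \<forall>y\<in>A. x + y \<in> A \<and> x * y \<in> A)"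

lemma is_subring_zero: "is_subring A \<Longrightarrow> 0 \<in> A"
  unfolding is_subring_def by (metis add.right_inverse)

lemma is_subring_sum: "is_subring A \<Longrightarrow> (\<And>x. x \<in> X \<Longrightarrow> g x \<in> A) \<Longrightarrow> (\<Sum>x\<in>X. g x) \<in> A"
  by (induction X rule: infinite_finite_induct) (auto simp: is_subring_zero, auto simp: is_subring_def)

lemma is_subring_polys:
  assumes A: "is_subring A"
  shows "is_subring {p. \<forall>i. poly.coeff p i \<in> A}"
  unfolding is_subring_def
proof (intro conjI ballI CollectI allI)
  fix p q i assume "p \<in> {p. \<forall>i. poly.coeff p i \<in> A}" "q \<in> {p. \<forall>i. poly.coeff p i \<in> A}"
  thus "poly.coeff (p * q) i \<in> A" unfolding coeff_mult
    using A by (intro is_subring_sum[OF A]) (auto simp: is_subring_def)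
qed (use A is_subring_zero[OF A] in \<open>auto simp: is_subring_def\<close>)

lemma is_subring_poly_mappings:
  assumes A: "is_subring A"
  shows "is_subring {P :: 'm :: comm_monoid_add \<Rightarrow>\<^sub>0 'a :: comm_ring_1. \<forall>\<alpha>. Poly_Mapping.lookup P \<alpha> \<in> A}"
  unfolding is_subring_def
proof (intro conjI ballI CollectI allI)
  fix P Q :: "'m \<Rightarrow>\<^sub>0 'a" and \<gamma>
  assume PQ: "P \<in> {P. \<forall>\<alpha>. Poly_Mapping.lookup P \<alpha> \<in> A}" "Q \<in> {P. \<forall>\<alpha>. Poly_Mapping.lookup P \<alpha> \<in> A}"
  have "P * Q = (\<Sum>\<alpha>\<in>Poly_Mapping.keys P. \<Sum>\<beta>\<in>Poly_Mapping.keys Q.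
      Poly_Mapping.single (\<alpha> + \<beta>) (Poly_Mapping.lookup P \<alpha> * Poly_Mapping.lookup Q \<beta>))"
    by (subst (1) poly_mapping_sum_singles[of P], subst (1) poly_mapping_sum_singles[of Q])
      (simp only: sum_product mult_single)
  hence "Poly_Mapping.lookup (P * Q) \<gamma> = (\<Sum>\<alpha>\<in>Poly_Mapping.keys P. \<Sum>\<beta>\<in>Poly_Mapping.keys Q.
      if \<alpha> + \<beta> = \<gamma> then Poly_Mapping.lookup P \<alpha> * Poly_Mapping.lookup Q \<beta> else 0)"
    by (simp add: lookup_sum lookup_single when_def)
  also have "\<dots> \<in> A"
    using PQ A is_subring_zero[OF A] by (intro is_subring_sum[OF A]) (auto simp: is_subring_def)
  finally show "Poly_Mapping.lookup (P * Q) \<gamma> \<in> A" .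
qed (use A is_subring_zero[OF A] in \<open>auto simp: is_subring_def lookup_add lookup_one when_def\<close>)

lemma derivation_divide_of_nat:
  fixes D :: "'f :: field_char_0 \<Rightarrow> 'f"
  assumes "derivation D"
  shows "D (x / of_nat N) = D x / of_nat N"
proof -
  interpret derivation D by (rule assms)
  show ?thesis
  proof (cases "N = 0")
    case False
    have "D x = D (x / of_nat N * of_nat N)" using False by simp
    also have "\<dots> = D (x / of_nat N) * of_nat N" by (simp only: mult of_nat mult_zero_right add_0_right)
    finally show ?thesis using False by simp
  qed simp
qed

lemma derivation_divide_fact:
  fixes D :: "'f :: field_char_0 \<Rightarrow> 'f"
  assumes "derivation D"
  shows "D (x / fact r) = D x / fact r"
  using derivation_divide_of_nat[OF assms, of x "fact r"] by simp

section \<open>Rational scalars in extensions of the p-adic integers\<close>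

lemma mconst_add: "mconst (a + b) = mconst a + mconst b"
  by (simp add: mconst_def single_add)

lemma mconst_mult: "mconst (a * b) = mconst a * mconst b"
  by (simp add: mconst_def mult_single)

lemma mconst_0 [simp]: "mconst 0 = 0" and mconst_1 [simp]: "mconst 1 = 1"
  by (simp_all add: mconst_def)

lemma comm_ring_hom_const:
  "comm_ring_hom (\<lambda>c. to_fract (mconst c) :: ((nat \<Rightarrow>\<^sub>0 nat) \<Rightarrow>\<^sub>0 'a :: idom) fract)"
  by unfold_locales (simp_all add: mconst_add mconst_mult)

lemma comm_ring_hom_const_const:
  "comm_ring_hom (\<lambda>c. to_fract (mconst [:mconst c:]) :: 'p :: prime_card tzlpoly fract)"
proof
  fix a b :: "'p padic_int"
  have "[:mconst (a + b):] = [:mconst a:] + [:mconst b:]"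
    and "[:mconst (a * b):] = [:mconst a:] * [:mconst b:]"
    by (simp_all add: mconst_add mconst_mult)
  thus "to_fract (mconst [:mconst (a + b):]) = to_fract (mconst [:mconst a:]) + to_fract (mconst [:mconst b:])"
    and "to_fract (mconst [:mconst (a * b):]) = to_fract (mconst [:mconst a:]) * to_fract (mconst [:mconst b:])"
    by (simp_all only: mconst_add mconst_mult to_fract_add to_fract_mult)
qed (simp_all flip: one_pCons)

text \<open>The hypothesis is an identity in the fraction field of the p-adic integers, while the
  exponents are compared in another field. Multiplying by the denominator of \<open>a - b\<close>
  gives an identity between p-adic integers, which \<open>\<phi>\<close> transports; in
  characteristic 0 the denominator can then be divided out again.\<close>

lemma rat_cong_hom:
  fixes \<phi> :: "'p :: prime_card padic_int \<Rightarrow> 'f :: field_char_0"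
  assumes hom: "comm_ring_hom \<phi>" and cong: "rat_cong TYPE('p) s a b"
  shows "\<exists>c. of_rat a - of_rat b = of_nat CARD('p) ^ s * \<phi> c"
proof -
  interpret comm_ring_hom \<phi> by (rule hom)
  interpret emb: comm_ring_hom "to_fract :: 'p padic_int \<Rightarrow> _" by unfold_locales auto
  from cong obtain c :: "'p padic_int" where
    c: "of_rat a - of_rat b = to_fract (of_nat CARD('p) ^ s * c)" unfolding rat_cong_def by blast
  obtain u v where uv: "quotient_of (a - b) = (u, v)" by force
  have ab: "a - b = of_int u / of_int v" by (rule quotient_of_div[OF uv])
  have v: "v \<noteq> 0" using quotient_of_denom_pos[OF uv] by simp
  have q: "(of_rat a - of_rat b :: 'g :: field_char_0) = of_int u / of_int v"
  proof -
    have "(of_rat a - of_rat b :: 'g) = of_rat (a - b)" by (simp add: of_rat_diff)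
    thus ?thesis unfolding ab by (simp add: of_rat_divide)
  qed
  have "to_fract (of_int u) = to_fract (of_int v * (of_nat CARD('p) ^ s * c))"
    using c v unfolding q by (simp add: emb.hom_of_int field_simps)
  hence "of_int u = of_int v * (of_nat CARD('p) ^ s * c)" by (simp only: to_fract_eq_iff)
  hence "\<phi> (of_int u) = \<phi> (of_int v * (of_nat CARD('p) ^ s * c))" by simp
  hence "of_int u = of_int v * (of_nat CARD('p) ^ s * \<phi> c)"
    by (simp only: hom_mult hom_power hom_of_nat hom_of_int)
  hence "of_rat a - of_rat b = of_nat CARD('p) ^ s * \<phi> c"
    unfolding q using v by simp
  thus ?thesis ..
qed

lemma inverse_of_rat_hom:
  fixes \<phi> :: "'p :: prime_card padic_int \<Rightarrow> 'f :: field_char_0"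
  assumes "comm_ring_hom \<phi>" and "\<kappa> \<noteq> 0"
    and c: "of_int (fst (quotient_of \<kappa>)) * c = of_int (snd (quotient_of \<kappa>))"
  shows "1 / of_rat \<kappa> = \<phi> c"
proof -
  interpret comm_ring_hom \<phi> by fact
  obtain u v where uv: "quotient_of \<kappa> = (u, v)" by force
  have \<kappa>: "\<kappa> = of_int u / of_int v" by (rule quotient_of_div[OF uv])
  have nz: "v \<noteq> 0" "u \<noteq> 0" using quotient_of_denom_pos[OF uv] \<kappa> assms(2) by auto
  have "\<phi> (of_int u * c) = \<phi> (of_int v)" using c uv by simp
  hence "of_int u * \<phi> c = of_int v" by (simp only: hom_mult hom_of_int)
  thus ?thesis unfolding \<kappa> using nz by (simp add: of_rat_divide field_simps)
qed

section \<open>Truncated exponentials\<close>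

context subring_congruence
begin

text \<open>Differentiation shifts the sum by one place, so the only defect is the missing last term
  \<open>(p * y)^d / fact d\<close>. Integrality of the \<open>p^r / fact r\<close> and divisibility
  of the last one hold in the p-adic integers and are carried into the field by
  \<open>\<phi>\<close>.\<close>

lemma exp_poly_congruence:
  fixes \<phi> :: "'p :: prime_card padic_int \<Rightarrow> 'f"
  assumes hom: "comm_ring_hom \<phi>" and \<phi>: "\<And>c. \<phi> c \<in> S" and p: "CARD('p) > 2"
    and q: "q = of_nat CARD('p) ^ s" and y: "y \<in> S"
  shows "exp_poly CARD('p) s (of_nat CARD('p) * y) \<in> S"
    and "derivation D \<Longrightarrow> D y \<in> S \<Longrightarrow> D (exp_poly CARD('p) s (of_nat CARD('p) * y)) \<approx>
      of_nat CARD('p) * D y * exp_poly CARD('p) s (of_nat CARD('p) * y)"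
proof -
  interpret comm_ring_hom \<phi> by (rule hom)
  let ?p = "of_nat CARD('p) :: 'f" let ?d = "exp_deg CARD('p) s"
  have hom_fact: "\<phi> (fact r) = fact r" for r
    using hom_of_nat[of "fact r"] by simp
  have p_S: "?p \<in> S" using \<phi>[of "of_nat CARD('p)"] by (simp only: hom_of_nat)
  have "(?p * y) ^ r / fact r \<in> S" for r
  proof -
    obtain c :: "'p padic_int" where "of_nat CARD('p) ^ r = fact r * c"
      using padic_int_power_dvd_fact by blast
    hence "\<phi> (of_nat CARD('p) ^ r) = \<phi> (fact r * c)" by simp
    hence "?p ^ r = fact r * \<phi> c" by (simp only: hom_power hom_of_nat hom_mult hom_fact)
    hence "(?p * y) ^ r / fact r = \<phi> c * y ^ r" by (simp add: power_mult_distrib)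
    thus ?thesis using \<phi> y by (simp add: S_mult S_power)
  qed
  thus "exp_poly CARD('p) s (?p * y) \<in> S"
    unfolding exp_poly_def by (intro S_sum)
  assume D: "derivation D" and Dy: "D y \<in> S"
  interpret D: derivation D by (rule D)
  have Dpy: "D (?p * y) = ?p * D y" by (simp add: D.mult)
  have "D ((?p * y) ^ r / fact r) = (if r = 0 then 0 else ?p * D y * ((?p * y) ^ (r - 1) / fact (r - 1)))" for r
  proof -
    have "D ((?p * y) ^ r / fact r) = of_nat r * (?p * y) ^ (r - 1) * (?p * D y) / fact r"
      by (simp only: derivation_divide_fact[OF D] D.power Dpy)
    thus ?thesis by (cases r) (simp_all add: fact_Suc divide_simps del: of_nat_Suc)
  qed
  hence "D (exp_poly CARD('p) s (?p * y)) =
      (\<Sum>r=0..?d. if r = 0 then 0 else ?p * D y * ((?p * y) ^ (r - 1) / fact (r - 1)))"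
    unfolding exp_poly_def D.sum by simp
  also have "\<dots> = (\<Sum>r=1..?d. ?p * D y * ((?p * y) ^ (r - 1) / fact (r - 1)))"
    by (subst sum.atLeast_Suc_atMost) (auto intro!: sum.cong)
  also have "\<dots> = (\<Sum>r<?d. ?p * D y * ((?p * y) ^ r / fact r))"
    by (rule sum.reindex_bij_witness[where i = Suc and j = "\<lambda>r. r - 1"]) auto
  also have "\<dots> = ?p * D y * (exp_poly CARD('p) s (?p * y) - (?p * y) ^ ?d / fact ?d)"
    unfolding exp_poly_def atLeast0AtMost lessThan_Suc_atMost[symmetric]
    by (simp add: sum_distrib_left)
  finally have eq: "D (exp_poly CARD('p) s (?p * y)) - ?p * D y * exp_poly CARD('p) s (?p * y) =
      - (?p * D y * ((?p * y) ^ ?d / fact ?d))"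
    by (simp add: algebra_simps)
  obtain c :: "'p padic_int" where
    "of_nat CARD('p) ^ ?d = of_nat CARD('p) ^ s * (fact ?d * c)"
    using padic_int_power_exp_deg[OF p] by blast
  hence "\<phi> (of_nat CARD('p) ^ ?d) = \<phi> (of_nat CARD('p) ^ s * (fact ?d * c))" by simp
  hence "?p ^ ?d = q * (fact ?d * \<phi> c)"
    by (simp only: q hom_power hom_of_nat hom_mult hom_fact)
  hence "(?p * y) ^ ?d / fact ?d = q * (\<phi> c * y ^ ?d)" by (simp add: power_mult_distrib)
  hence "- (?p * D y * ((?p * y) ^ ?d / fact ?d)) = q * - (?p * D y * (\<phi> c * y ^ ?d))"
    by simp
  with eq show "D (exp_poly CARD('p) s (?p * y)) \<approx> ?p * D y * exp_poly CARD('p) s (?p * y)"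
    using p_S Dy \<phi> y
    by (intro congrI[of _ _ "- (?p * D y * (\<phi> c * y ^ ?d))"]) (auto intro!: S_uminus S_mult S_power)
qed

end

section \<open>Extraction of coefficients\<close>

text \<open>Taking a coefficient and substituting for \<lambda> make sense for fractions whose
  denominator \<open>r\<close> is a polynomial in z alone: \<open>r\<close> is a scalar with respect
  to t and is unaffected by the substitution. A relation avoids a choice of
  \<open>r\<close>.\<close>

definition has_coeff :: "(nat \<Rightarrow>\<^sub>0 nat) \<Rightarrow> 'p :: prime_card padic_int \<Rightarrow> 'p tzlpoly fract \<Rightarrow> 'p zpoly fract \<Rightarrow> bool" where
  "has_coeff \<alpha> lam x y \<longleftrightarrow> (\<exists>r P. r \<noteq> 0 \<and> x * to_fract (mconst [:r:]) = to_fract P \<and>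
     y * to_fract r = subst_lam lam (Poly_Mapping.lookup P \<alpha>))"

lemma subst_lam_add: "subst_lam lam (P + Q) = subst_lam lam P + subst_lam lam Q"
  and subst_lam_mult: "subst_lam lam (P * Q) = subst_lam lam P * subst_lam lam Q"
  by (simp_all add: subst_lam_def)

lemma subst_lam_pCons_0: "subst_lam lam [:r:] = to_fract r"
  by (simp add: subst_lam_def)

lemma lookup_mconst_mult: "Poly_Mapping.lookup (mconst r * P) \<alpha> = r * Poly_Mapping.lookup P \<alpha>"
  unfolding mconst_def mult_map_scale_conv_mult[symmetric] by (simp add: map.rep_eq when_def)

lemma mconst_eq_0_iff [simp]: "mconst r = 0 \<longleftrightarrow> r = 0"
  unfolding mconst_def by (metis lookup_single_eq lookup_zero single_zero)

lemma mconst_const_mult: "mconst [:a * b:] = mconst [:a:] * mconst [:b:]"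
  by (simp add: mconst_mult[symmetric] mult.commute)

lemma has_coeff_to_fract:
  fixes lam :: "'p :: prime_card padic_int"
  shows "has_coeff \<alpha> lam (to_fract P) (subst_lam lam (Poly_Mapping.lookup P \<alpha>))"
proof -
  have "mconst [:1:] = (1 :: 'p tzlpoly)" by (simp flip: one_pCons)
  thus ?thesis unfolding has_coeff_def by (intro exI[of _ 1] exI[of _ P]) simp
qed

lemma has_coeff_scale:
  assumes "has_coeff \<alpha> lam x y"
  shows "has_coeff \<alpha> lam (to_fract (mconst r) * x) (subst_lam lam r * y)"
proof -
  from assms obtain r' P where "r' \<noteq> 0" "x * to_fract (mconst [:r':]) = to_fract P"
    "y * to_fract r' = subst_lam lam (Poly_Mapping.lookup P \<alpha>)" unfolding has_coeff_def by blast
  thus ?thesis unfolding has_coeff_def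
    by (intro exI[of _ r'] exI[of _ "mconst r * P"])
      (simp add: mult.assoc lookup_mconst_mult subst_lam_mult)
qed

lemma has_coeff_lam_var:
    "has_coeff \<alpha> lam x y \<Longrightarrow> has_coeff \<alpha> lam (lam_var * x) (subst_lam lam [:0, 1:] * y)"
  and has_coeff_z_var:
    "has_coeff \<alpha> lam x y \<Longrightarrow> has_coeff \<alpha> lam (z_var l * x) (subst_lam lam [:mvar l:] * y)"
  unfolding lam_var_def z_var_def by (rule has_coeff_scale, assumption)+

lemma has_coeff_divide:
  assumes "has_coeff \<alpha> lam x y" and r: "r \<noteq> 0"
  shows "has_coeff \<alpha> lam (x / to_fract (mconst [:r:])) (y / to_fract r)"
proof -
  from assms(1) obtain r' P where *: "r' \<noteq> 0" "x * to_fract (mconst [:r':]) = to_fract P"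
    "y * to_fract r' = subst_lam lam (Poly_Mapping.lookup P \<alpha>)" unfolding has_coeff_def by blast
  show ?thesis unfolding has_coeff_def using * r
    by (intro exI[of _ "r * r'"] exI[of _ P]) (simp add: mconst_const_mult del: mult_pCons_left)
qed

lemma has_coeff_add:
  assumes "has_coeff \<alpha> lam x y" "has_coeff \<alpha> lam x' y'"
  shows "has_coeff \<alpha> lam (x + x') (y + y')"
proof -
  from assms(1) obtain r P where 1: "r \<noteq> 0" "x * to_fract (mconst [:r:]) = to_fract P"
    "y * to_fract r = subst_lam lam (Poly_Mapping.lookup P \<alpha>)" unfolding has_coeff_def by blast
  from assms(2) obtain r' P' where 2: "r' \<noteq> 0" "x' * to_fract (mconst [:r':]) = to_fract P'"
    "y' * to_fract r' = subst_lam lam (Poly_Mapping.lookup P' \<alpha>)" unfolding has_coeff_def by blast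
  have c: "to_fract (mconst [:r * r':]) = to_fract (mconst [:r:]) * to_fract (mconst [:r':])"
    by (simp only: mconst_const_mult to_fract_mult)
  have "(x + x') * to_fract (mconst [:r * r':]) = to_fract (mconst [:r':] * P + mconst [:r:] * P')"
    unfolding c to_fract_add to_fract_mult 1(2)[symmetric] 2(2)[symmetric]
    by (simp only: distrib_left distrib_right mult_ac)
  moreover have "(y + y') * to_fract (r * r') =
      subst_lam lam (Poly_Mapping.lookup (mconst [:r':] * P + mconst [:r:] * P') \<alpha>)"
    unfolding lookup_add lookup_mconst_mult subst_lam_add subst_lam_mult subst_lam_pCons_0
      1(3)[symmetric] 2(3)[symmetric] to_fract_mult
    by (simp only: distrib_left distrib_right mult_ac)
  ultimately show ?thesis unfolding has_coeff_def using 1(1) 2(1)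
    by (intro exI[of _ "r * r'"] exI[of _ "mconst [:r':] * P + mconst [:r:] * P'"]) simp
qed

text \<open>The denominator \<open>r\<close> appears as a factor on both sides. As \<lambda> does
  not occur in it, it remains nonzero after the substitution and can be cancelled.\<close>

lemma has_coeff_unique:
  assumes "has_coeff \<alpha> lam (to_fract P) y"
  shows "y = subst_lam lam (Poly_Mapping.lookup P \<alpha>)"
proof -
  from assms obtain r P' where *: "r \<noteq> 0" "to_fract P * to_fract (mconst [:r:]) = to_fract P'"
    "y * to_fract r = subst_lam lam (Poly_Mapping.lookup P' \<alpha>)" unfolding has_coeff_def by blast
  from *(2) have "to_fract (mconst [:r:] * P) = to_fract P'" by (simp add: mult.commute)
  hence "P' = mconst [:r:] * P" by (simp only: to_fract_eq_iff)
  hence "y * to_fract r = to_fract r * subst_lam lam (Poly_Mapping.lookup P \<alpha>)"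
    using *(3) by (simp add: lookup_mconst_mult subst_lam_mult) (simp add: subst_lam_def)
  thus ?thesis using *(1) by simp
qed

lemma has_coeff_zero: "has_coeff \<alpha> lam 0 0"
  using has_coeff_to_fract[of \<alpha> lam 0] by (simp add: subst_lam_def)

lemma has_coeff_sum:
  "(\<And>x. x \<in> A \<Longrightarrow> has_coeff \<alpha> lam (f x) (g x)) \<Longrightarrow> has_coeff \<alpha> lam (\<Sum>x\<in>A. f x) (\<Sum>x\<in>A. g x)"
  by (induction A rule: infinite_finite_induct) (auto simp: has_coeff_zero has_coeff_add)

lemma has_coeff_const:
  "has_coeff \<alpha> lam x y \<Longrightarrow>
     has_coeff \<alpha> lam (to_fract (mconst [:mconst c:]) * x) (to_fract (mconst c) * y)"
  using has_coeff_scale[of \<alpha> lam x y "[:mconst c:]"] by (simp add: subst_lam_def)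

lemma has_coeff_of_int:
  fixes lam :: "'p :: prime_card padic_int"
  assumes "has_coeff \<alpha> lam x y"
  shows "has_coeff \<alpha> lam (of_int i * x) (of_int i * y)"
proof -
  interpret F: comm_ring_hom "\<lambda>c. to_fract (mconst [:mconst c:]) :: 'p tzlpoly fract"
    by (rule comm_ring_hom_const_const)
  interpret G: comm_ring_hom "\<lambda>c. to_fract (mconst c) :: 'p zpoly fract"
    by (rule comm_ring_hom_const)
  show ?thesis using has_coeff_const[OF assms, of "of_int i"] by (simp only: F.hom_of_int G.hom_of_int)
qed

lemma has_coeff_of_nat: "has_coeff \<alpha> lam x y \<Longrightarrow> has_coeff \<alpha> lam (of_nat i * x) (of_nat i * y)"
  using has_coeff_of_int[of \<alpha> lam x y "int i"] by simp

lemma has_coeff_diff: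
  "has_coeff \<alpha> lam x y \<Longrightarrow> has_coeff \<alpha> lam x' y' \<Longrightarrow> has_coeff \<alpha> lam (x - x') (y - y')"
  using has_coeff_add[of \<alpha> lam x y "- x'" "- y'"] has_coeff_of_int[of \<alpha> lam x' y' "-1"] by simp

lemma has_coeff_half:
  fixes lam :: "'p :: prime_card padic_int"
  assumes "has_coeff \<alpha> lam x y"
  shows "has_coeff \<alpha> lam (x / 2) (y / 2)"
proof -
  interpret F: comm_ring_hom "\<lambda>c. to_fract (mconst c) :: 'p tzlpoly fract"
    by (rule comm_ring_hom_const)
  have "[:2:] = (2 :: 'p zlpoly)" by (simp add: numeral_poly)
  hence "to_fract (mconst [:2:]) = (2 :: 'p tzlpoly fract)"
    using F.hom_numeral by simp
  moreover have "to_fract 2 = (2 :: 'p zpoly fract)"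
    using of_nat_fract[of 2, where 'a = "'p zpoly"] by simp
  ultimately show ?thesis using has_coeff_divide[OF assms, of 2] by simp
qed

lemma has_coeff_act:
  "(\<And>J. has_coeff \<alpha> lam (u J) (v J)) \<Longrightarrow> has_coeff \<alpha> lam (act m x i u J) (act m x i v J)"
  unfolding act_def by (intro has_coeff_sum has_coeff_of_int)

lemma has_coeff_Omega:
  assumes "\<And>J. has_coeff \<alpha> lam (u J) (v J)"
  shows "has_coeff \<alpha> lam (Omega m i j u J) (Omega m i j v J)"
  unfolding Omega_def using has_coeff_half[OF has_coeff_act[OF has_coeff_act[OF assms]]]
  by (intro has_coeff_add has_coeff_act assms) simp

section \<open>The exponential factor under an arbitrary derivation\<close>

context subring_congruence
begin

lemma exp_prod_congruence:
  fixes \<phi> :: "'p :: prime_card padic_int \<Rightarrow> 'f"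
  assumes hom: "comm_ring_hom \<phi>" and \<phi>: "\<And>c. \<phi> c \<in> S" and p: "CARD('p) > 2"
    and q: "q = of_nat CARD('p) ^ s"
    and y: "\<And>x. x \<in> A \<Longrightarrow> y x \<in> S"
  shows "(\<Prod>x\<in>A. exp_poly CARD('p) s (of_nat CARD('p) * y x)) \<in> S"
    and "derivation D \<Longrightarrow> (\<And>x. x \<in> A \<Longrightarrow> D (y x) \<in> S) \<Longrightarrow>
      D (\<Prod>x\<in>A. exp_poly CARD('p) s (of_nat CARD('p) * y x)) \<approx>
      (\<Sum>x\<in>A. of_nat CARD('p) * D (y x)) * (\<Prod>x\<in>A. exp_poly CARD('p) s (of_nat CARD('p) * y x))"
  by (intro S_prod congr_derivation_prod exp_poly_congruence[OF hom \<phi> p q y]; assumption)+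

text \<open>\<open>D\<close> may move \<open>t\<close>, \<open>z\<close> and \<open>lam\<close> at
  once, so that one statement serves the derivatives in all three kinds of variables. That
  \<open>h / 2\<close> comes from a p-adic integer keeps the arguments of the exponentials in
  \<open>S\<close>.\<close>

lemma exp_factor_congruence:
  fixes \<phi> :: "'p :: prime_card padic_int \<Rightarrow> 'f"
  assumes hom: "comm_ring_hom \<phi>" and \<phi>: "\<And>c. \<phi> c \<in> S" and p: "CARD('p) > 2"
    and q: "q = of_nat CARD('p) ^ s"
    and t: "\<And>a. a \<in> {1..k} \<Longrightarrow> t a \<in> S" and z: "\<And>l. l \<in> {1..n} \<Longrightarrow> z l \<in> S"
    and lam: "lam \<in> S" and h: "h = \<phi> c" and h2: "h / 2 = \<phi> c2"
    and E: "E = (\<Prod>l=1..n. exp_poly CARD('p) s (of_nat CARD('p) * (of_nat (m l) * z l * lam * (h / 2)))) *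
      (\<Prod>a=1..k. exp_poly CARD('p) s (of_nat CARD('p) * - (t a * lam * h)))"
  shows "E \<in> S"
    and "derivation D \<Longrightarrow> (\<And>a. a \<in> {1..k} \<Longrightarrow> D (t a) \<in> S) \<Longrightarrow> (\<And>l. l \<in> {1..n} \<Longrightarrow> D (z l) \<in> S) \<Longrightarrow>
      D lam \<in> S \<Longrightarrow> (\<And>c. D (\<phi> c) = 0) \<Longrightarrow>
      D E \<approx> ((\<Sum>l=1..n. of_nat CARD('p) * (of_nat (m l) * (D (z l) * lam + z l * D lam) * (h / 2)))
        + (\<Sum>a=1..k. of_nat CARD('p) * - ((D (t a) * lam + t a * D lam) * h))) * E"
proof -
  interpret comm_ring_hom \<phi> by (rule hom)
  have nat: "of_nat N \<in> S" for N using \<phi>[of "of_nat N"] by (simp only: hom_of_nat)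
  have hS: "h \<in> S" "h / 2 \<in> S" unfolding h h2[unfolded h] by (rule \<phi>)+
  let ?y = "\<lambda>l. of_nat (m l) * z l * lam * (h / 2)" and ?w = "\<lambda>a. - (t a * lam * h)"
  have y: "l \<in> {1..n} \<Longrightarrow> ?y l \<in> S" for l by (intro S_mult nat z lam hS)
  have w: "a \<in> {1..k} \<Longrightarrow> ?w a \<in> S" for a by (intro S_uminus S_mult t lam hS)
  let ?E1 = "\<Prod>l=1..n. exp_poly CARD('p) s (of_nat CARD('p) * ?y l)"
  let ?E2 = "\<Prod>a=1..k. exp_poly CARD('p) s (of_nat CARD('p) * ?w a)"
  have E1: "?E1 \<in> S" by (rule exp_prod_congruence(1)[OF hom \<phi> p q]) (rule y)
  have E2: "?E2 \<in> S" by (rule exp_prod_congruence(1)[OF hom \<phi> p q]) (rule w)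
  show "E \<in> S" unfolding E by (intro S_mult E1 E2)
  assume D: "derivation D" and Dt: "\<And>a. a \<in> {1..k} \<Longrightarrow> D (t a) \<in> S"
    and Dz: "\<And>l. l \<in> {1..n} \<Longrightarrow> D (z l) \<in> S" and Dlam: "D lam \<in> S" and D\<phi>: "\<And>c. D (\<phi> c) = 0"
  interpret D: derivation D by (rule D)
  have Dh: "D h = 0" "D (h / 2) = 0" unfolding h h2[unfolded h] by (rule D\<phi>)+
  have Dy: "D (?y l) = of_nat (m l) * (D (z l) * lam + z l * D lam) * (h / 2)" for l
    by (simp only: D.mult D.of_nat Dh) (simp add: algebra_simps)
  have Dw: "D (?w a) = - ((D (t a) * lam + t a * D lam) * h)" for a
    by (simp only: D.minus D.mult Dh) (simp add: algebra_simps)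
  have regroup: "b * (x * a) + a * (y * b) = (x + y) * (a * b)" for a b x y :: 'f
    by (simp add: algebra_simps)
  have "D ?E1 \<approx> (\<Sum>l=1..n. of_nat CARD('p) * D (?y l)) * ?E1"
  proof (rule exp_prod_congruence(2)[OF hom \<phi> p q _ D])
    show "D (?y l) \<in> S" if "l \<in> {1..n}" for l
      unfolding Dy using that by (intro S_mult S_add nat hS z lam Dz Dlam)
  qed (rule y)
  moreover have "D ?E2 \<approx> (\<Sum>a=1..k. of_nat CARD('p) * D (?w a)) * ?E2"
  proof (rule exp_prod_congruence(2)[OF hom \<phi> p q _ D])
    show "D (?w a) \<in> S" if "a \<in> {1..k}" for a
      unfolding Dw using that by (intro S_uminus S_mult S_add nat hS t lam Dt Dlam)
  qed (rule w)
  ultimately have "?E2 * D ?E1 + ?E1 * D ?E2 \<approx>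
      ?E2 * ((\<Sum>l=1..n. of_nat CARD('p) * D (?y l)) * ?E1)
      + ?E1 * ((\<Sum>a=1..k. of_nat CARD('p) * D (?w a)) * ?E2)"
    by (intro congr_add congr_mult E1 E2)
  moreover have "D E = ?E2 * D ?E1 + ?E1 * D ?E2"
    unfolding E D.mult by (simp only: mult.commute add.commute)
  moreover have "?E2 * ((\<Sum>l=1..n. of_nat CARD('p) * D (?y l)) * ?E1)
      + ?E1 * ((\<Sum>a=1..k. of_nat CARD('p) * D (?w a)) * ?E2) =
      ((\<Sum>l=1..n. of_nat CARD('p) * D (?y l)) + (\<Sum>a=1..k. of_nat CARD('p) * D (?w a))) * E"
    unfolding E by (rule regroup)
  ultimately show "D E \<approx> ((\<Sum>l=1..n. of_nat CARD('p) * (of_nat (m l) * (D (z l) * lam + z l * D lam) * (h / 2)))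
        + (\<Sum>a=1..k. of_nat CARD('p) * - ((D (t a) * lam + t a * D lam) * h))) * E"
    by (simp only: Dy Dw)
qed

end

section \<open>Polynomials with coefficients in R, and negligible coefficients\<close>

lemma is_subring_ring_R: "is_subring (ring_R n :: 'p :: prime_card zpoly fract set)"
proof -
  have one: "1 \<in> (ring_R n :: 'p zpoly fract set)"
    using ring_R.const[of 1 n] by simp
  have "to_fract (mconst (- 1)) = (- 1 :: 'p zpoly fract)"
  proof -
    interpret comm_ring_hom "\<lambda>c. to_fract (mconst c) :: 'p zpoly fract" by (rule comm_ring_hom_const)
    show ?thesis by (simp only: hom_uminus hom_one)
  qed
  hence m1: "- 1 \<in> (ring_R n :: 'p zpoly fract set)"
    using ring_R.const[of "- 1" n] by metis
  have "- x \<in> ring_R n" if "x \<in> ring_R n" for x :: "'p zpoly fract"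
    using ring_R.mult[OF m1 that] by simp
  thus ?thesis unfolding is_subring_def using one ring_R.add ring_R.mult by blast
qed

text \<open>The coefficient polynomials may involve infinitely many variables z. Requiring each
  coefficient to lie in R as a rational function ensures that extraction of a coefficient and
  substitution for \<lambda> end in R.\<close>

definition poly_ring :: "nat \<Rightarrow> 'p :: prime_card tzlpoly set" where
  "poly_ring n = {P. \<forall>\<alpha>. Poly_Mapping.lookup P \<alpha> \<in> {r. \<forall>j. poly.coeff r j \<in> {x. to_fract x \<in> ring_R n}}}"

lemma is_subring_poly_ring: "is_subring (poly_ring n :: 'p :: prime_card tzlpoly set)"
  unfolding poly_ring_def
  by (intro is_subring_poly_mappings is_subring_polys)
    (use is_subring_ring_R[of n, where 'p = 'p] in \<open>auto simp: is_subring_def\<close>)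

lemma mconst_in_poly_ring:
  "(\<And>j. to_fract (poly.coeff r j) \<in> ring_R n) \<Longrightarrow> mconst r \<in> poly_ring n"
  using is_subring_zero[OF is_subring_ring_R]
  by (auto simp: poly_ring_def mconst_def lookup_single when_def)

lemma
  shows mvar_in_poly_ring: "mvar a \<in> poly_ring n"
    and z_in_poly_ring: "l \<in> {1..n} \<Longrightarrow> mconst [:mvar l:] \<in> poly_ring n"
    and lam_in_poly_ring: "mconst [:0, 1:] \<in> poly_ring n"
    and const_in_poly_ring: "mconst [:mconst c:] \<in> poly_ring n"
  using is_subring_zero[OF is_subring_ring_R, of n] is_subring_ring_R[of n] ring_R.var[of l n] ring_R.const[of c n]
  by (auto intro!: mconst_in_poly_ring simp: coeff_pCons split: nat.split)
    (auto simp: poly_ring_def mvar_def lookup_single when_def is_subring_def)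

lemma subst_lam_in_ring_R:
  assumes "P \<in> poly_ring n"
  shows "subst_lam lam (Poly_Mapping.lookup P \<alpha>) \<in> ring_R n"
proof -
  let ?r = "Poly_Mapping.lookup P \<alpha>"
  have pow: "to_fract (mconst lam ^ i) \<in> ring_R n" for i
    using is_subring_ring_R[of n] ring_R.const[of lam n]
    by (induction i) (auto simp: is_subring_def)
  have "subst_lam lam ?r = (\<Sum>i\<le>degree ?r. to_fract (poly.coeff ?r i) * to_fract (mconst lam ^ i))"
    by (simp add: subst_lam_def poly_altdef)
  also have "\<dots> \<in> ring_R n"
    using assms pow by (intro is_subring_sum[OF is_subring_ring_R] ring_R.mult) (auto simp: poly_ring_def)
  finally show ?thesis .
qed

lemma p_power_R_add: "x \<in> p_power_R s n \<Longrightarrow> y \<in> p_power_R s n \<Longrightarrow> x + y \<in> p_power_R s n"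
  unfolding p_power_R_def using ring_R.add by (auto simp: distrib_left[symmetric])

lemma p_power_R_mult: "r \<in> ring_R n \<Longrightarrow> x \<in> p_power_R s n \<Longrightarrow> r * x \<in> p_power_R s n"
  unfolding p_power_R_def using ring_R.mult by (auto simp: mult.left_commute)

lemma p_power_R_intro: "r \<in> ring_R n \<Longrightarrow> of_nat CARD('p) ^ s * r \<in> (p_power_R s n :: 'p :: prime_card zpoly fract set)"
  unfolding p_power_R_def by blast

text \<open>The two parts of a defect have this additive property for different reasons: one is a
  multiple of the prime power, the other a sum of derivatives in t.\<close>

definition negligible :: "nat \<Rightarrow> nat \<Rightarrow> (nat \<Rightarrow>\<^sub>0 nat) \<Rightarrow> 'p :: prime_card padic_int \<Rightarrow> 'p tzlpoly fract \<Rightarrow> bool" where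
  "negligible n s \<alpha> lam x \<longleftrightarrow>
     (\<exists>P. x = to_fract P \<and> subst_lam lam (Poly_Mapping.lookup P \<alpha>) \<in> p_power_R s n)"

lemma negligible_add:
  "negligible n s \<alpha> lam x \<Longrightarrow> negligible n s \<alpha> lam y \<Longrightarrow> negligible n s \<alpha> lam (x + y)"
  unfolding negligible_def
proof (elim exE conjE)
  fix P Q
  assume "x = to_fract P" "subst_lam lam (Poly_Mapping.lookup P \<alpha>) \<in> p_power_R s n"
    "y = to_fract Q" "subst_lam lam (Poly_Mapping.lookup Q \<alpha>) \<in> p_power_R s n"
  thus "\<exists>P. x + y = to_fract P \<and> subst_lam lam (Poly_Mapping.lookup P \<alpha>) \<in> p_power_R s n"
    by (intro exI[of _ "P + Q"]) (simp add: lookup_add subst_lam_add p_power_R_add)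
qed

lemma subst_lam_of_nat: "subst_lam lam (of_nat N) = of_nat N"
  by (simp add: subst_lam_def of_nat_fract)

lemma subst_lam_zero: "subst_lam lam 0 = 0"
  by (simp add: subst_lam_def)

lemma negligible_zero: "negligible n s \<alpha> lam 0"
proof -
  have "0 \<in> p_power_R s n"
    using p_power_R_intro[OF is_subring_zero[OF is_subring_ring_R]] by simp
  thus ?thesis unfolding negligible_def by (intro exI[of _ 0]) (simp add: subst_lam_zero)
qed

lemma negligible_uminus:
  fixes lam :: "'p :: prime_card padic_int"
  assumes "negligible n s \<alpha> lam x"
  shows "negligible n s \<alpha> lam (- x)"
proof -
  obtain P where P: "x = to_fract P" "subst_lam lam (Poly_Mapping.lookup P \<alpha>) \<in> p_power_R s n"
    using assms unfolding negligible_def by blast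
  have "- 1 \<in> (ring_R n :: 'p zpoly fract set)"
    using is_subring_ring_R unfolding is_subring_def by blast
  from p_power_R_mult[OF this P(2)] have "subst_lam lam (Poly_Mapping.lookup (- P) \<alpha>) \<in> p_power_R s n"
    by (simp add: subst_lam_def)
  thus ?thesis unfolding negligible_def using P(1) by (intro exI[of _ "- P"]) simp
qed

lemma negligible_sum:
  "(\<And>x. x \<in> A \<Longrightarrow> negligible n s \<alpha> lam (g x)) \<Longrightarrow> negligible n s \<alpha> lam (\<Sum>x\<in>A. g x)"
  by (induction A rule: infinite_finite_induct) (auto simp: negligible_zero negligible_add)

lemma negligible_power:
  fixes lam :: "'p :: prime_card padic_int"
  assumes "x \<in> (*) (of_nat CARD('p) ^ s) ` to_fract ` poly_ring n"
  shows "negligible n s \<alpha> lam x"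
proof -
  obtain P where P: "P \<in> poly_ring n" "x = of_nat CARD('p) ^ s * to_fract P" using assms by blast
  have "x = to_fract (mconst (of_nat (CARD('p) ^ s)) * P)"
  proof -
    interpret comm_ring_hom "\<lambda>c. to_fract (mconst c) :: 'p tzlpoly fract" by (rule comm_ring_hom_const)
    show ?thesis unfolding P(2) to_fract_mult hom_of_nat by simp
  qed
  moreover have "subst_lam lam (Poly_Mapping.lookup (mconst (of_nat (CARD('p) ^ s)) * P) \<alpha>) =
      of_nat CARD('p) ^ s * subst_lam lam (Poly_Mapping.lookup P \<alpha>)"
    unfolding lookup_mconst_mult subst_lam_mult subst_lam_of_nat by simp
  ultimately show ?thesis unfolding negligible_def
    using p_power_R_intro[OF subst_lam_in_ring_R[OF P(1)]] by metis
qed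

text \<open>Integration by parts: the exponent of \<open>t\<^sub>a\<close> in the extracted monomial is one less than a
  multiple of \<open>p\<^sup>s\<close>.\<close>

lemma negligible_deriv:
  fixes lam :: "'p :: prime_card padic_int"
  assumes x: "x \<in> to_fract ` poly_ring n"
    and \<alpha>: "Poly_Mapping.lookup \<alpha> a + 1 = N * CARD('p) ^ s"
  shows "negligible n s \<alpha> lam (fract_deriv (mderiv a) x)"
proof -
  obtain P where P: "P \<in> poly_ring n" "x = to_fract P" using x by blast
  let ?y = "subst_lam lam (Poly_Mapping.lookup P (\<alpha> + Poly_Mapping.single a 1))"
  have "subst_lam lam (Poly_Mapping.lookup (mderiv a P) \<alpha>) = of_nat (N * CARD('p) ^ s) * ?y"
    unfolding lookup_mderiv \<alpha> subst_lam_mult subst_lam_of_nat ..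
  also have "\<dots> = of_nat CARD('p) ^ s * (subst_lam lam (of_nat N) * ?y)"
    by (simp add: subst_lam_of_nat)
  also have "\<dots> = of_nat CARD('p) ^ s * subst_lam lam (Poly_Mapping.lookup (mconst (of_nat N) * P) (\<alpha> + Poly_Mapping.single a 1))"
    unfolding lookup_mconst_mult subst_lam_mult ..
  also have "\<dots> \<in> p_power_R s n"
  proof (rule p_power_R_intro[OF subst_lam_in_ring_R])
    have "mconst (of_nat N) = mconst [:mconst (of_nat N :: 'p padic_int):]"
      by (simp add: of_nat_poly mconst_def of_nat_single flip: single_of_nat)
    thus "mconst (of_nat N) * P \<in> poly_ring n"
      using is_subring_poly_ring[of n] P(1) const_in_poly_ring by (metis is_subring_def)
  qed
  finally show ?thesis unfolding negligible_def P(2) fract_deriv_to_fract[OF derivation_mderiv] by blast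
qed

lemma has_coeff_negligible:
  assumes "has_coeff \<alpha> lam x y" "negligible n s \<alpha> lam x"
  shows "y \<in> p_power_R s n"
  using assms has_coeff_unique unfolding negligible_def by metis

section \<open>Derivatives in t, z and \<lambda> on the field of rational functions\<close>

definition deriv_t where "deriv_t a = fract_deriv (mderiv a :: 'p :: prime_card tzlpoly \<Rightarrow> _)"
definition deriv_z where "deriv_z i = fract_deriv (Poly_Mapping.map (map_poly (mderiv i)) :: 'p :: prime_card tzlpoly \<Rightarrow> _)"
definition deriv_lam where "deriv_lam = fract_deriv (Poly_Mapping.map pderiv :: 'p :: prime_card tzlpoly \<Rightarrow> _)"

lemmas d_z = derivation_map_poly_mapping[OF derivation_map_poly[OF derivation_mderiv]]
lemmas d_lam = derivation_map_poly_mapping[OF derivation_pderiv]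

lemma derivations:
  "derivation (deriv_t a)" "derivation (deriv_z i)" "derivation deriv_lam"
  unfolding deriv_t_def deriv_z_def deriv_lam_def
  by (intro derivation_fract_deriv derivation_mderiv d_z d_lam)+

lemma mderiv_mconst [simp]: "mderiv i (mconst c) = 0"
  by (simp add: mconst_def mderiv_single)

lemma mderiv_mvar: "mderiv i (mvar l) = (if l = i then 1 else 0)"
  by (simp add: mvar_def mderiv_single lookup_single when_def)

lemma deriv_t_values:
  "deriv_t a (t_var b) = (if b = a then 1 else 0)" "deriv_t a (z_var l) = 0"
  "deriv_t a lam_var = 0" "deriv_t a (to_fract (mconst c)) = 0"
  by (simp_all add: deriv_t_def t_var_def z_var_def lam_var_def mderiv_mvar
      fract_deriv_to_fract[OF derivation_mderiv])

lemma deriv_z_values: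
  "deriv_z i (t_var b) = (0 :: 'p :: prime_card tzlpoly fract)"
  "deriv_z i (z_var l) = (if l = i then 1 else 0 :: 'p tzlpoly fract)"
  "deriv_z i lam_var = (0 :: 'p tzlpoly fract)"
  "deriv_z i (to_fract (mconst [:mconst c:])) = (0 :: 'p tzlpoly fract)"
proof -
  interpret derivation "mderiv i :: 'p zpoly \<Rightarrow> _" by (rule derivation_mderiv)
  interpret P: derivation "map_poly (mderiv i) :: 'p zlpoly \<Rightarrow> _"
    by (rule derivation_map_poly[OF derivation_mderiv])
  have mp: "map_poly (mderiv i) [:x:] = [:mderiv i x:]" for x :: "'p zpoly"
    by (rule poly_eqI) (simp add: coeff_map_poly coeff_pCons split: nat.split)
  note map = map_derivation_single[OF derivation_map_poly[OF derivation_mderiv]]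
  show "deriv_z i (t_var b :: 'p tzlpoly fract) = 0"
    "deriv_z i (z_var l :: 'p tzlpoly fract) = (if l = i then 1 else 0)"
    "deriv_z i (lam_var :: 'p tzlpoly fract) = 0"
    "deriv_z i (to_fract (mconst [:mconst c:]) :: 'p tzlpoly fract) = 0"
    unfolding deriv_z_def t_var_def z_var_def lam_var_def fract_deriv_to_fract[OF d_z]
      mvar_def[of b] mconst_def[of "[:_:]"] mconst_def[of "[:0, 1:]"] map
    by (simp_all add: mp mderiv_mvar one_pCons[symmetric] map_poly_pCons)
qed

lemma deriv_lam_values:
  "deriv_lam (t_var b) = 0" "deriv_lam (z_var l) = 0"
  "deriv_lam lam_var = 1" "deriv_lam (to_fract (mconst [:r:])) = 0"
  unfolding deriv_lam_def t_var_def z_var_def lam_var_def fract_deriv_to_fract[OF d_lam]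
    mvar_def[of b] mconst_def map_derivation_single[OF derivation_pderiv]
  by (simp_all add: pderiv_pCons flip: one_pCons)

text \<open>Equal elements have equal derivatives, but for two different variables a suitable
  derivation takes the value 1 on one and 0 on the other.\<close>

lemma variables_distinct:
  "a \<noteq> b \<Longrightarrow> t_var a \<noteq> (t_var b :: 'p :: prime_card tzlpoly fract)"
  "i \<noteq> j \<Longrightarrow> z_var i \<noteq> (z_var j :: 'p tzlpoly fract)"
  "t_var a \<noteq> (z_var l :: 'p tzlpoly fract)"
proof -
  show "t_var a \<noteq> (t_var b :: 'p tzlpoly fract)" if "a \<noteq> b"
  proof
    assume "t_var a = (t_var b :: 'p tzlpoly fract)"
    hence "deriv_t a (t_var a) = deriv_t a (t_var b :: 'p tzlpoly fract)" by simp
    thus False using that by (simp add: deriv_t_values)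
  qed
  show "z_var i \<noteq> (z_var j :: 'p tzlpoly fract)" if "i \<noteq> j"
  proof
    assume "z_var i = (z_var j :: 'p tzlpoly fract)"
    hence "deriv_z i (z_var i) = deriv_z i (z_var j :: 'p tzlpoly fract)" by simp
    thus False using that by (simp add: deriv_z_values)
  qed
  show "t_var a \<noteq> (z_var l :: 'p tzlpoly fract)"
  proof
    assume "t_var a = (z_var l :: 'p tzlpoly fract)"
    hence "deriv_t a (t_var a) = deriv_t a (z_var l :: 'p tzlpoly fract)" by simp
    thus False by (simp add: deriv_t_values)
  qed
qed

text \<open>Polynomiality of \<open>Psi\<close> belongs to the claim, because it is what gives the
  definite description in \<open>I_vec\<close> its intended value.\<close>

theorem theorem2p5:
  fixes k n s :: nat and m :: "nat \<Rightarrow> nat" and \<kappa> :: rat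
    and M :: "nat \<Rightarrow> nat" and M2 :: "nat \<Rightarrow> nat \<Rightarrow> nat" and M0 :: nat
  assumes "k \<ge> 1" and "n \<ge> 1" and "s \<ge> 1"
    and "\<forall>l\<in>{1..n}. m l > 0"
    and "\<kappa> \<noteq> 0"
    and "CARD('p :: prime_card) > 2"
    and "\<not> int CARD('p) dvd fst (quotient_of \<kappa>)"
    and "\<forall>l\<in>{1..n}. M l > 0 \<and> rat_cong TYPE('p) s (of_nat (M l)) (- of_nat (m l) / \<kappa>)"
    and "\<forall>j\<in>{1..n}. \<forall>i\<in>{1..<j}. M2 i j > 0 \<and>
           rat_cong TYPE('p) s (of_nat (M2 i j)) (of_nat (m i) * of_nat (m j) / (2 * \<kappa>))"
    and "M0 > 0 \<and> rat_cong TYPE('p) s (of_nat M0) (2 / \<kappa>)"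
  shows "(\<forall>J\<in>multi_indices n m k. \<exists>P :: 'p tzlpoly. to_fract P = Psi s n k m \<kappa> M M2 M0 J) \<and>
    (\<forall>ell :: nat \<Rightarrow> nat. (\<forall>i\<in>{1..k}. ell i > 0) \<longrightarrow>
       (\<forall>lam :: 'p padic_int.
          KZ_solution_mod s n k m \<kappa> lam (I_vec s n k m \<kappa> M M2 M0 ell)) \<and>
       (\<forall>lam :: 'p padic_int. lam dvd 1 \<longrightarrow>
          dynamical_solution_mod s n k m \<kappa> lam (I_vec s n k m \<kappa> M M2 M0 ell)))"
proof -
  let ?p = "of_nat CARD('p) :: 'p tzlpoly fract"
  let ?c = "\<lambda>c. to_fract (mconst [:mconst c:]) :: 'p tzlpoly fract"
  define S where "S = to_fract ` (poly_ring n :: 'p tzlpoly set)"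
  define q where "q = ?p ^ s"
  interpret C: comm_ring_hom ?c by (rule comm_ring_hom_const_const)
  interpret G: comm_ring_hom "\<lambda>c. to_fract (mconst c) :: 'p zpoly fract" by (rule comm_ring_hom_const)
  interpret R: subring_congruence S q
  proof
    note ring = is_subring_poly_ring[of n, where 'p = 'p, unfolded is_subring_def]
    show "1 \<in> S" unfolding S_def using ring by (metis imageI to_fract_1)
    fix x assume "x \<in> S"
    then obtain P where P: "P \<in> poly_ring n" "x = to_fract P" unfolding S_def by blast
    show "- x \<in> S" unfolding S_def P(2) using ring P(1) by (metis imageI to_fract_uminus)
    fix y assume "y \<in> S"
    then obtain Q where Q: "Q \<in> poly_ring n" "y = to_fract Q" unfolding S_def by blast
    show "x + y \<in> S" unfolding S_def P(2) Q(2) using ring P(1) Q(1) by (metis imageI to_fract_add)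
    show "x * y \<in> S" unfolding S_def P(2) Q(2) using ring P(1) Q(1) by (metis imageI to_fract_mult)
  qed
  write R.congr (infix "\<approx>" 50)
  have tS: "t_var a \<in> S" for a
    unfolding S_def t_var_def by (intro imageI mvar_in_poly_ring)
  have zS: "z_var l \<in> S" if "l \<in> {1..n}" for l
    unfolding S_def z_var_def using that by (intro imageI z_in_poly_ring)
  have lamS: "lam_var \<in> S"
    unfolding S_def lam_var_def by (intro imageI lam_in_poly_ring)
  have cS: "?c c \<in> S" for c
    unfolding S_def by (intro imageI const_in_poly_ring)
  have zeroS: "0 \<in> S" "1 \<in> S" by (rule R.S_zero, rule R.S_one)

  \<comment> \<open>\<open>d\<close> inverts the numerator of \<kappa>, so \<open>hc\<close> below
    is \<open>1 / \<kappa>\<close> as a p-adic integer; \<open>d2\<close> is one half, available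
    because p > 2.\<close>
  obtain d where d: "of_int (fst (quotient_of \<kappa>)) * d = (1 :: 'p padic_int)"
    using padic_int_unit[OF assms(7)] by blast
  define hc where "hc = d * of_int (snd (quotient_of \<kappa>))"
  have hc: "of_int (fst (quotient_of \<kappa>)) * hc = of_int (snd (quotient_of \<kappa>))"
    unfolding hc_def mult.assoc[symmetric] d by simp
  have "\<not> int CARD('p) dvd 2" using assms(6) by (auto dest: zdvd_imp_le)
  then obtain d2 where d2: "of_int 2 * d2 = (1 :: 'p padic_int)"
    using padic_int_unit by blast
  define h where "h = ?c hc"
  have h: "1 / of_rat \<kappa> = h" unfolding h_def
    by (rule inverse_of_rat_hom[OF comm_ring_hom_const_const assms(5) hc])
  \<comment> \<open>The same p-adic integer represents \<open>1 / \<kappa>\<close> in the field of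
    rational functions in z, where the equations are stated, and in the larger field with t and
    \<lambda>, where the congruences are proved.\<close>
  have hG: "1 / of_rat \<kappa> = (to_fract (mconst hc) :: 'p zpoly fract)"
    by (rule inverse_of_rat_hom[OF comm_ring_hom_const assms(5) hc])
  have "?c (of_int 2 * d2) = 1" unfolding d2 by (rule C.hom_one)
  hence "2 * ?c d2 = 1" by (simp only: C.hom_mult of_int_numeral C.hom_numeral)
  hence h2: "h / 2 = ?c (hc * d2)" unfolding h_def C.hom_mult by (simp add: field_simps)

  define E where "E = (\<Prod>l=1..n. exp_poly CARD('p) s (?p * (of_nat (m l) * z_var l * lam_var * (h / 2)))) *
      (\<Prod>a=1..k. exp_poly CARD('p) s (?p * - (t_var a * lam_var * h)))"
  note exp_factor = R.exp_factor_congruence[OF comm_ring_hom_const_const cS assms(6) q_def tS zS lamS h_def h2 E_def]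

  have cong: "of_rat a - of_rat b \<in> (*) q ` S" if ab: "rat_cong TYPE('p) s a b" for a b
    using rat_cong_hom[OF comm_ring_hom_const_const ab] cS unfolding q_def by auto
  have r\<kappa>: "of_rat (x / \<kappa>) = of_rat x * h" for x :: rat
    unfolding h[symmetric] by (simp add: of_rat_divide)
  interpret master_function S q k n m M M2 M0 t_var z_var h E
  proof
    show "E \<in> S" by (rule exp_factor(1))
    show "of_nat (M l) + of_nat (m l) * h \<in> (*) q ` S" if "l \<in> {1..n}" for l
      using cong[of "of_nat (M l)" "- of_nat (m l) / \<kappa>"] assms(8) that
      by (simp add: r\<kappa> of_rat_minus)
    show "of_nat M0 - 2 * h \<in> (*) q ` S"
      using cong[of "of_nat M0" "2 / \<kappa>"] assms(10) by (simp add: r\<kappa>)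
    show "of_nat (M2 i j) - of_nat (m i) * of_nat (m j) * h / 2 \<in> (*) q ` S"
      if "i \<in> {1..n}" "j \<in> {1..n}" "i < j" for i j
    proof -
      have eq: "of_rat (of_nat (m i) * of_nat (m j) / (2 * \<kappa>)) = of_nat (m i) * of_nat (m j) * h / (2 :: 'p tzlpoly fract)"
        unfolding h[symmetric] by (simp add: of_rat_divide of_rat_mult)
      have "rat_cong TYPE('p) s (of_nat (M2 i j)) (of_nat (m i) * of_nat (m j) / (2 * \<kappa>))"
        using assms(9) that by simp
      from cong[OF this] show ?thesis unfolding eq by simp
    qed
  qed (use tS zS variables_distinct[where 'p = 'p] assms(8-10) in auto)

  have Psi: "Psi s n k m \<kappa> M M2 M0 J = U J" for J
  proof (cases "J \<in> multi_indices n m k")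
    case True
    hence "(\<Sum>l=1..n. J l) = k" by (simp add: multi_indices_def)
    hence "weight_fun n k J = (\<Sum>c\<in>colorings k n J. W c)"
      unfolding weight_fun_def W_def by (rule sum_permutations_blocks)
    moreover have "master_poly s n k m \<kappa> M M2 M0 = E * B"
    proof -
      have "of_nat (m l) * z_var l * lam_var / (2 * of_rat \<kappa>) = of_nat (m l) * z_var l * lam_var * (h / (2 :: 'p tzlpoly fract))" for l
        unfolding h[symmetric] by simp
      moreover have "- (?p * (t_var i * lam_var / of_rat \<kappa>)) = ?p * - (t_var i * lam_var * h)" for i
        unfolding h[symmetric] by simp
      ultimately show ?thesis
        unfolding master_poly_def E_def B_def Zf_def Tf_def Xf_def by (simp only: mult.assoc)
    qed
    ultimately show ?thesis using True by (simp add: Psi_def U_def sum_distrib_left mult.assoc)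
  qed (simp add: Psi_def U_def)

  have BW: "B * W c \<in> S" and BV: "B * V c a \<in> S" if "c \<in> colorings k n J" for c a J
    by (rule B_W_S, rule coloring_range[OF that], assumption)
      (rule B_V_S, rule coloring_range[OF that])
  have "U J \<in> S" for J
    unfolding U_def using R.S_zero by (auto intro!: R.S_sum R.S_mult E_S BW)
  hence "\<forall>J. \<exists>P. U J = to_fract P" unfolding S_def by blast
  then obtain P where P: "\<And>J. U J = to_fract (P J)" by metis

  have dt: "deriv_t a E \<approx> - (?p * lam_var * h) * E" if a: "a \<in> {1..k}" for a
  proof -
    have "deriv_t a E \<approx> ((\<Sum>l=1..n. ?p * (of_nat (m l) * (deriv_t a (z_var l) * lam_var + z_var l * deriv_t a lam_var) * (h / 2)))
        + (\<Sum>b=1..k. ?p * - ((deriv_t a (t_var b) * lam_var + t_var b * deriv_t a lam_var) * h))) * E"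
      by (rule exp_factor(2)) (auto simp: derivations deriv_t_values zeroS)
    also have "(\<Sum>l=1..n. ?p * (of_nat (m l) * (deriv_t a (z_var l) * lam_var + z_var l * deriv_t a lam_var) * (h / 2))) = 0"
      by (simp add: deriv_t_values)
    also have "(\<Sum>b=1..k. ?p * - ((deriv_t a (t_var b) * lam_var + t_var b * deriv_t a lam_var) * h)) =
        (\<Sum>b=1..k. if b = a then - (?p * lam_var * h) else 0)"
      by (intro sum.cong refl) (simp add: deriv_t_values)
    also have "\<dots> = - (?p * lam_var * h)" using a by simp
    finally show ?thesis by simp
  qed

  define \<alpha> where "\<alpha> ell = (\<Sum>i=1..k. Poly_Mapping.single i (ell i * CARD('p) ^ s - 1))" for ell :: "nat \<Rightarrow> nat"
  have \<alpha>: "Poly_Mapping.lookup (\<alpha> ell) a + 1 = ell a * CARD('p) ^ s"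
    if "\<forall>i\<in>{1..k}. ell i > 0" "a \<in> {1..k}" for ell a
  proof -
    have "Poly_Mapping.lookup (\<alpha> ell) a = (\<Sum>i=1..k. if i = a then ell a * CARD('p) ^ s - 1 else 0)"
      unfolding \<alpha>_def lookup_sum by (intro sum.cong) (auto simp: lookup_single when_def)
    hence "Poly_Mapping.lookup (\<alpha> ell) a = ell a * CARD('p) ^ s - 1" using that(2) by simp
    \<comment> \<open>Positivity of \<open>ell a\<close> makes the subtraction of 1 in the exponent
      exact.\<close>
    moreover have "ell a * CARD('p) ^ s > 0" using that by simp
    ultimately show ?thesis by simp
  qed
  \<comment> \<open>The definite description is resolved by the injectivity of
    \<open>to_fract\<close>.\<close>
  have I: "I_vec s n k m \<kappa> M M2 M0 ell J = Poly_Mapping.lookup (P J) (\<alpha> ell)" for ell J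
    unfolding I_vec_def Psi P \<alpha>_def by simp
  have neg: "negligible n s (\<alpha> ell) lam x" if "x \<approx> 0" for ell lam x
    using that unfolding R.congr_def unfolding q_def S_def by (intro negligible_power) simp
  have negD: "negligible n s (\<alpha> ell) lam (deriv_t a x)"
    if "\<forall>i\<in>{1..k}. ell i > 0" "a \<in> {1..k}" "x \<in> S" for ell lam a x
    unfolding deriv_t_def using that \<alpha> unfolding S_def by (intro negligible_deriv) blast+

  have KZ: "KZ_solution_mod s n k m \<kappa> lam (I_vec s n k m \<kappa> M M2 M0 ell)"
    if ell: "\<forall>i\<in>{1..k}. ell i > 0" for ell and lam :: "'p padic_int"
    unfolding KZ_solution_mod_def Let_def
  proof (intro ballI)
    fix i J assume i: "i \<in> {1..n}" and J: "J \<in> multi_indices n m k"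
    let ?u = "\<lambda>J. subst_lam lam (I_vec s n k m \<kappa> M M2 M0 ell J)"
    let ?z = "\<lambda>l. to_fract (mvar l) :: 'p zpoly fract"
    let ?hc = "has_coeff (\<alpha> ell) lam"
    have u: "?hc (U J) (?u J)" for J
      unfolding P I by (rule has_coeff_to_fract)
    have dz: "deriv_z i E \<approx> ?p * lam_var * of_nat (m i) * h / 2 * E"
    proof -
      have "deriv_z i E \<approx> ((\<Sum>l=1..n. ?p * (of_nat (m l) * (deriv_z i (z_var l) * lam_var + z_var l * deriv_z i lam_var) * (h / 2)))
          + (\<Sum>b=1..k. ?p * - ((deriv_z i (t_var b) * lam_var + t_var b * deriv_z i lam_var) * h))) * E"
        by (rule exp_factor(2)) (auto simp: derivations deriv_z_values zeroS)
      also have "(\<Sum>b=1..k. ?p * - ((deriv_z i (t_var b) * lam_var + t_var b * deriv_z i lam_var) * h)) = 0"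
        by (simp add: deriv_z_values)
      also have "(\<Sum>l=1..n. ?p * (of_nat (m l) * (deriv_z i (z_var l) * lam_var + z_var l * deriv_z i lam_var) * (h / 2))) =
          (\<Sum>l=1..n. if l = i then ?p * lam_var * of_nat (m i) * h / 2 else 0)"
        by (intro sum.cong refl) (simp add: deriv_z_values)
      also have "\<dots> = ?p * lam_var * of_nat (m i) * h / 2" using i by simp
      finally show ?thesis by simp
    qed
    \<comment> \<open>\<open>X\<close> is the defect of the equation before a coefficient in t is
      taken and before \<lambda> is specialized; \<open>T\<close> below is the correction by
      derivatives in t.\<close>
    define X where "X = deriv_z i (U J) - h * (?p * lam_var / 2 * act m sl2_h i U J
      + (\<Sum>j\<in>{1..n} - {i}. Omega m i j U J / (z_var i - z_var j)))"
    define T where "T = (\<Sum>c\<in>colorings k n J. \<Sum>a\<in>{a\<in>{1..k}. c a = i}. deriv_t a (E * (B * W c)))"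
    have "X + T \<approx> 0" unfolding X_def T_def
      by (rule kz_congruence[OF derivations(2)]) (use i J dz dt in \<open>auto simp: derivations deriv_t_values deriv_z_values\<close>)
    moreover have "negligible n s (\<alpha> ell) lam T"
      unfolding T_def
      by (intro negligible_sum negD ell R.S_mult E_S BW) auto
    \<comment> \<open>\<open>X\<close> itself need not be a multiple of the prime power, but its
      coefficient is, as a difference of two negligible ones.\<close>
    ultimately have "negligible n s (\<alpha> ell) lam (X + T + - T)"
      by (rule negligible_add[OF neg negligible_uminus])
    hence "negligible n s (\<alpha> ell) lam X" by simp
    moreover have "?hc X (subst_lam lam (map_poly (mderiv i) (I_vec s n k m \<kappa> M M2 M0 ell J))
           - 1 / of_rat \<kappa> *
               (of_nat CARD('p) * (to_fract (mconst lam) / 2) * act m sl2_h i ?u J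
                + (\<Sum>j\<in>{1..n} - {i}. Omega m i j ?u J / (?z i - ?z j))))"
      unfolding X_def hG h_def
    proof (intro has_coeff_diff has_coeff_const has_coeff_add has_coeff_sum)
      show "?hc (deriv_z i (U J)) (subst_lam lam (map_poly (mderiv i) (I_vec s n k m \<kappa> M M2 M0 ell J)))"
        unfolding P I deriv_z_def fract_deriv_to_fract[OF d_z]
          lookup_map_derivation[OF derivation_map_poly[OF derivation_mderiv], symmetric]
        by (rule has_coeff_to_fract)
      have "?hc (of_nat CARD('p) * (lam_var * (act m sl2_h i U J / 2)))
          (of_nat CARD('p) * (subst_lam lam [:0, 1:] * (act m sl2_h i ?u J / 2)))"
        by (intro has_coeff_of_nat has_coeff_lam_var has_coeff_half has_coeff_act u)
      thus "?hc (?p * lam_var / 2 * act m sl2_h i U J)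
          (of_nat CARD('p) * (to_fract (mconst lam) / 2) * act m sl2_h i ?u J)"
        by (simp add: subst_lam_def mult.assoc)
      fix j assume "j \<in> {1..n} - {i}"
      hence ij: "i \<noteq> j" by auto
      \<comment> \<open>The denominator is a polynomial in z alone, as \<open>has_coeff\<close>
        demands.\<close>
      have zz: "z_var i - z_var j = to_fract (mconst [:mvar i - mvar j :: 'p zpoly:])"
        and "?z i - ?z j = to_fract (mvar i - mvar j)"
        by (simp_all add: z_var_def mconst_def flip: to_fract_diff single_diff)
      have "mvar i - mvar j \<noteq> (0 :: 'p zpoly)"
        using variables_distinct(2)[OF ij, where 'p = 'p] unfolding z_var_def by auto
      hence "?hc (Omega m i j U J / to_fract (mconst [:mvar i - mvar j :: 'p zpoly:]))
          (Omega m i j ?u J / to_fract (mvar i - mvar j))"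
        by (intro has_coeff_divide has_coeff_Omega u)
      thus "?hc (Omega m i j U J / (z_var i - z_var j)) (Omega m i j ?u J / (?z i - ?z j))"
        unfolding zz by simp
    qed
    ultimately show "subst_lam lam (map_poly (mderiv i) (I_vec s n k m \<kappa> M M2 M0 ell J))
           - 1 / of_rat \<kappa> *
               (of_nat CARD('p) * (to_fract (mconst lam) / 2) * act m sl2_h i ?u J
                + (\<Sum>j\<in>{1..n} - {i}. Omega m i j ?u J / (?z i - ?z j))) \<in> p_power_R s n"
      using has_coeff_negligible by blast
  qed

  have DYN: "dynamical_solution_mod s n k m \<kappa> lam (I_vec s n k m \<kappa> M M2 M0 ell)"
    if ell: "\<forall>i\<in>{1..k}. ell i > 0" and unit: "lam dvd 1" for ell and lam :: "'p padic_int"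
    unfolding dynamical_solution_mod_def Let_def
  proof (intro ballI)
    fix J assume J: "J \<in> multi_indices n m k"
    let ?u = "\<lambda>J. subst_lam lam (I_vec s n k m \<kappa> M M2 M0 ell J)"
    let ?z = "\<lambda>l. to_fract (mvar l) :: 'p zpoly fract"
    let ?lc = "to_fract (mconst lam) :: 'p zpoly fract"
    let ?hc = "has_coeff (\<alpha> ell) lam"
    obtain mu where mu: "1 = lam * mu" using unit by (rule dvdE)
    have "to_fract (mconst (lam * mu)) = (1 :: 'p zpoly fract)" unfolding mu[symmetric] by simp
    hence lmu: "?lc * to_fract (mconst mu) = 1" by (simp only: mconst_mult to_fract_mult)
    have u: "?hc (U J) (?u J)" for J
      unfolding P I by (rule has_coeff_to_fract)
    have dl: "deriv_lam E \<approx> ?p * h * ((\<Sum>l=1..n. z_var l / 2 * of_nat (m l)) - (\<Sum>a=1..k. t_var a)) * E"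
    proof -
      have "deriv_lam E \<approx> ((\<Sum>l=1..n. ?p * (of_nat (m l) * (deriv_lam (z_var l) * lam_var + z_var l * deriv_lam lam_var) * (h / 2)))
          + (\<Sum>b=1..k. ?p * - ((deriv_lam (t_var b) * lam_var + t_var b * deriv_lam lam_var) * h))) * E"
        by (rule exp_factor(2)) (auto simp: derivations deriv_lam_values zeroS)
      also have "(\<Sum>b=1..k. ?p * - ((deriv_lam (t_var b) * lam_var + t_var b * deriv_lam lam_var) * h)) =
          - (?p * h * (\<Sum>a=1..k. t_var a))"
        unfolding sum_distrib_left sum_negf[symmetric]
        by (intro sum.cong refl) (simp add: deriv_lam_values)
      also have "(\<Sum>l=1..n. ?p * (of_nat (m l) * (deriv_lam (z_var l) * lam_var + z_var l * deriv_lam lam_var) * (h / 2))) =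
          ?p * h * (\<Sum>l=1..n. z_var l / 2 * of_nat (m l))"
        unfolding sum_distrib_left by (intro sum.cong refl) (simp add: deriv_lam_values)
      finally show ?thesis by (simp add: right_diff_distrib)
    qed
    \<comment> \<open>Here \<open>X\<close> is \<lambda> times the defect, so that the equation is
      free of denominators in \<lambda>, which \<open>has_coeff\<close> would not admit.\<close>
    define X where "X = lam_var * (deriv_lam (U J) - h * (?p * (\<Sum>i=1..n. z_var i / 2 * act m sl2_h i U J)))
      - h * (\<Sum>i=1..n. \<Sum>j=1..n. act m sl2_f i (act m sl2_e j U) J)"
    define T where "T = (\<Sum>c\<in>colorings k n J. \<Sum>a=1..k. deriv_t a (E * (B * V c a)))"
    have "X - T \<approx> 0" unfolding X_def T_def
      by (rule dynamical_congruence[OF derivations(3)]) (use J dl dt lamS in \<open>auto simp: derivations deriv_t_values deriv_lam_values\<close>)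
    moreover have "negligible n s (\<alpha> ell) lam T"
      unfolding T_def
      by (intro negligible_sum negD ell R.S_mult E_S BV) auto
    ultimately have "negligible n s (\<alpha> ell) lam (X - T + T)"
      by (rule negligible_add[OF neg])
    hence "negligible n s (\<alpha> ell) lam X" by simp
    moreover have "?hc X (subst_lam lam [:0, 1:] * (subst_lam lam (pderiv (I_vec s n k m \<kappa> M M2 M0 ell J))
           - to_fract (mconst hc) * (of_nat CARD('p) * (\<Sum>i=1..n. subst_lam lam [:mvar i:] * (act m sl2_h i ?u J / 2))))
           - to_fract (mconst hc) * (\<Sum>i=1..n. \<Sum>j=1..n. act m sl2_f i (act m sl2_e j ?u) J))"
    proof -
      \<comment> \<open>The factor one half is moved from z to the vector, where
        \<open>has_coeff_half\<close> applies.\<close>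
      have X: "X = lam_var * (deriv_lam (U J) - h * (?p * (\<Sum>i=1..n. z_var i * (act m sl2_h i U J / 2))))
        - h * (\<Sum>i=1..n. \<Sum>j=1..n. act m sl2_f i (act m sl2_e j U) J)"
        by (simp add: X_def)
      have "?hc (deriv_lam (U J)) (subst_lam lam (pderiv (I_vec s n k m \<kappa> M M2 M0 ell J)))"
        unfolding P I deriv_lam_def fract_deriv_to_fract[OF d_lam]
          lookup_map_derivation[OF derivation_pderiv, symmetric]
        by (rule has_coeff_to_fract)
      thus ?thesis
        unfolding X h_def
        by (intro has_coeff_diff has_coeff_lam_var has_coeff_z_var has_coeff_const has_coeff_of_nat has_coeff_sum
            has_coeff_half has_coeff_act u)
    qed
    ultimately have "subst_lam lam [:0, 1:] * (subst_lam lam (pderiv (I_vec s n k m \<kappa> M M2 M0 ell J))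
           - to_fract (mconst hc) * (of_nat CARD('p) * (\<Sum>i=1..n. subst_lam lam [:mvar i:] * (act m sl2_h i ?u J / 2))))
           - to_fract (mconst hc) * (\<Sum>i=1..n. \<Sum>j=1..n. act m sl2_f i (act m sl2_e j ?u) J) \<in> p_power_R s n"
      (is "?Y \<in> _") using has_coeff_negligible by blast
    \<comment> \<open>The unit hypothesis enters only now: multiplying by the constant
      \<open>mu\<close>, the inverse of \<open>lam\<close>, stays in R and restores the equation
      with its term in \<open>1 / \<lambda>\<close>.\<close>
    hence "to_fract (mconst mu) * ?Y \<in> p_power_R s n"
      by (intro p_power_R_mult ring_R.const)
    moreover have "subst_lam lam (pderiv (I_vec s n k m \<kappa> M M2 M0 ell J))
           - 1 / of_rat \<kappa> *
               (of_nat CARD('p) * (\<Sum>i=1..n. ?z i / 2 * act m sl2_h i ?u J)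
                + (\<Sum>i=1..n. \<Sum>j=1..n. act m sl2_f i (act m sl2_e j ?u) J / ?lc)) =
        to_fract (mconst mu) * ?Y"
    proof -
      define A where "A = subst_lam lam (pderiv (I_vec s n k m \<kappa> M M2 M0 ell J))"
      define H where "H = (\<Sum>i=1..n. ?z i / 2 * act m sl2_h i ?u J)"
      define F where "F = (\<Sum>i=1..n. \<Sum>j=1..n. act m sl2_f i (act m sl2_e j ?u) J)"
      have lz: "?lc \<noteq> 0" using lmu by auto
      have mu': "to_fract (mconst mu) = 1 / ?lc" using lmu lz by (simp add: field_simps)
      have 1: "(\<Sum>i=1..n. subst_lam lam [:mvar i:] * (act m sl2_h i ?u J / 2)) = H"
        by (simp add: H_def subst_lam_pCons_0)
      have 2: "(\<Sum>i=1..n. \<Sum>j=1..n. act m sl2_f i (act m sl2_e j ?u) J / ?lc) = F / ?lc"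
        by (simp add: F_def sum_divide_distrib)
      have 3: "subst_lam lam [:0, 1:] = ?lc" by (simp add: subst_lam_def)
      show ?thesis
        unfolding 1 2 3 hG mu' A_def[symmetric] H_def[symmetric] F_def[symmetric]
        using lz by (simp add: field_simps)
    qed
    ultimately show "subst_lam lam (pderiv (I_vec s n k m \<kappa> M M2 M0 ell J))
           - 1 / of_rat \<kappa> *
               (of_nat CARD('p) * (\<Sum>i=1..n. ?z i / 2 * act m sl2_h i ?u J)
                + (\<Sum>i=1..n. \<Sum>j=1..n. act m sl2_f i (act m sl2_e j ?u) J / ?lc)) \<in> p_power_R s n"
      by simp
  qed
  show ?thesis using KZ DYN P Psi by metis
qed

end
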